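(* Let $X$ be an upwards skip-free Lévy chain on $\mathbb{Z}_h$. For each $x\ge0$, $$\mathsf{E}\left[e^{-qT_x^-}\mathbf{1}_{\{T_x^-<\infty\}}\right]=Z^{(q)}(x)-\frac{qh}{e^{\Phi(q)h}-1}W^{(q)}(x)$$ when $q>0$, and $\mathsf{P}(T_x^-<\infty)=1-W(x)/W(+\infty)$. The Laplace transform of $Z^{(q)}$, $q\ge0$, is given by $$\widehat{Z^{(q)}}(\beta)=\int_0^\infty Z^{(q)}(x)e^{-\beta x}\,dx=\frac1\beta\left(1+\frac{q}{\psi(\beta)-q}\right)\qquad(\beta>\Phi(q)).$$
   Context: Fix $h>0$; $\mathbb{Z}_h:=\{hk:k\in\mathbb{Z}\}$. $X$ is an upwards skip-free Lévy chain: a Lévy process (càdlàg paths, $X_0=0$ a.s.) that is compound Poisson (finite Lévy measure $\lambda$, no drift, no Gaussian part) with $\lambda$ supported in $\mathbb{Z}_h$ and with $\lambda|_{(0,\infty)}$ having support exactly $\{h\}$ (so $\lambda(\{h\})>0$). $\psi(\beta)=\int_{\mathbb{R}}(e^{\beta x}-1)\lambda(dx)$, $\beta\ge0$, is the Laplace exponent; it is strictly convex and continuous on $[0,\infty)$ and tends to $+\infty$; $\Phi(0)$ is the largest root of $\psi|_{[0,\infty)}$, and $\Phi:[0,\infty)\to[\Phi(0),\infty)$ is the inverse of the increasing bijection $\psi:[\Phi(0),\infty)\to[0,\infty)$. $T_x^-:=\inf\{t\ge0:X_t<-x\}$ for $x\ge0$ ($\inf\emptyset=+\infty$). Scale functions: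 with $T_h:=\inf\{t\ge0:X_t\ge h\}$ and $D_1:=-\inf\{X_s:0\le s\le T_h,\ s<\infty\}$, the scale function of $X$ is $W(x)=c/\prod_{r=1}^{\lfloor x/h\rfloor}\mathsf{P}(D_1\le(r-1)h)$, $x\ge0$, where $c>0$ is chosen so that $\int_0^\infty e^{-\beta x}W(x)\,dx=\frac{e^{\beta h}-1}{\beta h\psi(\beta)}$ for $\beta>\Phi(0)$; $W(+\infty):=\lim_{x\to\infty}W(x)\in(0,\infty]$ (with $W(x)/\infty=0$). For $b\ge0$, $W_b$ denotes the scale function (defined in the same way, with the same normalization relative to its own Laplace exponent) of the upwards skip-free Lévy chain with Lévy measure $e^{bx}\lambda(dx)$, whose Laplace exponent is $\psi(\cdot+b)-\psi(b)$. For $q\ge0$ and $x\ge0$, $W^{(q)}(x):=e^{\Phi(q)\lfloor1+x/h\rfloor h}W_{\Phi(q)}(x)$ (so $W^{(0)}=W$) and $Z^{(q)}(x):=1+q\int_0^{\lfloor x/h\rfloor h}W^{(q)}(z)\,dz$. *)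

theory Defs
  imports "HOL-Probability.Probability"
begin

definition cadlag :: "(real \<Rightarrow> real) \<Rightarrow> bool" where
  "cadlag f \<longleftrightarrow>
     (\<forall>t\<ge>0. (f \<longlongrightarrow> f t) (at_right t)) \<and> (\<forall>t>0. \<exists>l. (f \<longlongrightarrow> l) (at_left t))"

text \<open>The time index of a process ranges over the nonnegative reals; the values at negative
  times are irrelevant.\<close>

locale levy_process = prob_space M for M :: "'a measure" +
  fixes X :: "real \<Rightarrow> 'a \<Rightarrow> real"
  assumes measurable_at: "\<And>t. 0 \<le> t \<Longrightarrow> X t \<in> borel_measurable M"
    and start: "AE \<omega> in M. X 0 \<omega> = 0"
    and cadlag_paths: "\<And>\<omega>. \<omega> \<in> space M \<Longrightarrow> cadlag (\<lambda>t. X t \<omega>)"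
    and stationary_increments: "\<And>s t. 0 \<le> s \<Longrightarrow> 0 \<le> t \<Longrightarrow>
      distr M borel (\<lambda>\<omega>. X (s + t) \<omega> - X s \<omega>) = distr M borel (X t)"
    and independent_increments: "\<And>(n::nat) (t :: nat \<Rightarrow> real).
      0 \<le> t 0 \<Longrightarrow> (\<And>i. i < n \<Longrightarrow> t i < t (Suc i)) \<Longrightarrow>
      indep_vars (\<lambda>_. borel) (\<lambda>i \<omega>. X (t (Suc i)) \<omega> - X (t i) \<omega>) {..<n}"

text \<open>Topological support of a Borel measure.\<close>

definition msupport :: "real measure \<Rightarrow> real set" where
  "msupport \<mu> = {x. \<forall>U. open U \<longrightarrow> x \<in> U \<longrightarrow> 0 < emeasure \<mu> U}"

definition lattice_points :: "real \<Rightarrow> real set" where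
  "lattice_points h = {h * of_int k | k :: int. True}"

text \<open>Compound Poisson means: finite Levy measure and Levy-Khintchine exponent without drift
  and Gaussian part. The density in the last assumption is the restriction of the Levy measure
  to the positive half-line.\<close>

locale upwards_skip_free_levy_chain = levy_process M X
  for M :: "'a measure" and X :: "real \<Rightarrow> 'a \<Rightarrow> real" +
  fixes h :: real and \<Lambda> :: "real measure"
  assumes h_pos: "0 < h"
    and sets_levy_measure: "sets \<Lambda> = sets borel"
    and finite_levy_measure: "finite_measure \<Lambda>"
    and levy_measure_zero: "emeasure \<Lambda> {0} = 0"
    and compound_Poisson: "\<And>t u. 0 \<le> t \<Longrightarrow>
      char (distr M borel (X t)) u = exp (of_real t * (CLINT x|\<Lambda>. (iexp (u * x) - 1)))"
    and levy_measure_lattice: "msupport \<Lambda> \<subseteq> lattice_points h"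
    and skip_free: "msupport (density \<Lambda> (indicator {0<..})) = {h}"

definition laplace_exponent :: "real measure \<Rightarrow> real \<Rightarrow> real" where
  "laplace_exponent \<Lambda> \<beta> = (LINT x|\<Lambda>. (exp (\<beta> * x) - 1))"

definition largest_root :: "real measure \<Rightarrow> real" where
  "largest_root \<Lambda> = (GREATEST \<beta>. 0 \<le> \<beta> \<and> laplace_exponent \<Lambda> \<beta> = 0)"

text \<open>The function \<open>\<Phi>\<close>, inverse of the Laplace exponent to the right of its largest root.\<close>

definition Phi :: "real measure \<Rightarrow> real \<Rightarrow> real" where
  "Phi \<Lambda> q = the_inv_into {largest_root \<Lambda>..} (laplace_exponent \<Lambda>) q"

definition passage_below :: "(real \<Rightarrow> 'a \<Rightarrow> real) \<Rightarrow> real \<Rightarrow> 'a \<Rightarrow> ereal" where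
  "passage_below X x \<omega> = Inf {ereal t | t. 0 \<le> t \<and> X t \<omega> < - x}"

definition passage_above :: "(real \<Rightarrow> 'a \<Rightarrow> real) \<Rightarrow> real \<Rightarrow> 'a \<Rightarrow> ereal" where
  "passage_above X x \<omega> = Inf {ereal t | t. 0 \<le> t \<and> X t \<omega> \<ge> x}"

text \<open>The depth \<open>D\<^sub>1\<close> reached up to the first passage to \<open>h\<close>, possibly \<open>\<infinity>\<close> when \<open>h\<close> is
  never reached.\<close>

definition first_depth :: "(real \<Rightarrow> 'a \<Rightarrow> real) \<Rightarrow> real \<Rightarrow> 'a \<Rightarrow> ereal" where
  "first_depth X h \<omega> =
     - (INF s\<in>{s. 0 \<le> s \<and> ereal s \<le> passage_above X h \<omega>}. ereal (X s \<omega>))"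

text \<open>The completion is harmless and only serves to make the event measurable: paths are
  lattice-valued only almost surely, and off that event a cadlag path may approach \<open>h\<close> without
  attaining it.\<close>

definition depth_prob :: "'a measure \<Rightarrow> (real \<Rightarrow> 'a \<Rightarrow> real) \<Rightarrow> real \<Rightarrow> real \<Rightarrow> real" where
  "depth_prob M X h y = measure (completion M) {\<omega> \<in> space M. first_depth X h \<omega> \<le> ereal y}"

definition scale_with_const ::
  "'a measure \<Rightarrow> (real \<Rightarrow> 'a \<Rightarrow> real) \<Rightarrow> real \<Rightarrow> real \<Rightarrow> real \<Rightarrow> real" where
  "scale_with_const M X h c x =
     c / (\<Prod>r = 1..nat \<lfloor>x / h\<rfloor>. depth_prob M X h ((real r - 1) * h))"

definition scale_const ::
  "'a measure \<Rightarrow> (real \<Rightarrow> 'a \<Rightarrow> real) \<Rightarrow> real \<Rightarrow> real measure \<Rightarrow> real" where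
  "scale_const M X h \<Lambda> = (THE c. 0 < c \<and> (\<forall>\<beta>>Phi \<Lambda> 0.
     (LBINT x:{0..}. exp (- \<beta> * x) * scale_with_const M X h c x)
       = (exp (\<beta> * h) - 1) / (\<beta> * h * laplace_exponent \<Lambda> \<beta>)))"

text \<open>The scale function \<open>W\<close> of the chain \<open>X\<close> with Levy measure \<open>\<Lambda>\<close>.\<close>

definition scale_fun ::
  "'a measure \<Rightarrow> (real \<Rightarrow> 'a \<Rightarrow> real) \<Rightarrow> real \<Rightarrow> real measure \<Rightarrow> real \<Rightarrow> real" where
  "scale_fun M X h \<Lambda> x = scale_with_const M X h (scale_const M X h \<Lambda>) x"

text \<open>\<open>W(+\<infinity>)\<close>, in the extended reals so that division by \<open>\<infinity>\<close> gives \<open>0\<close>.\<close>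

definition scale_fun_limit ::
  "'a measure \<Rightarrow> (real \<Rightarrow> 'a \<Rightarrow> real) \<Rightarrow> real \<Rightarrow> real measure \<Rightarrow> ereal" where
  "scale_fun_limit M X h \<Lambda> = Lim at_top (\<lambda>x. ereal (scale_fun M X h \<Lambda> x))"

definition tilt :: "real measure \<Rightarrow> real \<Rightarrow> real measure" where
  "tilt \<Lambda> b = density \<Lambda> (\<lambda>x. ennreal (exp (b * x)))"

text \<open>The chain with a given Levy measure is determined in law only, and the scale function depends
  on nothing but its law. We therefore pick an arbitrary realization; sample spaces of real
  sequences are rich enough for one to exist.\<close>

definition chain_realization ::
  "real \<Rightarrow> real measure \<Rightarrow> (nat \<Rightarrow> real) measure \<times> (real \<Rightarrow> (nat \<Rightarrow> real) \<Rightarrow> real)" where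
  "chain_realization h \<Lambda> = (SOME (N, Y). upwards_skip_free_levy_chain N Y h \<Lambda>)"

definition tilted_scale_fun :: "real \<Rightarrow> real measure \<Rightarrow> real \<Rightarrow> real \<Rightarrow> real" where
  "tilted_scale_fun h \<Lambda> b x =
     (let (N, Y) = chain_realization h (tilt \<Lambda> b) in scale_fun N Y h (tilt \<Lambda> b) x)"

text \<open>The functions \<open>W\<^sup>(\<^sup>q\<^sup>)\<close> and \<open>Z\<^sup>(\<^sup>q\<^sup>)\<close>.\<close>

definition Wq :: "real \<Rightarrow> real measure \<Rightarrow> real \<Rightarrow> real \<Rightarrow> real" where
  "Wq h \<Lambda> q x =
     exp (Phi \<Lambda> q * of_int \<lfloor>1 + x / h\<rfloor> * h) * tilted_scale_fun h \<Lambda> (Phi \<Lambda> q) x"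

definition Zq :: "real \<Rightarrow> real measure \<Rightarrow> real \<Rightarrow> real \<Rightarrow> real" where
  "Zq h \<Lambda> q x = 1 + q * (LBINT z:{0..of_int \<lfloor>x / h\<rfloor> * h}. Wq h \<Lambda> q z)"

end

theory Submission
  imports Defs
begin

text \<open>On the lattice, write \<open>p\<close> for the rate of the jump \<open>h\<close>, \<open>a\<^sub>k\<close> for the rate of the jump \<open>- k h\<close>
  and \<open>\<lambda>\<close> for the total rate. Sample the chain at the times \<open>k / 2\<^sup>m\<close>. For the sampled random walk, the
  discounted probability of exiting downwards before reaching an upper barrier satisfies an exact
  one-step equation. Since \<open>E f (X\<^sub>\<delta>) = e\<^sup>-\<^sup>\<lambda>\<^sup>\<delta> (f 0 + \<delta> \<integral> f d\<Lambda>) + O(\<delta>\<^sup>2)\<close>, this equation becomes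
  \<open>(\<lambda> + q) F n = p F (n + 1) + \<Sum>\<^sub>k a\<^sub>k F (n - k)\<close> as the grid is refined; neither the strong Markov property
  nor the jump structure of the paths is needed.

  Upwards skip-freeness means that \<open>p\<close> multiplies the only term ahead of \<open>n\<close>, so a solution is
  determined by its value at \<open>0\<close>. For \<open>q = 0\<close> and a barrier at \<open>N\<close> this gives the two-sided exit
  probability \<open>W n / W N\<close>, hence the depth probabilities \<open>W n / W (n + 1)\<close> and the telescoping product
  in the definition of the scale function; letting \<open>N\<close> tend to infinity gives the probability of
  ruin. For \<open>q > 0\<close> without a barrier, the generating function of the bounded solution, evaluated at
  \<open>exp (- \<Phi> q h)\<close>, a zero of its denominator, yields the value at \<open>0\<close>.

  The chains tilted by \<open>\<Phi> q\<close> must exist for \<open>W\<^sup>q\<close> to mean anything. They are built from independent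
  compound Poisson blocks on unit time intervals; their joint characteristic function factorises, which
  gives independent increments by Levy's uniqueness theorem in one coordinate at a time.\<close>

section \<open>Independence from characteristic functions\<close>

text \<open>The paths enter only when the grid is refined. Between grid times a path might touch the
  upper barrier for an instant and then leave downwards unseen; right continuity together with
  lattice values excludes this, since the path then cannot drop immediately. Crossing below the
  level \<open>0\<close> is an open condition, for which right continuity alone is enough. The
  recurrence for the scale sequence contains a subtraction, so neither the sign nor the growth of
  its terms is visible. Positivity comes from reading ratios of terms as probabilities; for
  \<open>q > 0\<close> this is done after tilting by \<open>Phi \<Lambda> q\<close>, which turns the
  total rate plus \<open>q\<close> into the total rate of the tilted chain. Convergence of the
  generating function, without which formal manipulation gives nothing, comes from the positive
  drift of a tilted chain. Every scale function turns out to be a sequence computed from the Levy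
  measure alone. Hence the arbitrary choice of a realization in the tilted scale function is
  harmless as soon as one realization exists.\<close>

lemma (in prob_space) char_weight_nonneg:
  fixes w V :: "'a \<Rightarrow> real"
  assumes V[measurable]: "V \<in> borel_measurable M" and w[measurable]: "w \<in> borel_measurable M"
    and w0: "\<And>\<omega>. 0 \<le> w \<omega>" and wK: "\<And>\<omega>. w \<omega> \<le> K"
    and char: "\<And>u. (CLINT \<omega>|M. w \<omega> * iexp (u * V \<omega>)) = of_real c * (CLINT \<omega>|M. iexp (u * V \<omega>))"
    and A: "A \<in> sets borel"
  shows "(\<integral>\<omega>. w \<omega> * indicator A (V \<omega>) \<partial>M) = c * prob (V -` A \<inter> space M)"
proof -
  note [measurable] = A
  have iw: "integrable M w"
    by (rule integrable_const_bound[where B=K]) (use w0 wK in auto)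
  have c: "(\<integral>\<omega>. w \<omega> \<partial>M) = c"
  proof -
    have "complex_of_real (\<integral>\<omega>. w \<omega> \<partial>M) = of_real c"
      using char[of 0] by (simp add: prob_space)
    thus ?thesis using of_real_eq_iff by blast
  qed
  have c0: "0 \<le> c" using c w0 by (metis integral_nonneg_AE AE_I2)
  show ?thesis
  proof (cases "c = 0")
    case True
    hence "AE \<omega> in M. w \<omega> = 0"
      using c w0 integral_nonneg_eq_0_iff_AE[OF iw] by auto
    hence "(\<integral>\<omega>. w \<omega> * indicator A (V \<omega>) \<partial>M) = (\<integral>\<omega>. 0 \<partial>M)"
      by (intro integral_cong_AE) auto
    thus ?thesis using True by simp
  next
    case False
    hence cp: "0 < c" using c0 by simp
    \<comment> \<open>The weight divided by its mean is a density. Under it \<open>V\<close> has the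
      same characteristic function as under \<open>M\<close>, hence the same law.\<close>
    define N where "N = density M (\<lambda>\<omega>. ennreal (w \<omega> / c))"
    have wc: "0 \<le> w \<omega> / c" for \<omega> using w0 cp by simp
    have N: "prob_space N"
    proof (rule prob_spaceI)
      have "emeasure N (space N) = (\<integral>\<^sup>+ \<omega>. ennreal (w \<omega> / c) \<partial>M)"
        by (simp add: N_def emeasure_density cong: nn_integral_cong)
      also have "\<dots> = ennreal (\<integral>\<omega>. w \<omega> / c \<partial>M)"
        by (rule nn_integral_eq_integral) (use iw wc in auto)
      finally show "emeasure N (space N) = 1" using c cp by simp
    qed
    have [measurable]: "V \<in> borel_measurable N" by (simp add: N_def)
    have "real_distribution (distr N borel V)" "real_distribution (distr M borel V)"
      using prob_space.real_distribution_distr[OF N] real_distribution_distr by auto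
    moreover have "char (distr N borel V) = char (distr M borel V)"
    proof
      fix u
      have "char (distr N borel V) u = (CLINT \<omega>|N. iexp (u * V \<omega>))"
        by (simp add: char_def integral_distr)
      also have "\<dots> = (CLINT \<omega>|M. (w \<omega> / c) *\<^sub>R iexp (u * V \<omega>))"
        unfolding N_def by (rule integral_density) (use wc in auto)
      also have "\<dots> = (CLINT \<omega>|M. w \<omega> * iexp (u * V \<omega>)) / c"
        by (simp add: scaleR_conv_of_real divide_inverse mult_ac flip: integral_mult_right_zero)
      also have "\<dots> = char (distr M borel V) u"
        unfolding char using cp by (simp add: char_def integral_distr)
      finally show "char (distr N borel V) u = char (distr M borel V) u" .
    qed
    ultimately have eq: "distr N borel V = distr M borel V" by (rule Levy_uniqueness)
    have "prob (V -` A \<inter> space M) = measure N (V -` A \<inter> space M)"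
      using arg_cong[OF eq, of "\<lambda>D. measure D A"] by (simp add: measure_distr N_def)
    also have "\<dots> = (\<integral>\<omega>. indicator (V -` A \<inter> space M) \<omega> \<partial>N)" by (simp add: N_def)
    also have "\<dots> = (\<integral>\<omega>. (w \<omega> / c) *\<^sub>R indicator (V -` A \<inter> space M) \<omega> \<partial>M)"
      unfolding N_def by (rule integral_density) (use wc in auto)
    also have "\<dots> = (\<integral>\<omega>. w \<omega> * indicator A (V \<omega>) / c \<partial>M)"
      by (rule Bochner_Integration.integral_cong) (auto simp: indicator_def)
    finally show ?thesis using cp by simp
  qed
qed

text \<open>A constant weight \<open>K\<close> satisfies the hypothesis with constant
  \<open>K\<close>, so \<open>w + K\<close> is admissible with \<open>c + K\<close> and is
  nonnegative.\<close>

lemma (in prob_space) char_weight_real: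
  fixes w V :: "'a \<Rightarrow> real"
  assumes V[measurable]: "V \<in> borel_measurable M" and w[measurable]: "w \<in> borel_measurable M"
    and wK: "\<And>\<omega>. \<bar>w \<omega>\<bar> \<le> K"
    and char: "\<And>u. (CLINT \<omega>|M. w \<omega> * iexp (u * V \<omega>)) = of_real c * (CLINT \<omega>|M. iexp (u * V \<omega>))"
    and A[measurable]: "A \<in> sets borel"
  shows "(\<integral>\<omega>. w \<omega> * indicator A (V \<omega>) \<partial>M) = c * prob (V -` A \<inter> space M)"
proof -
  have i1: "integrable M (\<lambda>\<omega>. iexp (u * V \<omega>))" for u
    by (rule integrable_const_bound[where B=1]) auto
  have K0: "0 \<le> K" using wK by (meson abs_ge_zero order_trans)
  have i2: "integrable M (\<lambda>\<omega>. w \<omega> * iexp (u * V \<omega>))" for u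
    by (rule integrable_const_bound[where B=K]) (auto simp: norm_mult wK)
  have i3: "integrable M (\<lambda>\<omega>. w \<omega> * indicator A (V \<omega>))"
    by (rule integrable_const_bound[where B=K]) (auto simp: abs_mult wK indicator_def K0)
  have i4: "integrable M (\<lambda>\<omega>. indicator A (V \<omega>) :: real)"
    by (rule integrable_const_bound[where B=1]) (auto simp: indicator_def)
  have "(\<integral>\<omega>. (w \<omega> + K) * indicator A (V \<omega>) \<partial>M) = (c + K) * prob (V -` A \<inter> space M)"
  proof (rule char_weight_nonneg[where K="2*K"])
    fix u
    have "(CLINT \<omega>|M. complex_of_real (w \<omega> + K) * iexp (u * V \<omega>))
        = (CLINT \<omega>|M. w \<omega> * iexp (u * V \<omega>) + K * iexp (u * V \<omega>))"
      by (simp add: algebra_simps)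
    also have "\<dots> = (CLINT \<omega>|M. w \<omega> * iexp (u * V \<omega>)) + K * (CLINT \<omega>|M. iexp (u * V \<omega>))"
      using i1 i2 by simp
    finally show "(CLINT \<omega>|M. complex_of_real (w \<omega> + K) * iexp (u * V \<omega>))
        = complex_of_real (c + K) * (CLINT \<omega>|M. iexp (u * V \<omega>))"
      using char by (simp add: algebra_simps)
  next
    fix \<omega> show "0 \<le> w \<omega> + K" "w \<omega> + K \<le> 2 * K" using wK[of \<omega>] by auto
  qed auto
  moreover have "(\<integral>\<omega>. (w \<omega> + K) * indicator A (V \<omega>) \<partial>M)
      = (\<integral>\<omega>. w \<omega> * indicator A (V \<omega>) \<partial>M) + K * (\<integral>\<omega>. indicator A (V \<omega>) \<partial>M)"
    using i3 i4 by (simp add: algebra_simps)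
  moreover have "(\<integral>\<omega>. indicator A (V \<omega>) \<partial>M) = prob (V -` A \<inter> space M)"
  proof -
    have "(\<integral>\<omega>. indicator A (V \<omega>) \<partial>M) = (\<integral>\<omega>. indicator (V -` A \<inter> space M) \<omega> \<partial>M :: real)"
      by (rule Bochner_Integration.integral_cong) (auto simp: indicator_def)
    thus ?thesis by simp
  qed
  ultimately show ?thesis by (simp add: algebra_simps)
qed

text \<open>The hypothesis holds for every \<open>u\<close>, so replacing \<open>u\<close> by
  \<open>- u\<close> and conjugating gives it for \<open>cnj w\<close> with \<open>cnj c\<close>.
  Hence \<open>Re w\<close> and \<open>Im w\<close> are real weights with constants
  \<open>Re c\<close> and \<open>Im c\<close>.\<close>

lemma (in prob_space) char_weight:
  fixes w :: "'a \<Rightarrow> complex" and V :: "'a \<Rightarrow> real"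
  assumes V[measurable]: "V \<in> borel_measurable M" and w[measurable]: "w \<in> borel_measurable M"
    and wK: "\<And>\<omega>. norm (w \<omega>) \<le> K"
    and char: "\<And>u. (CLINT \<omega>|M. w \<omega> * iexp (u * V \<omega>)) = c * (CLINT \<omega>|M. iexp (u * V \<omega>))"
    and A[measurable]: "A \<in> sets borel"
  shows "(CLINT \<omega>|M. w \<omega> * indicator A (V \<omega>)) = c * prob (V -` A \<inter> space M)"
proof -
  have K0: "0 \<le> K" using wK by (meson norm_ge_zero order_trans)
  have [measurable]: "(\<lambda>\<omega>. cnj (w \<omega>)) \<in> borel_measurable M"
    by (intro borel_measurable_continuous_on[OF _ w] continuous_intros)
  have iw: "integrable M (\<lambda>\<omega>. w \<omega> * iexp (u * V \<omega>))" "integrable M (\<lambda>\<omega>. cnj (w \<omega>) * iexp (u * V \<omega>))" for u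
    by (rule integrable_const_bound[where B=K]; auto simp: norm_mult wK)+
  have iA: "integrable M (\<lambda>\<omega>. w \<omega> * indicator A (V \<omega>))"
    by (rule integrable_const_bound[where B=K]) (auto simp: norm_mult wK indicator_def K0)
  have cnj: "(CLINT \<omega>|M. cnj (w \<omega>) * iexp (u * V \<omega>)) = cnj c * (CLINT \<omega>|M. iexp (u * V \<omega>))" for u
  proof -
    have "(CLINT \<omega>|M. cnj (w \<omega>) * iexp (u * V \<omega>)) = (CLINT \<omega>|M. cnj (w \<omega> * iexp ((-u) * V \<omega>)))"
      by (simp add: exp_cnj)
    also have "\<dots> = cnj (c * (CLINT \<omega>|M. iexp ((-u) * V \<omega>)))"
      unfolding Bochner_Integration.integral_cnj char ..
    also have "\<dots> = cnj c * (CLINT \<omega>|M. cnj (iexp ((-u) * V \<omega>)))"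
      by (simp only: complex_cnj_mult Bochner_Integration.integral_cnj)
    finally show ?thesis by (simp add: exp_cnj)
  qed
  have "(\<integral>\<omega>. Re (w \<omega>) * indicator A (V \<omega>) \<partial>M) = Re c * prob (V -` A \<inter> space M)"
  proof (rule char_weight_real[where K=K])
    fix u
    have "(CLINT \<omega>|M. complex_of_real (Re (w \<omega>)) * iexp (u * V \<omega>))
      = (CLINT \<omega>|M. (1/2) * (w \<omega> * iexp (u * V \<omega>) + cnj (w \<omega>) * iexp (u * V \<omega>)))"
      by (intro Bochner_Integration.integral_cong refl)
        (simp add: complex_add_cnj flip: ring_distribs)
    also have "\<dots> = (1/2) * (c + cnj c) * (CLINT \<omega>|M. iexp (u * V \<omega>))"
      using iw by (simp only: integral_mult_right_zero Bochner_Integration.integral_add char cnj)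
        (simp add: algebra_simps)
    finally show "(CLINT \<omega>|M. complex_of_real (Re (w \<omega>)) * iexp (u * V \<omega>))
        = complex_of_real (Re c) * (CLINT \<omega>|M. iexp (u * V \<omega>))" by (simp add: complex_add_cnj)
  qed (auto intro: order_trans[OF abs_Re_le_cmod wK])
  moreover have "(\<integral>\<omega>. Im (w \<omega>) * indicator A (V \<omega>) \<partial>M) = Im c * prob (V -` A \<inter> space M)"
  proof (rule char_weight_real[where K=K])
    fix u
    have im: "complex_of_real (Im z) = (-\<i>/2) * (z - cnj z)" for z
      by (simp add: complex_eq_iff)
    have "(CLINT \<omega>|M. complex_of_real (Im (w \<omega>)) * iexp (u * V \<omega>))
      = (CLINT \<omega>|M. (-\<i>/2) * (w \<omega> * iexp (u * V \<omega>) - cnj (w \<omega>) * iexp (u * V \<omega>)))"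
      by (intro Bochner_Integration.integral_cong refl) (simp add: im algebra_simps)
    also have "\<dots> = (-\<i>/2) * (c - cnj c) * (CLINT \<omega>|M. iexp (u * V \<omega>))"
      using iw by (simp only: integral_mult_right_zero Bochner_Integration.integral_diff char cnj)
        (simp add: field_simps)
    finally show "(CLINT \<omega>|M. complex_of_real (Im (w \<omega>)) * iexp (u * V \<omega>))
        = complex_of_real (Im c) * (CLINT \<omega>|M. iexp (u * V \<omega>))" by (simp add: im)
  qed (auto intro: order_trans[OF abs_Im_le_cmod wK])
  moreover have "Re (CLINT \<omega>|M. w \<omega> * indicator A (V \<omega>)) = (\<integral>\<omega>. Re (w \<omega>) * indicator A (V \<omega>) \<partial>M)"
    "Im (CLINT \<omega>|M. w \<omega> * indicator A (V \<omega>)) = (\<integral>\<omega>. Im (w \<omega>) * indicator A (V \<omega>) \<partial>M)"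
    using iA by (auto simp: indicator_def intro!: Bochner_Integration.integral_cong simp flip: integral_Re integral_Im)
  ultimately show ?thesis by (simp add: complex_eq_iff)
qed

lemma (in prob_space) indep_vars_char:
  fixes V :: "nat \<Rightarrow> 'a \<Rightarrow> real"
  assumes V[measurable]: "\<And>i. i < n \<Longrightarrow> V i \<in> borel_measurable M"
    and char: "\<And>u. (CLINT \<omega>|M. iexp (\<Sum>i<n. u i * V i \<omega>)) = (\<Prod>i<n. CLINT \<omega>|M. iexp (u i * V i \<omega>))"
  shows "indep_vars (\<lambda>_. borel) V {..<n}"
proof (cases "n = 0")
  case True
  thus ?thesis by (simp add: indep_vars_def indep_sets_def)
next
  case False
  define \<phi> where "\<phi> i u = (CLINT \<omega>|M. iexp (u * V i \<omega>))" for i u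
  have \<phi>0: "\<phi> i 0 = 1" for i by (simp add: \<phi>_def prob_space)
  \<comment> \<open>A hybrid statement interpolates between characteristic functions
    (\<open>k = 0\<close>) and probabilities of events (\<open>k = n\<close>). One step turns the
    exponential of coordinate \<open>k\<close> into an indicator; the product of all other factors
    is the weight in \<open>char_weight\<close>.\<close>
  have main: "(CLINT \<omega>|M. (\<Prod>i<k. indicator (A i) (V i \<omega>)) * iexp (\<Sum>i\<in>{k..<n}. u i * V i \<omega>))
      = (\<Prod>i<k. of_real (prob (V i -` A i \<inter> space M))) * (\<Prod>i\<in>{k..<n}. \<phi> i (u i))"
    if "k \<le> n" "\<And>i. i < n \<Longrightarrow> A i \<in> sets borel" for k A u
    using that(1)
  proof (induction k arbitrary: u)
    case 0
    show ?case using char[of u] by (simp add: \<phi>_def lessThan_atLeast0)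
  next
    case (Suc k)
    hence k: "k < n" by simp
    note A = that(2)
    have [measurable]: "k < n" "\<And>i. i < k \<Longrightarrow> i < n" using k by auto
    have [measurable]: "(\<lambda>\<omega>. indicator (A i) (V i \<omega>) :: complex) \<in> borel_measurable M" if "i < n" for i
      using A[OF that] V[OF that] by measurable
    define w where "w \<omega> = (\<Prod>i<k. indicator (A i) (V i \<omega>)) * iexp (\<Sum>i\<in>{Suc k..<n}. u i * V i \<omega>)" for \<omega>
    have [measurable]: "w \<in> borel_measurable M"
      unfolding w_def using k by (intro borel_measurable_times borel_measurable_prod) (auto)
    have ins: "{k..<n} = insert k {Suc k..<n}" using k by auto
    have "(CLINT \<omega>|M. w \<omega> * indicator (A k) (V k \<omega>))
        = ((\<Prod>i<k. of_real (prob (V i -` A i \<inter> space M))) * (\<Prod>i\<in>{Suc k..<n}. \<phi> i (u i)))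
          * prob (V k -` A k \<inter> space M)"
    proof (rule char_weight[where K=1])
      fix v
      have "(CLINT \<omega>|M. w \<omega> * iexp (v * V k \<omega>)) =
         (CLINT \<omega>|M. (\<Prod>i<k. indicator (A i) (V i \<omega>)) * iexp (\<Sum>i\<in>{k..<n}. (u(k:=v)) i * V i \<omega>))"
        unfolding w_def ins
        by (intro Bochner_Integration.integral_cong refl) (simp add: exp_add ring_distribs mult_ac)
      also have "\<dots> = (\<Prod>i<k. of_real (prob (V i -` A i \<inter> space M))) * (\<Prod>i\<in>{k..<n}. \<phi> i ((u(k:=v)) i))"
        by (rule Suc.IH) (use Suc in simp)
      also have "(\<Prod>i\<in>{k..<n}. \<phi> i ((u(k:=v)) i)) = \<phi> k v * (\<Prod>i\<in>{Suc k..<n}. \<phi> i (u i))"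
        unfolding ins by simp
      finally show "(CLINT \<omega>|M. w \<omega> * iexp (v * V k \<omega>)) = ((\<Prod>i<k. of_real (prob (V i -` A i \<inter> space M))) * (\<Prod>i\<in>{Suc k..<n}. \<phi> i (u i)))
          * (CLINT \<omega>|M. iexp (v * V k \<omega>))" by (simp add: \<phi>_def)
    next
      fix \<omega>
      have "norm (\<Prod>i<k. indicator (A i) (V i \<omega>) :: complex) \<le> (\<Prod>i<k. 1)"
        unfolding prod_norm[symmetric] by (rule prod_mono) (auto simp: indicator_def)
      thus "norm (w \<omega>) \<le> 1" by (simp add: w_def norm_mult)
    qed (use k A in auto)
    thus ?case by (simp add: w_def mult_ac)
  qed
  show ?thesis
    unfolding indep_vars_def2
  proof (intro conjI)
    show "\<forall>i\<in>{..<n}. random_variable borel (V i)" using V by auto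
    show "indep_sets (\<lambda>i. {V i -` A \<inter> space M |A. A \<in> sets borel}) {..<n}"
    proof (subst indep_sets_finite)
      show "\<forall>B\<in>(\<Pi> i\<in>{..<n}. {V i -` A \<inter> space M |A. A \<in> sets borel}).
        prob (\<Inter>j\<in>{..<n}. B j) = (\<Prod>j\<in>{..<n}. prob (B j))"
      proof
        fix B assume "B \<in> (\<Pi> i\<in>{..<n}. {V i -` A \<inter> space M |A. A \<in> sets borel})"
        hence "\<forall>i\<in>{..<n}. \<exists>A. A \<in> sets borel \<and> B i = V i -` A \<inter> space M"
          by (simp add: Pi_iff) blast
        from bchoice[OF this] obtain A where A: "\<forall>i\<in>{..<n}. A i \<in> sets borel \<and> B i = V i -` A i \<inter> space M" by blast
        have ev: "(\<Inter>j\<in>{..<n}. B j) \<in> events"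
          using A False by (intro sets.finite_INT) (auto intro!: measurable_sets[OF V])
        have "of_real (prob (\<Inter>j\<in>{..<n}. B j)) = complex_of_real (\<integral>\<omega>. indicator (\<Inter>j\<in>{..<n}. B j) \<omega> \<partial>M)"
          using ev by simp
        also have "\<dots> = (CLINT \<omega>|M. of_real (indicator (\<Inter>j\<in>{..<n}. B j) \<omega>))"
          by (rule integral_of_real[symmetric], rule integrable_const_bound[where B=1]) (use ev in auto)
        also have "\<dots> = (CLINT \<omega>|M. (\<Prod>i<n. indicator (A i) (V i \<omega>)) * iexp (\<Sum>i\<in>{n..<n}. 0 * V i \<omega>))"
          using A by (intro Bochner_Integration.integral_cong refl)
             (auto simp: indicator_def prod.neutral intro!: prod_zero[symmetric])
        also have "\<dots> = of_real (\<Prod>i<n. prob (V i -` A i \<inter> space M))"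
          using main[of n A "\<lambda>_. 0"] A by simp
        finally show "prob (\<Inter>j\<in>{..<n}. B j) = (\<Prod>j\<in>{..<n}. prob (B j))"
          using A by (simp add: of_real_eq_iff del: of_real_prod)
      qed
      show "space M \<in> {V i -` A \<inter> space M |A. A \<in> sets borel}" for i
        by (auto intro!: exI[of _ UNIV])
    qed (use False V in \<open>auto intro: measurable_sets\<close>)
  qed
qed

section \<open>Marked Poisson sums\<close>

lemma integral_pmf_nat:
  fixes f :: "nat \<Rightarrow> 'b::{banach, second_countable_topology}"
  assumes f: "\<And>n. norm (f n) \<le> K"
  shows "(\<lambda>n. pmf p n *\<^sub>R f n) sums (\<integral>n. f n \<partial>measure_pmf p)"
proof -
  have "integrable (measure_pmf p) f"
    by (rule measure_pmf.integrable_const_bound[where B=K]) (use f in auto)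
  hence int: "integrable (count_space UNIV) (\<lambda>n. pmf p n *\<^sub>R f n)"
    unfolding measure_pmf_eq_density by (subst (asm) integrable_density) auto
  have "(\<integral>n. f n \<partial>measure_pmf p) = (\<integral>n. pmf p n *\<^sub>R f n \<partial>count_space UNIV)"
    unfolding measure_pmf_eq_density by (subst integral_density) auto
  thus ?thesis using sums_integral_count_space_nat[OF int] by simp
qed

context sequence_space
begin

lemma integral_coordinate:
  fixes f :: "'a \<Rightarrow> 'c::{banach, second_countable_topology}"
  assumes [measurable]: "f \<in> borel_measurable M"
  shows "(\<integral>\<omega>. f (\<omega> i) \<partial>S) = (\<integral>x. f x \<partial>M)"
proof -
  have "(\<integral>\<omega>. f (\<omega> i) \<partial>S) = (\<integral>x. f x \<partial>distr S M (\<lambda>\<omega>. \<omega> i))"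
    by (rule integral_distr[symmetric]) auto
  thus ?thesis by (simp add: PiM_component)
qed

lemma integral_prod_coordinates:
  fixes f :: "nat \<Rightarrow> 'a \<Rightarrow> complex"
  assumes [measurable]: "\<And>i. f i \<in> borel_measurable M" and f1: "\<And>i x. norm (f i x) \<le> 1"
  shows "(\<integral>\<omega>. (\<Prod>i<n. f i (\<omega> i)) \<partial>S) = (\<Prod>i<n. \<integral>x. f i x \<partial>M)"
proof -
  have ind: "P.indep_vars (\<lambda>_. M) (\<lambda>i \<omega>. \<omega> i) UNIV"
  proof (subst P.indep_vars_iff_distr_eq_PiM')
    show "distr S S (\<lambda>x. \<lambda>i\<in>UNIV. x i) = PiM UNIV (\<lambda>i. distr S M (\<lambda>\<omega>. \<omega> i))"
      by (simp add: restrict_UNIV PiM_component)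
  qed auto
  have "(\<integral>\<omega>. (\<Prod>i<n. f i (\<omega> i)) \<partial>S) = (\<Prod>i<n. \<integral>\<omega>. f i (\<omega> i) \<partial>S)"
  proof (rule P.indep_vars_lebesgue_integral)
    show "P.indep_vars (\<lambda>_. borel) (\<lambda>i \<omega>. f i (\<omega> i)) {..<n}"
      by (rule P.indep_vars_subset[OF P.indep_vars_compose2[OF ind]]) auto
    show "integrable S (\<lambda>\<omega>. f i (\<omega> i))" if "i \<in> {..<n}" for i
      by (rule P.integrable_const_bound[where B=1]) (use f1 in auto)
  qed simp
  thus ?thesis by (simp add: integral_coordinate)
qed

end

text \<open>A full sequence of marks is stored whatever the count is, and sums use only the marks
  with index below the count. This makes the law a plain product measure.\<close>

definition marked_poisson :: "real \<Rightarrow> 'b measure \<Rightarrow> (nat \<times> (nat \<Rightarrow> 'b)) measure" where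
  "marked_poisson r Q = measure_pmf (poisson_pmf r) \<Otimes>\<^sub>M PiM UNIV (\<lambda>_. Q)"

locale marked_poisson_space = prob_space Q for Q :: "'b measure" +
  fixes r :: real assumes rate: "0 < r"
begin

sublocale seq: sequence_space Q ..

sublocale mp: pair_prob_space "measure_pmf (poisson_pmf r)" "PiM UNIV (\<lambda>_::nat. Q)" ..

lemma marked_poisson_prob: "prob_space (marked_poisson r Q)"
  unfolding marked_poisson_def by (rule mp.prob_space_axioms)

lemma integral_marked_poisson:
  fixes f :: "nat \<times> (nat \<Rightarrow> 'b) \<Rightarrow> 'c::{banach, second_countable_topology}"
  assumes f[measurable]: "f \<in> borel_measurable (marked_poisson r Q)" and K: "\<And>x. norm (f x) \<le> K"
  shows "(\<lambda>n. (exp (-r) * r ^ n / fact n) *\<^sub>R (\<integral>\<omega>. f (n, \<omega>) \<partial>PiM UNIV (\<lambda>_. Q)))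
      sums (\<integral>x. f x \<partial>marked_poisson r Q)"
proof -
  note [measurable] = f[unfolded marked_poisson_def]
  have int: "integrable (marked_poisson r Q) f"
  proof -
    interpret B: prob_space "marked_poisson r Q" by (rule marked_poisson_prob)
    show ?thesis by (rule B.integrable_const_bound[where B=K]) (use f K in auto)
  qed
  have K0: "0 \<le> K" using K by (meson norm_ge_zero order_trans)
  have "(\<integral>x. f x \<partial>marked_poisson r Q)
      = (\<integral>n. (\<integral>\<omega>. f (n, \<omega>) \<partial>PiM UNIV (\<lambda>_. Q)) \<partial>measure_pmf (poisson_pmf r))"
    unfolding marked_poisson_def
    by (rule mp.integral_fst'[symmetric]) (use int in \<open>simp add: marked_poisson_def\<close>)
  moreover have "norm (\<integral>\<omega>. f (n, \<omega>) \<partial>PiM UNIV (\<lambda>_. Q)) \<le> K" for n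
  proof -
    have "norm (\<integral>\<omega>. f (n, \<omega>) \<partial>PiM UNIV (\<lambda>_. Q)) \<le> (\<integral>\<omega>. norm (f (n, \<omega>)) \<partial>PiM UNIV (\<lambda>_. Q))"
      by (rule Bochner_Integration.integral_norm_bound)
    also have "\<dots> \<le> (\<integral>\<omega>. K \<partial>PiM UNIV (\<lambda>_::nat. Q))"
      using K K0
      by (intro Bochner_Integration.integral_mono) (auto intro!: seq.P.integrable_const_bound[where B=K])
    finally have "norm (\<integral>\<omega>. f (n, \<omega>) \<partial>PiM UNIV (\<lambda>_. Q)) \<le> (\<integral>\<omega>. K \<partial>PiM UNIV (\<lambda>_::nat. Q))" .
    thus ?thesis by (simp add: seq.P.prob_space)
  qed
  ultimately show ?thesis
    using integral_pmf_nat[of "\<lambda>n. \<integral>\<omega>. f (n, \<omega>) \<partial>PiM UNIV (\<lambda>_. Q)" K "poisson_pmf r"]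
    by (simp add: rate mult_ac)
qed

lemma marked_sum_measurable:
  fixes f :: "'b \<Rightarrow> real"
  assumes [measurable]: "f \<in> borel_measurable Q"
  shows "(\<lambda>x. \<Sum>i<fst x. f (snd x i)) \<in> borel_measurable (marked_poisson r Q)"
  unfolding marked_poisson_def
  by (rule measurable_compose_countable[where f="\<lambda>n x. \<Sum>i<n. f (snd x i)" and g=fst]) measurable

text \<open>Given \<open>n\<close> marks, independence makes the expectation \<open>c ^ n\<close>;
  the Poisson average of these powers is an exponential series.\<close>

lemma char_marked_poisson:
  fixes f :: "'b \<Rightarrow> real"
  assumes f[measurable]: "f \<in> borel_measurable Q"
  shows "(CLINT x|marked_poisson r Q. iexp (\<Sum>i<fst x. f (snd x i)))
       = exp (of_real r * ((CLINT y|Q. iexp (f y)) - 1))"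
proof -
  define c where "c = (CLINT y|Q. iexp (f y))"
  have prod: "(CLINT \<omega>|PiM UNIV (\<lambda>_. Q). iexp (\<Sum>i<n. f (\<omega> i))) = c ^ n" for n
  proof -
    have "(CLINT \<omega>|PiM UNIV (\<lambda>_. Q). iexp (\<Sum>i<n. f (\<omega> i)))
        = (CLINT \<omega>|PiM UNIV (\<lambda>_. Q). \<Prod>i<n. iexp (f (\<omega> i)))"
      by (simp add: sum_distrib_left exp_sum)
    also have "\<dots> = c ^ n"
      by (subst seq.integral_prod_coordinates) (auto simp: c_def)
    finally show ?thesis .
  qed
  have "(\<lambda>n. (exp (-r) * r ^ n / fact n) *\<^sub>R (CLINT \<omega>|PiM UNIV (\<lambda>_. Q). iexp (\<Sum>i<fst (n, \<omega>). f (snd (n, \<omega>) i))))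
      sums (CLINT x|marked_poisson r Q. iexp (\<Sum>i<fst x. f (snd x i)))"
  proof (rule integral_marked_poisson[where K=1])
    note [measurable] = marked_sum_measurable[OF f]
    show "(\<lambda>x. iexp (\<Sum>i<fst x. f (snd x i))) \<in> borel_measurable (marked_poisson r Q)"
      by measurable
  qed auto
  hence 1: "(\<lambda>n. (exp (-r) * r ^ n / fact n) *\<^sub>R c ^ n) sums (CLINT x|marked_poisson r Q. iexp (\<Sum>i<fst x. f (snd x i)))"
    unfolding fst_conv snd_conv prod .
  have "(\<lambda>n. exp (-r) *\<^sub>R ((of_real r * c) ^ n /\<^sub>R fact n)) sums (exp (-r) *\<^sub>R exp (of_real r * c))"
    by (intro sums_scaleR_right exp_converges)
  moreover have "exp (-r) *\<^sub>R ((of_real r * c) ^ n /\<^sub>R fact n) = (exp (-r) * r ^ n / fact n) *\<^sub>R c ^ n" for n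
    by (simp add: power_mult_distrib scaleR_conv_of_real divide_inverse)
  ultimately have "(CLINT x|marked_poisson r Q. iexp (\<Sum>i<fst x. f (snd x i))) = exp (-r) *\<^sub>R exp (of_real r * c)"
    using sums_unique2[OF 1] by simp
  also have "\<dots> = exp (of_real r * (c - 1))"
    by (simp add: scaleR_conv_of_real exp_of_real[symmetric] mult_exp_exp algebra_simps)
  finally show ?thesis by (simp add: c_def)
qed

end

section \<open>The Levy measure of an upwards skip-free chain\<close>

text \<open>The analytic content of the assumptions on the Levy measure, shared by \<open>\<Lambda>\<close> and its tilts.\<close>

locale skip_free_levy_measure = finite_measure \<Lambda> for \<Lambda> :: "real measure" +
  fixes h :: real
  assumes h_pos: "0 < h"
    and sets_levy_measure: "sets \<Lambda> = sets borel"
    and levy_measure_zero: "emeasure \<Lambda> {0} = 0"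
    and levy_measure_lattice: "msupport \<Lambda> \<subseteq> lattice_points h"
    and skip_free: "msupport (density \<Lambda> (indicator {0<..})) = {h}"

sublocale upwards_skip_free_levy_chain \<subseteq> L: skip_free_levy_measure \<Lambda> h
  using h_pos sets_levy_measure finite_levy_measure levy_measure_zero levy_measure_lattice skip_free
  by (intro skip_free_levy_measure.intro skip_free_levy_measure_axioms.intro)

text \<open>The complement of the support is a union of open null sets. By Lindelof countably many
  of them already cover it.\<close>

lemma AE_in_msupport:
  assumes sets: "sets N = sets borel"
  shows "AE x in N. x \<in> msupport N"
proof -
  have sp: "space N = UNIV" using sets_eq_imp_space_eq[OF sets] by simp
  define F where "F = {U :: real set. open U \<and> emeasure N U = 0}"
  obtain F' where F': "F' \<subseteq> F" "countable F'" "\<Union>F' = \<Union>F"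
    using Lindelof[of F] by (auto simp: F_def)
  have "(\<Union>U\<in>F'. U) \<in> null_sets N"
    using F' by (intro null_sets_UN') (auto simp: F_def null_sets_def sets)
  hence "\<Union>F \<in> null_sets N" using F' by simp
  moreover have "{x \<in> space N. \<not> x \<in> msupport N} \<subseteq> \<Union>F"
    by (auto simp: msupport_def F_def zero_less_iff_neq_zero)
  ultimately show ?thesis by (rule AE_I')
qed

lemma msupport_density_pos:
  assumes sets: "sets N = sets borel" and f[measurable]: "f \<in> borel_measurable borel"
    and pos: "\<And>x. 0 < f x"
  shows "msupport (density N f) = msupport N"
proof -
  have "emeasure (density N f) U = 0 \<longleftrightarrow> emeasure N U = 0" if "open U" for U
  proof -
    have [measurable]: "U \<in> sets N" "f \<in> borel_measurable N"
      using that by (auto simp: sets cong: measurable_cong_sets)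
    have "U \<in> null_sets (density N f) \<longleftrightarrow> (AE x in N. x \<notin> U)"
      by (subst null_sets_density_iff) (use pos in \<open>auto simp: less_imp_neq[OF pos, symmetric]\<close>)
    also have "\<dots> \<longleftrightarrow> U \<in> null_sets N"
      by (rule AE_iff_null_sets[symmetric]) simp
    finally have "U \<in> null_sets (density N f) \<longleftrightarrow> U \<in> null_sets N" .
    thus ?thesis using \<open>U \<in> sets N\<close> by (simp add: null_sets_def)
  qed
  thus ?thesis by (auto simp: msupport_def zero_less_iff_neq_zero)
qed

context skip_free_levy_measure
begin

definition lam :: real where "lam = measure \<Lambda> UNIV"
definition p_up :: real where "p_up = measure \<Lambda> {h}"
text \<open>The value at \<open>0\<close> lets convolutions run over all \<open>k \<le> n\<close>
  without singling out an index.\<close>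

definition a_down :: "nat \<Rightarrow> real" where "a_down k = (if k = 0 then 0 else measure \<Lambda> {- (real k * h)})"

lemma space_levy [simp]: "space \<Lambda> = UNIV"
  using sets_eq_imp_space_eq[OF sets_levy_measure] by simp

lemma measurable_levy [simp]: "measurable \<Lambda> N = measurable borel N"
  by (rule measurable_cong_sets) (auto simp: sets_levy_measure)

lemmas sets_levy [measurable_cong] = sets_levy_measure

text \<open>One injective list of all possible jumps: index \<open>0\<close>, free because there is
  no jump of size \<open>0\<close>, stands for the upward jump.\<close>

definition atoms :: "nat \<Rightarrow> real" where "atoms k = (if k = 0 then h else - (real k * h))"

lemma inj_atoms: "inj atoms"
  using h_pos by (auto simp: inj_def atoms_def split: if_splits)
    (smt (verit) mult_nonneg_nonneg of_nat_0_le_iff)+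

lemma AE_atoms: "AE x in \<Lambda>. x \<in> range atoms"
proof -
  have "AE x in \<Lambda>. x \<in> msupport \<Lambda>" by (rule AE_in_msupport[OF sets_levy_measure])
  moreover have "AE x in \<Lambda>. x \<noteq> 0"
    by (rule AE_I'[of "{0}"]) (auto simp: null_sets_def levy_measure_zero)
  moreover have "AE x in \<Lambda>. 0 < x \<longrightarrow> x = h"
  proof -
    have "AE x in density \<Lambda> (indicator {0<..}). x \<in> {h}"
      using AE_in_msupport[of "density \<Lambda> (indicator {0<..})"] skip_free
      by (simp add: sets_levy_measure)
    thus ?thesis by (subst (asm) AE_density) auto
  qed
  ultimately show ?thesis
  proof eventually_elim
    case (elim x)
    show ?case
    proof (cases "0 < x")
      case True thus ?thesis using elim by (auto intro!: image_eqI[of _ _ 0] simp: atoms_def)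
    next
      case False
      hence "x < 0" using elim by simp
      moreover obtain k where k: "x = h * of_int k" using elim levy_measure_lattice by (auto simp: lattice_points_def)
      ultimately have "k < 0" using h_pos by (simp add: mult_less_0_iff)
      thus ?thesis using k by (intro image_eqI[of _ _ "nat (-k)"]) (auto simp: atoms_def)
    qed
  qed
qed

text \<open>Membership in the support yields mass only for neighbourhoods of \<open>h\<close>. In
  the neighbourhood \<open>(0, 2 h)\<close> the sole possible jump is \<open>h\<close>, so the mass
  sits in the atom.\<close>

lemma p_up_pos: "0 < p_up"
proof -
  have "h \<in> msupport (density \<Lambda> (indicator {0<..}))" using skip_free by simp
  hence "0 < emeasure (density \<Lambda> (indicator {0<..})) {0<..<2*h}"
    using h_pos by (auto simp: msupport_def)
  also have "emeasure (density \<Lambda> (indicator {0<..})) {0<..<2*h} = emeasure \<Lambda> {0<..<2*h}"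
    by (subst emeasure_density) (auto simp: indicator_inter_arith[symmetric] sets_levy_measure
      intro!: nn_integral_indicator[THEN trans] arg_cong[where f="emeasure \<Lambda>"])
  also have "\<dots> = emeasure \<Lambda> {h}"
  proof (rule emeasure_eq_AE)
    show "AE x in \<Lambda>. x \<in> {0<..<2 * h} \<longleftrightarrow> x \<in> {h}"
      using AE_atoms
    proof eventually_elim
      case (elim x)
      then obtain k where x: "x = atoms k" by auto
      show ?case
      proof (cases "k = 0")
        case False
        have "0 \<le> real k * h" using h_pos by simp
        hence "x \<le> 0" unfolding x atoms_def using False by simp
        thus ?thesis using h_pos by auto
      qed (use x h_pos in \<open>auto simp: atoms_def\<close>)
    qed
  qed (auto simp: sets_levy_measure)
  finally show ?thesis by (simp add: p_up_def emeasure_eq_measure)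
qed

text \<open>At a given atom the partial sums of \<open>f\<close> restricted to the first atoms are
  first \<open>0\<close> and then \<open>f\<close>, so \<open>norm f\<close> dominates them and no
  sign condition on \<open>f\<close> is involved.\<close>

lemma has_sums_levy:
  fixes f :: "real \<Rightarrow> 'b::{banach, second_countable_topology}"
  assumes int: "integrable \<Lambda> f"
  shows "(\<lambda>k. measure \<Lambda> {atoms k} *\<^sub>R f (atoms k)) sums (\<integral>x. f x \<partial>\<Lambda>)"
  unfolding sums_def
proof -
  have [measurable]: "f \<in> borel_measurable borel" using borel_measurable_integrable[OF int] by simp
  have ind: "(\<integral>x. indicator {c} x *\<^sub>R f x \<partial>\<Lambda>) = measure \<Lambda> {c} *\<^sub>R f c"
    and intc: "integrable \<Lambda> (\<lambda>x. indicator {c} x *\<^sub>R f x)" for c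
  proof -
    have "(\<integral>x. indicator {c} x *\<^sub>R f x \<partial>\<Lambda>) = (\<integral>x. indicator {c} x *\<^sub>R f c \<partial>\<Lambda>)"
      by (rule Bochner_Integration.integral_cong) (auto simp: indicator_def)
    thus "(\<integral>x. indicator {c} x *\<^sub>R f x \<partial>\<Lambda>) = measure \<Lambda> {c} *\<^sub>R f c" by (simp add: emeasure_eq_measure)
    show "integrable \<Lambda> (\<lambda>x. indicator {c} x *\<^sub>R f x)"
      by (rule integrable_mult_indicator[OF _ int]) (auto simp: sets_levy_measure)
  qed
  have "(\<lambda>n. \<integral>x. (\<Sum>k<n. indicator {atoms k} x *\<^sub>R f x) \<partial>\<Lambda>) \<longlonglongrightarrow> (\<integral>x. f x \<partial>\<Lambda>)"
  proof (rule integral_dominated_convergence[where w="\<lambda>x. norm (f x)"])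
    have eq: "(\<Sum>k<n. indicator {atoms k} (atoms j) *\<^sub>R f (atoms j)) = (if j < n then f (atoms j) else 0)" for n j
    proof -
      have "(\<Sum>k<n. indicator {atoms k} (atoms j) *\<^sub>R f (atoms j)) = (\<Sum>k<n. if k = j then f (atoms j) else 0)"
        by (rule sum.cong) (use inj_atoms in \<open>auto simp: indicator_def inj_def\<close>)
      thus ?thesis by simp
    qed
    show "AE x in \<Lambda>. (\<lambda>n. \<Sum>k<n. indicator {atoms k} x *\<^sub>R f x) \<longlonglongrightarrow> f x"
      using AE_atoms
    proof eventually_elim
      case (elim x)
      then obtain j where x: "x = atoms j" by auto
      have "eventually (\<lambda>n. (\<Sum>k<n. indicator {atoms k} x *\<^sub>R f x) = f x) sequentially"
        unfolding x eq using eventually_gt_at_top[of j] by eventually_elim simp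
      thus ?case by (rule tendsto_eventually)
    qed
    show "AE x in \<Lambda>. norm (\<Sum>k<n. indicator {atoms k} x *\<^sub>R f x) \<le> norm (f x)" for n
      using AE_atoms
    proof eventually_elim
      case (elim x)
      then obtain j where x: "x = atoms j" by auto
      show ?case unfolding x eq by simp
    qed
    show "(\<lambda>x. \<Sum>k<n. indicator {atoms k} x *\<^sub>R f x) \<in> borel_measurable \<Lambda>" for n
      by (simp only: measurable_levy) measurable
  qed (use int in auto)
  moreover have "(\<integral>x. (\<Sum>k<n. indicator {atoms k} x *\<^sub>R f x) \<partial>\<Lambda>)
      = (\<Sum>k<n. measure \<Lambda> {atoms k} *\<^sub>R f (atoms k))" for n
    by (subst Bochner_Integration.integral_sum) (use ind intc in auto)
  ultimately show "(\<lambda>n. \<Sum>k<n. measure \<Lambda> {atoms k} *\<^sub>R f (atoms k)) \<longlonglongrightarrow> (\<integral>x. f x \<partial>\<Lambda>)" by simp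
qed

lemma levy_integral:
  fixes f :: "real \<Rightarrow> 'b::{banach, second_countable_topology}"
  assumes int: "integrable \<Lambda> f"
  shows "(\<lambda>k. a_down k *\<^sub>R f (- (real k * h))) sums ((\<integral>x. f x \<partial>\<Lambda>) - p_up *\<^sub>R f h)"
proof -
  have "(\<lambda>k. measure \<Lambda> {atoms k} *\<^sub>R f (atoms k) - (if k = 0 then p_up *\<^sub>R f h else 0)) sums ((\<integral>x. f x \<partial>\<Lambda>) - p_up *\<^sub>R f h)"
    by (rule sums_diff[OF has_sums_levy[OF int] sums_If_finite_set[of "{0}", simplified]])
  moreover have "measure \<Lambda> {atoms k} *\<^sub>R f (atoms k) - (if k = 0 then p_up *\<^sub>R f h else 0) = a_down k *\<^sub>R f (- (real k * h))" for k
    by (auto simp: atoms_def a_down_def p_up_def)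
  ultimately show ?thesis by simp
qed

lemma a_down_nonneg: "0 \<le> a_down k" by (simp add: a_down_def)

lemma a_down_0 [simp]: "a_down 0 = 0" by (simp add: a_down_def)

lemma sums_a_down: "a_down sums (lam - p_up)"
  using levy_integral[of "\<lambda>_. 1 :: real"] by (simp add: lam_def)

lemma lam_pos: "0 < lam"
  using p_up_pos finite_measure_mono[of "{h}" UNIV] by (simp add: lam_def p_up_def sets_levy_measure)

end

section \<open>The law of the chain at a fixed time\<close>

context skip_free_levy_measure
begin

definition jump_law :: "real measure" where
  "jump_law = density \<Lambda> (\<lambda>_. ennreal (1 / lam))"

lemma sets_jump_law [measurable_cong]: "sets jump_law = sets borel"
  by (simp add: jump_law_def sets_levy_measure)

lemma measurable_jump_law [simp]: "measurable jump_law N = measurable borel N"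
  by (rule measurable_cong_sets) (auto simp: sets_jump_law)

lemma prob_space_jump_law: "prob_space jump_law"
proof (rule prob_spaceI)
  have "emeasure jump_law (space jump_law) = ennreal (1 / lam) * emeasure \<Lambda> UNIV"
    by (simp add: jump_law_def emeasure_density_const sets_levy_measure)
  also have "\<dots> = ennreal (1 / lam * lam)"
    using lam_pos by (subst ennreal_mult) (auto simp: lam_def emeasure_eq_measure)
  finally show "emeasure jump_law (space jump_law) = 1" using lam_pos by simp
qed

lemma integral_jump_law:
  fixes f :: "real \<Rightarrow> 'b::{banach, second_countable_topology}"
  assumes [measurable]: "f \<in> borel_measurable borel"
  shows "(\<integral>x. f x \<partial>jump_law) = (1 / lam) *\<^sub>R (\<integral>x. f x \<partial>\<Lambda>)"
  unfolding jump_law_def using lam_pos by (subst integral_density) auto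

lemma AE_jump_law: "(AE x in \<Lambda>. P x) \<Longrightarrow> AE x in jump_law. P x"
  unfolding jump_law_def by (subst AE_density) auto

lemma iexp_jump_law:
  "of_real (lam * t) * ((CLINT y|jump_law. iexp (u * y)) - 1) = of_real t * (CLINT x|\<Lambda>. (iexp (u * x) - 1))"
proof -
  have "integrable \<Lambda> (\<lambda>x. iexp (u * x))" by (rule integrable_const_bound[where B=1]) auto
  hence Z: "(CLINT x|\<Lambda>. iexp (u * x)) = (CLINT x|\<Lambda>. (iexp (u * x) - 1)) + of_real lam"
    by (subst Bochner_Integration.integral_diff) (auto simp: lam_def scaleR_conv_of_real)
  have "(CLINT y|jump_law. iexp (u * y)) = (1 / lam) *\<^sub>R ((CLINT x|\<Lambda>. (iexp (u * x) - 1)) + of_real lam)"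
    unfolding Z[symmetric] by (rule integral_jump_law) measurable
  thus ?thesis using lam_pos
    by (simp only:) (simp add: scaleR_conv_of_real field_simps)
qed

lemma lattice_image: "lattice_points h = (\<lambda>x. h *\<^sub>R x) ` \<int>"
  by (auto simp: lattice_points_def Ints_def)

lemma closed_lattice: "closed (lattice_points h)"
  unfolding lattice_image by (rule closed_scaling) (auto simp: Ints_def closed_of_int_image)

lemma lattice_add: "x \<in> lattice_points h \<Longrightarrow> y \<in> lattice_points h \<Longrightarrow> x + y \<in> lattice_points h"
  by (auto simp: lattice_points_def) (metis of_int_add distrib_left)

lemma lattice_of_int: "of_int k * h \<in> lattice_points h" "h * of_int k \<in> lattice_points h"
  by (auto simp: lattice_points_def)

lemma lattice_0: "0 \<in> lattice_points h" using lattice_of_int(1)[of 0] by simp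

lemma lattice_sum: "(\<And>i. i \<in> I \<Longrightarrow> f i \<in> lattice_points h) \<Longrightarrow> sum f I \<in> lattice_points h"
  by (induction I rule: infinite_finite_induct) (auto intro: lattice_add lattice_0)

lemma atoms_lattice: "atoms k \<in> lattice_points h"
  using lattice_of_int(1)[of 1] lattice_of_int(1)[of "- int k"] by (auto simp: atoms_def)

lemma AE_levy_lattice: "AE x in \<Lambda>. x \<in> lattice_points h"
  using AE_atoms by eventually_elim (auto simp: atoms_lattice)

end

context upwards_skip_free_levy_chain
begin

text \<open>Levy's uniqueness theorem applies because only the law at one fixed time is concerned.
  The Poisson mixture obtained here is what allows an expansion in the number of jumps.\<close>

lemma distr_X:
  assumes t: "0 < t"
  shows "distr M borel (X t) = distr (marked_poisson (L.lam * t) L.jump_law) borel (\<lambda>x. \<Sum>i<fst x. snd x i)"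
    and "(\<lambda>x. \<Sum>i<fst x. snd x i) \<in> borel_measurable (marked_poisson (L.lam * t) L.jump_law)"
proof -
  interpret J: prob_space L.jump_law by (rule L.prob_space_jump_law)
  interpret J: marked_poisson_space L.jump_law "L.lam * t"
    using t L.lam_pos by unfold_locales auto
  let ?B = "marked_poisson (L.lam * t) L.jump_law"
  have Xm: "X t \<in> borel_measurable M" using t by (intro measurable_at) simp
  show m[measurable]: "(\<lambda>x. \<Sum>i<fst x. snd x i) \<in> borel_measurable ?B"
    by (rule J.marked_sum_measurable) simp
  show "distr M borel (X t) = distr ?B borel (\<lambda>x. \<Sum>i<fst x. snd x i)"
  proof (rule Levy_uniqueness)
    show "real_distribution (distr M borel (X t))" using Xm by (rule real_distribution_distr)
    show "real_distribution (distr ?B borel (\<lambda>x. \<Sum>i<fst x. snd x i))"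
      using m by (intro prob_space.real_distribution_distr J.marked_poisson_prob) auto
    show "char (distr M borel (X t)) = char (distr ?B borel (\<lambda>x. \<Sum>i<fst x. snd x i))"
    proof
      fix u
      have "char (distr ?B borel (\<lambda>x. \<Sum>i<fst x. snd x i)) u = (CLINT x|?B. iexp (\<Sum>i<fst x. u * snd x i))"
        unfolding char_def by (subst integral_distr) (auto simp: sum_distrib_left)
      also have "\<dots> = exp (of_real (L.lam * t) * ((CLINT y|L.jump_law. iexp (u * y)) - 1))"
        by (rule J.char_marked_poisson) auto
      also have "\<dots> = char (distr M borel (X t)) u"
        using t by (simp only: L.iexp_jump_law compound_Poisson)
      finally show "char (distr M borel (X t)) u = char (distr ?B borel (\<lambda>x. \<Sum>i<fst x. snd x i)) u" ..
    qed
  qed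
qed

lemma expectation_X_sums:
  fixes f :: "real \<Rightarrow> real"
  assumes t: "0 < t" and f[measurable]: "f \<in> borel_measurable borel" and K: "\<And>x. \<bar>f x\<bar> \<le> K"
  shows "(\<lambda>n. (exp (- (L.lam * t)) * (L.lam * t) ^ n / fact n)
      * (\<integral>\<omega>. f (\<Sum>i<n. \<omega> i) \<partial>PiM UNIV (\<lambda>_. L.jump_law))) sums (\<integral>\<omega>. f (X t \<omega>) \<partial>M)"
proof -
  interpret J: prob_space L.jump_law by (rule L.prob_space_jump_law)
  interpret J: marked_poisson_space L.jump_law "L.lam * t"
    using t L.lam_pos by unfold_locales auto
  note [measurable] = distr_X(2)[OF t] measurable_at[of t]
  have "(\<integral>\<omega>. f (X t \<omega>) \<partial>M) = (\<integral>x. f x \<partial>distr M borel (X t))"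
    using t by (subst integral_distr) auto
  also have "\<dots> = (\<integral>x. f (\<Sum>i<fst x. snd x i) \<partial>marked_poisson (L.lam * t) L.jump_law)"
    unfolding distr_X(1)[OF t] by (subst integral_distr) auto
  finally show ?thesis
    using J.integral_marked_poisson[of "\<lambda>x. f (\<Sum>i<fst x. snd x i)" K] K by simp
qed

lemma AE_lattice_at:
  assumes t: "0 \<le> t"
  shows "AE \<omega> in M. X t \<omega> \<in> lattice_points h"
proof (cases "t = 0")
  case True
  thus ?thesis using start L.lattice_0 by auto
next
  case False
  hence t: "0 < t" using t by simp
  interpret J: prob_space L.jump_law by (rule L.prob_space_jump_law)
  interpret J: marked_poisson_space L.jump_law "L.lam * t"
    using t L.lam_pos by unfold_locales auto
  let ?L = "lattice_points h" and ?P = "PiM UNIV (\<lambda>_::nat. L.jump_law)"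
  have [measurable]: "?L \<in> sets borel" using L.closed_lattice by (rule borel_closed)
  have [measurable]: "X t \<in> borel_measurable M" using t by (intro measurable_at) simp
  have "AE \<omega> in ?P. \<omega> i \<in> ?L" for i
  proof -
    have "AE x in distr ?P L.jump_law (\<lambda>\<omega>. \<omega> i). x \<in> ?L"
      using L.AE_jump_law[OF L.AE_levy_lattice] by (subst J.seq.PiM_component) auto
    thus ?thesis by (rule AE_distrD[rotated]) measurable
  qed
  hence AE: "AE \<omega> in ?P. \<forall>i. \<omega> i \<in> ?L" by (simp add: AE_all_countable)
  have "(\<integral>\<omega>. indicator (- ?L) (\<Sum>i<n. \<omega> i) \<partial>?P) = (\<integral>\<omega>. 0 \<partial>?P :: real)" for n
    by (rule integral_cong_AE) (use AE in \<open>auto elim!: eventually_mono simp: indicator_def intro: L.lattice_sum\<close>)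
  hence "(\<lambda>_::nat. 0) sums (\<integral>\<omega>. indicator (- ?L) (X t \<omega>) \<partial>M :: real)"
    using expectation_X_sums[OF t, of "indicator (- ?L)" 1] by (simp add: indicator_def)
  hence "(\<integral>\<omega>. indicator (- ?L) (X t \<omega>) \<partial>M :: real) = 0" by (simp add: sums_iff)
  moreover have "integrable M (\<lambda>\<omega>. indicator (- ?L) (X t \<omega>) :: real)"
    by (rule integrable_const_bound[where B=1]) (auto simp: indicator_def)
  ultimately have "AE \<omega> in M. (indicator (- ?L) (X t \<omega>) :: real) = 0"
    by (subst (asm) integral_nonneg_eq_0_iff_AE) auto
  thus ?thesis by (auto elim!: eventually_mono simp: indicator_def split: if_splits)
qed

text \<open>Rational times are countably many. If the value at some \<open>t\<close> were off the
  closed lattice, right continuity would keep the path off it on an interval to the right of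
  \<open>t\<close>, which contains a rational.\<close>

lemma AE_lattice_path: "AE \<omega> in M. \<forall>t\<ge>0. X t \<omega> \<in> lattice_points h"
proof -
  have "AE \<omega> in M. \<forall>q\<in>{q::real. q \<in> \<rat> \<and> 0 \<le> q}. X q \<omega> \<in> lattice_points h"
    by (subst AE_ball_countable) (auto intro!: AE_lattice_at countable_subset[OF _ countable_rat])
  moreover have "AE \<omega> in M. \<omega> \<in> space M" by simp
  ultimately show ?thesis
  proof eventually_elim
    case (elim \<omega>)
    show ?case
    proof (intro allI impI, rule ccontr)
      fix t :: real assume t: "0 \<le> t" and n: "X t \<omega> \<notin> lattice_points h"
      have "((\<lambda>t. X t \<omega>) \<longlongrightarrow> X t \<omega>) (at_right t)"
        using cadlag_paths[OF elim(2)] t by (simp add: cadlag_def)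
      hence "eventually (\<lambda>s. X s \<omega> \<in> - lattice_points h) (at_right t)"
        using L.closed_lattice n by (auto simp: tendsto_def closed_def)
      then obtain b where b: "t < b" "\<And>s. t < s \<Longrightarrow> s < b \<Longrightarrow> X s \<omega> \<notin> lattice_points h"
        by (auto simp: eventually_at_right_field)
      from Rats_dense_in_real[OF b(1)] obtain q where "q \<in> \<rat>" "t < q" "q < b" by blast
      thus False using b(2)[of q] elim(1) t by auto
    qed
  qed
qed

text \<open>The terms with no jump and with one jump are kept exactly. Since \<open>f\<close> is
  bounded by \<open>1\<close>, the rest is at most the probability of two or more jumps.\<close>

lemma small_time:
  fixes f :: "real \<Rightarrow> real"
  assumes t: "0 < t" and f[measurable]: "f \<in> borel_measurable borel" and f1: "\<And>x. \<bar>f x\<bar> \<le> 1"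
  shows "\<bar>(\<integral>\<omega>. f (X t \<omega>) \<partial>M) - exp (- (L.lam * t)) * (f 0 + t * (\<integral>x. f x \<partial>\<Lambda>))\<bar> \<le> (L.lam * t)\<^sup>2"
proof -
  interpret J: prob_space L.jump_law by (rule L.prob_space_jump_law)
  interpret J: marked_poisson_space L.jump_law "L.lam * t"
    using t L.lam_pos by unfold_locales auto
  let ?P = "PiM UNIV (\<lambda>_::nat. L.jump_law)"
  define x where "x = L.lam * t"
  have x: "0 < x" using t L.lam_pos by (simp add: x_def)
  define E where "E n = (\<integral>\<omega>. f (\<Sum>i<n. \<omega> i) \<partial>?P)" for n
  have E1: "\<bar>E n\<bar> \<le> 1" for n
  proof -
    have "\<bar>E n\<bar> \<le> (\<integral>\<omega>. \<bar>f (\<Sum>i<n. \<omega> i)\<bar> \<partial>?P)" unfolding E_def by (rule integral_abs_bound)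
    also have "\<dots> \<le> (\<integral>\<omega>. 1 \<partial>?P)"
      by (rule integral_mono) (use f1 in \<open>auto intro!: J.seq.P.integrable_const_bound[where B=1]\<close>)
    finally show ?thesis by (simp add: J.seq.P.prob_space)
  qed
  define w where "w n = exp (-x) * x ^ n / fact n" for n
  have w0: "0 \<le> w n" for n using x by (simp add: w_def)
  have "(\<lambda>n. exp (-x) * (x ^ n /\<^sub>R fact n)) sums (exp (-x) * exp x)"
    by (intro sums_mult exp_converges)
  hence "w sums 1" by (simp add: w_def[abs_def] exp_minus divide_inverse mult_ac)
  hence tail: "(\<lambda>n. w (n + 2)) sums (1 - (\<Sum>n<2. w n))" by (rule sums_split_initial_segment)
  have "(\<lambda>n. w n * E n) sums (\<integral>\<omega>. f (X t \<omega>) \<partial>M)"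
    using expectation_X_sums[OF t f, of 1] f1 by (simp add: w_def E_def x_def)
  hence s: "(\<lambda>n. w (n + 2) * E (n + 2)) sums ((\<integral>\<omega>. f (X t \<omega>) \<partial>M) - (\<Sum>n<2. w n * E n))"
    by (rule sums_split_initial_segment)
  have "\<bar>(\<integral>\<omega>. f (X t \<omega>) \<partial>M) - (\<Sum>n<2. w n * E n)\<bar> \<le> 1 - (\<Sum>n<2. w n)"
  proof -
    have b: "norm (w (n + 2) * E (n + 2)) \<le> w (n + 2)" for n
      using mult_left_mono[OF E1[of "n+2"] w0[of "n+2"]] w0[of "n+2"] by (simp add: abs_mult)
    hence "norm (\<Sum>n. w (n + 2) * E (n + 2)) \<le> (\<Sum>n. w (n + 2))"
      by (rule norm_suminf_le) (use tail in \<open>auto simp: sums_iff\<close>)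
    thus ?thesis using s tail by (simp add: sums_iff)
  qed
  also have "1 - (\<Sum>n<2. w n) \<le> x\<^sup>2"
  proof -
    \<comment> \<open>From \<open>1 - x \<le> exp (- x)\<close>: the probability of at most one jump
      is at least \<open>(1 - x) * (1 + x)\<close>, that is, one minus the square of
      \<open>x\<close>.\<close>
    have "(1 - x) * (1 + x) \<le> exp (-x) * (1 + x)"
      using x exp_ge_add_one_self[of "-x"] by (intro mult_right_mono) auto
    thus ?thesis by (simp add: w_def numeral_2_eq_2 algebra_simps power2_eq_square)
  qed
  also have "(\<Sum>n<2. w n * E n) = exp (-x) * (f 0 + t * (\<integral>x. f x \<partial>\<Lambda>))"
  proof -
    have "E 1 = (\<integral>y. f y \<partial>L.jump_law)" using J.seq.integral_coordinate[of f 0] by (simp add: E_def)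
    also have "\<dots> = (\<integral>x. f x \<partial>\<Lambda>) / L.lam" by (simp add: L.integral_jump_law)
    finally have "x * E 1 = t * (\<integral>x. f x \<partial>\<Lambda>)" using L.lam_pos by (simp add: x_def)
    moreover have "E 0 = f 0" by (simp add: E_def J.seq.P.prob_space)
    ultimately show ?thesis by (simp add: w_def numeral_2_eq_2 algebra_simps)
  qed
  finally show ?thesis by (simp add: x_def)
qed

end

section \<open>Construction of a chain\<close>

text \<open>Once true, \<open>a\<close> stays true, so at most one difference of consecutive
  indicators is nonzero and both sides reduce to that term. In the application \<open>a l\<close>
  says that a mark has occurred by time \<open>t l\<close>.\<close>

lemma iexp_telescope:
  fixes a :: "nat \<Rightarrow> bool" and v :: "nat \<Rightarrow> real"
  assumes "\<And>l. l < n \<Longrightarrow> a l \<Longrightarrow> a (Suc l)"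
  shows "iexp (\<Sum>l<n. v l * (of_bool (a (Suc l)) - of_bool (a l))) - 1
      = (\<Sum>l<n. (of_bool (a (Suc l)) - of_bool (a l)) * (iexp (v l) - 1))"
  using assms
proof (induction n)
  case (Suc n)
  show ?case
  proof (cases "a (Suc n) = a n")
    case True
    thus ?thesis using Suc by simp
  next
    case False
    hence an: "a (Suc n)" "\<not> a n" using Suc.prems[of n] by auto
    have "\<not> a l" if "l \<le> n" for l
      using that an(2) Suc.prems by (induction rule: inc_induct) auto
    hence "v l * (of_bool (a (Suc l)) - of_bool (a l)) = 0"
      "(of_bool (a (Suc l)) - of_bool (a l)) * (iexp (v l) - 1) = 0" if "l < n" for l
      using that by auto
    hence "(\<Sum>l<n. v l * (of_bool (a (Suc l)) - of_bool (a l))) = 0"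
      "(\<Sum>l<n. (of_bool (a (Suc l)) - of_bool (a l)) * (iexp (v l) - 1)) = 0"
      by (auto intro!: sum.neutral)
    thus ?thesis using an by simp
  qed
qed simp

text \<open>The length of the part of a unit block that has elapsed \<open>s\<close> time units
  after the start of the block.\<close>

definition unit_clamp :: "real \<Rightarrow> real" where "unit_clamp s = max 0 (min 1 s)"

lemma sum_unit_clamp: "0 \<le> t \<Longrightarrow> (\<Sum>j<K. unit_clamp (t - real j)) = min t (real K)"
  by (induction K) (auto simp: unit_clamp_def min_def max_def)

abbreviation (input) unif :: "real measure" where "unif \<equiv> uniform_measure lborel {0..1}"

lemma prob_space_unif: "prob_space unif"
  by (rule prob_space_uniform_measure) auto

lemma measure_unif: "measure unif {x. 0 < x \<and> x \<le> s} = unit_clamp s"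
proof -
  have "{0..1} \<inter> {x. 0 < x \<and> x \<le> s} = {0<..min 1 s}" by auto
  moreover have "measure lborel {0<..min 1 s} = unit_clamp s"
    by (cases "0 \<le> min 1 s") (auto simp: unit_clamp_def max_def)
  ultimately show ?thesis by (simp add: measure_uniform_measure)
qed

context skip_free_levy_measure
begin

text \<open>Block \<open>j\<close> of a path carries the jumps in the time interval \<open>(j, j + 1]\<close>: a Poisson number of marks
  \<open>(U, J)\<close>, each a jump of size \<open>J\<close> at time \<open>j + U\<close>.\<close>

definition mark_law :: "(real \<times> real) measure" where "mark_law = unif \<Otimes>\<^sub>M jump_law"

text \<open>The strict bound keeps block \<open>j\<close> silent up to and including time
  \<open>j\<close>; the non-strict one makes paths right-continuous.\<close>

definition active :: "nat \<Rightarrow> real \<Rightarrow> real \<times> real \<Rightarrow> bool" where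
  "active j t y \<longleftrightarrow> 0 < fst y \<and> real j + fst y \<le> t"

definition block_sum :: "nat \<Rightarrow> real \<Rightarrow> nat \<times> (nat \<Rightarrow> real \<times> real) \<Rightarrow> real" where
  "block_sum j t x = (\<Sum>i<fst x. snd (snd x i) * of_bool (active j t (snd x i)))"

definition path_law :: "(nat \<Rightarrow> nat \<times> (nat \<Rightarrow> real \<times> real)) measure" where
  "path_law = PiM UNIV (\<lambda>_. marked_poisson lam mark_law)"

definition path :: "real \<Rightarrow> (nat \<Rightarrow> nat \<times> (nat \<Rightarrow> real \<times> real)) \<Rightarrow> real" where
  "path t \<omega> = (\<Sum>j<nat \<lceil>t\<rceil>. block_sum j t (\<omega> j))"

lemma sets_mark_law [measurable_cong]: "sets mark_law = sets (borel \<Otimes>\<^sub>M borel)"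
  unfolding mark_law_def by (intro sets_pair_measure_cong) (auto simp: sets_jump_law)

sublocale unif: prob_space unif by (rule prob_space_unif)
sublocale jump: prob_space jump_law by (rule prob_space_jump_law)
sublocale mark: pair_prob_space unif jump_law ..
sublocale block: marked_poisson_space mark_law lam
  unfolding marked_poisson_space_def marked_poisson_space_axioms_def
  using mark.prob_space_axioms lam_pos by (simp add: mark_law_def)
sublocale blk: prob_space "marked_poisson lam mark_law" by (rule block.marked_poisson_prob)
sublocale path: sequence_space "marked_poisson lam mark_law" ..

lemma path_eq:
  assumes "t \<le> real K"
  shows "path t \<omega> = (\<Sum>j<K. block_sum j t (\<omega> j))"
  unfolding path_def
proof (rule sum.mono_neutral_left)
  show "{..<nat \<lceil>t\<rceil>} \<subseteq> {..<K}" using assms by (auto simp: ceiling_le_iff nat_less_iff)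
  show "\<forall>i\<in>{..<K} - {..<nat \<lceil>t\<rceil>}. block_sum i t (\<omega> i) = 0"
  proof
    fix i assume "i \<in> {..<K} - {..<nat \<lceil>t\<rceil>}"
    hence "t \<le> real i" by (auto simp: not_less)
    hence "\<not> active i t y" for y by (auto simp: active_def)
    thus "block_sum i t (\<omega> i) = 0" by (simp add: block_sum_def)
  qed
qed simp

lemma active_measurable [measurable]: "Measurable.pred (borel \<Otimes>\<^sub>M borel) (active j t)"
  unfolding active_def by measurable

lemma block_sum_measurable [measurable]: "block_sum j t \<in> borel_measurable (marked_poisson lam mark_law)"
  unfolding block_sum_def by (rule block.marked_sum_measurable) measurable

lemma path_measurable [measurable]: "path t \<in> borel_measurable path_law"
  unfolding path_def path_law_def by measurable

lemma integral_mark: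
  "(CLINT y|mark_law. (of_bool (active j t y)) * (iexp (u * snd y) - 1))
    = unit_clamp (t - real j) * ((CLINT z|jump_law. iexp (u * z)) - 1)"
  and integrable_mark: "integrable mark_law (\<lambda>y. (of_bool (active j t y)) * (iexp (u * snd y) - 1))"
proof -
  let ?f = "\<lambda>y. (of_bool (active j t y)) * (iexp (u * snd y) - 1) :: complex"
  show int: "integrable mark_law ?f"
  proof (rule mark.integrable_const_bound[where B=2, folded mark_law_def])
    have "norm (?f y) \<le> 2" for y
      using norm_triangle_ineq4[of "iexp (u * snd y)" 1] by (cases "active j t y") auto
    thus "AE y in mark_law. norm (?f y) \<le> 2" by simp
  qed measurable
  have ij: "integrable jump_law (\<lambda>z. iexp (u * z))"
    by (rule jump.integrable_const_bound[where B=1]) auto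
  have "(CLINT y|mark_law. ?f y) = (CLINT x|unif. CLINT z|jump_law. ?f (x, z))"
    unfolding mark_law_def by (rule mark.integral_fst'[symmetric]) (use int in \<open>simp add: mark_law_def\<close>)
  also have "\<dots> = (CLINT x|unif. indicator {x. 0 < x \<and> x \<le> t - real j} x *\<^sub>R ((CLINT z|jump_law. iexp (u * z)) - 1))"
  proof (rule Bochner_Integration.integral_cong[OF refl])
    fix x
    have "(CLINT z|jump_law. ?f (x, z)) = of_bool (0 < x \<and> real j + x \<le> t) * (CLINT z|jump_law. iexp (u * z) - 1)"
      by (simp add: active_def)
    also have "(CLINT z|jump_law. iexp (u * z) - 1) = (CLINT z|jump_law. iexp (u * z)) - 1"
      using ij by (subst Bochner_Integration.integral_diff) (auto simp: jump.prob_space)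
    finally show "(CLINT z|jump_law. ?f (x, z)) = indicator {x. 0 < x \<and> x \<le> t - real j} x *\<^sub>R ((CLINT z|jump_law. iexp (u * z)) - 1)"
      by (auto simp: indicator_def algebra_simps)
  qed
  also have "\<dots> = measure unif {x. 0 < x \<and> x \<le> t - real j} *\<^sub>R ((CLINT z|jump_law. iexp (u * z)) - 1)"
  proof -
    have "{x. 0 < x \<and> x \<le> t - real j} \<in> sets unif" by simp
    moreover have "integrable unif (indicat_real {x. 0 < x \<and> x \<le> t - real j})"
      by (rule unif.integrable_const_bound[where B=1]) (auto simp: indicator_def)
    ultimately show ?thesis by (subst Bochner_Integration.integral_scaleR_left) auto
  qed
  finally show "(CLINT y|mark_law. ?f y) = unit_clamp (t - real j) * ((CLINT z|jump_law. iexp (u * z)) - 1)"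
    by (simp add: measure_unif scaleR_conv_of_real)
qed

text \<open>Regrouped by marks, the exponent is a sum over independent compound Poisson blocks. A
  mark becomes active in at most one of the intervals \<open>(t l, t (Suc l)]\<close>, so
  \<open>iexp_telescope\<close> separates these intervals inside each block.\<close>

lemma joint_char_path:
  fixes t :: "nat \<Rightarrow> real"
  assumes t0: "0 \<le> t 0" and inc: "\<And>l. l < n \<Longrightarrow> t l \<le> t (Suc l)"
  shows "(CLINT \<omega>|path_law. iexp (\<Sum>l<n. u l * (path (t (Suc l)) \<omega> - path (t l) \<omega>)))
     = exp (\<Sum>l<n. of_real (t (Suc l) - t l) * (CLINT x|\<Lambda>. (iexp (u l * x) - 1)))"
proof -
  define \<eta> where "\<eta> l = (CLINT z|jump_law. iexp (u l * z)) - 1" for l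
  have t_ge: "0 \<le> t l" if "l \<le> n" for l using that
  proof (induction l)
    case (Suc l) thus ?case using inc[of l] by simp
  qed (use t0 in simp)
  have t_le: "t l \<le> t n" if "l \<le> n" for l
    using that inc by (induction rule: inc_induct) (auto intro: order_trans)
  obtain K where K: "t n \<le> real K" using real_arch_simple by blast
  \<comment> \<open>The contribution of a single mark \<open>y\<close> of block \<open>j\<close> to
    the whole exponent, over all increments at once.\<close>
  define g where "g j y = (\<Sum>l<n. (u l * snd y) * (of_bool (active j (t (Suc l)) y) - of_bool (active j (t l) y)))"
    for j :: nat and y
  have [measurable]: "g j \<in> borel_measurable mark_law" for j unfolding g_def by measurable
  have sum: "(\<Sum>l<n. u l * (path (t (Suc l)) \<omega> - path (t l) \<omega>)) = (\<Sum>j<K. \<Sum>i<fst (\<omega> j). g j (snd (\<omega> j) i))" for \<omega>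
  proof -
    have "(\<Sum>l<n. u l * (path (t (Suc l)) \<omega> - path (t l) \<omega>))
      = (\<Sum>l<n. \<Sum>j<K. u l * (block_sum j (t (Suc l)) (\<omega> j) - block_sum j (t l) (\<omega> j)))"
    proof (rule sum.cong[OF refl])
      fix l assume "l \<in> {..<n}"
      hence "t (Suc l) \<le> real K" "t l \<le> real K" using t_le[of "Suc l"] t_le[of l] K by auto
      thus "u l * (path (t (Suc l)) \<omega> - path (t l) \<omega>)
         = (\<Sum>j<K. u l * (block_sum j (t (Suc l)) (\<omega> j) - block_sum j (t l) (\<omega> j)))"
        by (simp add: path_eq[of _ K] flip: sum_subtractf sum_distrib_left)
    qed
    also have "\<dots> = (\<Sum>j<K. \<Sum>l<n. u l * (block_sum j (t (Suc l)) (\<omega> j) - block_sum j (t l) (\<omega> j)))"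
      by (rule sum.swap)
    also have "\<dots> = (\<Sum>j<K. \<Sum>i<fst (\<omega> j). g j (snd (\<omega> j) i))"
    proof (rule sum.cong[OF refl])
      fix j
      have "(\<Sum>l<n. u l * (block_sum j (t (Suc l)) (\<omega> j) - block_sum j (t l) (\<omega> j)))
         = (\<Sum>l<n. \<Sum>i<fst (\<omega> j). (u l * snd (snd (\<omega> j) i)) * (of_bool (active j (t (Suc l)) (snd (\<omega> j) i)) - of_bool (active j (t l) (snd (\<omega> j) i))))"
        unfolding block_sum_def sum_subtractf[symmetric] sum_distrib_left
        by (intro sum.cong refl) (simp only: right_diff_distrib mult.assoc)
      also have "\<dots> = (\<Sum>i<fst (\<omega> j). g j (snd (\<omega> j) i))"
        unfolding g_def by (rule sum.swap)
      finally show "(\<Sum>l<n. u l * (block_sum j (t (Suc l)) (\<omega> j) - block_sum j (t l) (\<omega> j)))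
         = (\<Sum>i<fst (\<omega> j). g j (snd (\<omega> j) i))" .
    qed
    finally show ?thesis .
  qed
  have mark: "(CLINT y|mark_law. iexp (g j y)) - 1 = (\<Sum>l<n. of_real (unit_clamp (t (Suc l) - real j) - unit_clamp (t l - real j)) * \<eta> l)" for j
  proof -
    have ig: "integrable mark_law (\<lambda>y. iexp (g j y))"
      by (rule block.integrable_const_bound[where B=1]) auto
    have eq: "iexp (g j y) - 1 = (\<Sum>l<n. of_bool (active j (t (Suc l)) y) * (iexp (u l * snd y) - 1) - of_bool (active j (t l) y) * (iexp (u l * snd y) - 1))" for y
    proof -
      have "iexp (g j y) - 1 = (\<Sum>l<n. (of_bool (active j (t (Suc l)) y) - of_bool (active j (t l) y)) * (iexp (u l * snd y) - 1))"
        unfolding g_def by (rule iexp_telescope) (use inc in \<open>force simp: active_def\<close>)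
      thus ?thesis by (simp only: left_diff_distrib)
    qed
    have "(CLINT y|mark_law. iexp (g j y)) - 1 = (CLINT y|mark_law. iexp (g j y) - 1)"
      using ig by (subst Bochner_Integration.integral_diff) (auto simp: block.prob_space)
    also have "\<dots> = (\<Sum>l<n. (CLINT y|mark_law. of_bool (active j (t (Suc l)) y) * (iexp (u l * snd y) - 1)) - (CLINT y|mark_law. of_bool (active j (t l) y) * (iexp (u l * snd y) - 1)))"
      unfolding eq
      by (subst Bochner_Integration.integral_sum, intro Bochner_Integration.integrable_diff integrable_mark,
        rule sum.cong[OF refl], rule Bochner_Integration.integral_diff; rule integrable_mark)
    finally show ?thesis
      unfolding integral_mark by (simp add: \<eta>_def left_diff_distrib)
  qed
  have "(CLINT \<omega>|path_law. iexp (\<Sum>l<n. u l * (path (t (Suc l)) \<omega> - path (t l) \<omega>)))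
      = (CLINT \<omega>|path_law. \<Prod>j<K. iexp (\<Sum>i<fst (\<omega> j). g j (snd (\<omega> j) i)))"
    unfolding sum by (simp only: of_real_sum sum_distrib_left exp_sum finite_lessThan)
  also have "\<dots> = (\<Prod>j<K. CLINT x|marked_poisson lam mark_law. iexp (\<Sum>i<fst x. g j (snd x i)))"
    unfolding path_law_def
  proof (rule path.integral_prod_coordinates)
    fix j
    note [measurable] = block.marked_sum_measurable[of "g j"]
    show "(\<lambda>x. iexp (\<Sum>i<fst x. g j (snd x i))) \<in> borel_measurable (marked_poisson lam mark_law)" by measurable
  qed simp
  also have "\<dots> = (\<Prod>j<K. exp (of_real lam * ((CLINT y|mark_law. iexp (g j y)) - 1)))"
    by (subst block.char_marked_poisson) auto
  also have "\<dots> = exp (\<Sum>j<K. \<Sum>l<n. of_real lam * (of_real (unit_clamp (t (Suc l) - real j) - unit_clamp (t l - real j)) * \<eta> l))"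
    unfolding mark by (simp add: exp_sum sum_distrib_left)
  also have "(\<Sum>j<K. \<Sum>l<n. of_real lam * (of_real (unit_clamp (t (Suc l) - real j) - unit_clamp (t l - real j)) * \<eta> l))
     = (\<Sum>l<n. \<Sum>j<K. of_real lam * (of_real (unit_clamp (t (Suc l) - real j) - unit_clamp (t l - real j)) * \<eta> l))"
    by (rule sum.swap)
  also have "\<dots> = (\<Sum>l<n. of_real (t (Suc l) - t l) * (CLINT x|\<Lambda>. (iexp (u l * x) - 1)))"
  proof (rule sum.cong[OF refl])
    fix l assume l: "l \<in> {..<n}"
    \<comment> \<open>Each block contributes the length of its overlap with
      \<open>(t l, t (Suc l)]\<close>; the overlaps add up to the length of this interval.\<close>
    have "(\<Sum>j<K. unit_clamp (t (Suc l) - real j) - unit_clamp (t l - real j)) = t (Suc l) - t l"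
      using l t_ge[of l] t_ge[of "Suc l"] t_le[of l] t_le[of "Suc l"] K by (simp add: sum_subtractf sum_unit_clamp)
    hence "(\<Sum>j<K. of_real lam * (of_real (unit_clamp (t (Suc l) - real j) - unit_clamp (t l - real j)) * \<eta> l))
       = of_real lam * (of_real (t (Suc l) - t l) * \<eta> l)"
      by (simp only: sum_distrib_left[symmetric] sum_distrib_right[symmetric] of_real_sum[symmetric])
    also have "\<dots> = of_real (lam * (t (Suc l) - t l)) * \<eta> l" by simp
    also have "\<dots> = of_real (t (Suc l) - t l) * (CLINT x|\<Lambda>. (iexp (u l * x) - 1))"
      unfolding \<eta>_def by (rule iexp_jump_law)
    finally show "(\<Sum>j<K. of_real lam * (of_real (unit_clamp (t (Suc l) - real j) - unit_clamp (t l - real j)) * \<eta> l))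
       = of_real (t (Suc l) - t l) * (CLINT x|\<Lambda>. (iexp (u l * x) - 1))" .
  qed
  finally show ?thesis .
qed

lemma char_increment_path:
  assumes "0 \<le> s" "s \<le> s'"
  shows "(CLINT \<omega>|path_law. iexp (u * (path s' \<omega> - path s \<omega>))) = exp (of_real (s' - s) * (CLINT x|\<Lambda>. (iexp (u * x) - 1)))"
  using joint_char_path[of "\<lambda>i. if i = 0 then s else s'" 1 "\<lambda>_. u"] assms by simp

lemma path_0 [simp]: "path 0 \<omega> = 0" by (simp add: path_def)

lemma cadlag_path: "cadlag (\<lambda>t. path t \<omega>)"
  unfolding cadlag_def
proof (intro conjI allI impI)
  \<comment> \<open>Near \<open>t\<close> a fixed finite number of blocks suffices. The additional
    block is for times just after an integer \<open>t\<close>.\<close>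
  have ev: "eventually (\<lambda>s. path s \<omega> = (\<Sum>j<nat \<lceil>t\<rceil> + 1. block_sum j s (\<omega> j))) (nhds t)" for t
  proof -
    have "t < real (nat \<lceil>t\<rceil> + 1)" by linarith
    hence "eventually (\<lambda>s. s < real (nat \<lceil>t\<rceil> + 1)) (nhds t)" 
      using eventually_nhds_in_open[of "{..<real (nat \<lceil>t\<rceil> + 1)}" t] by simp
    thus ?thesis by eventually_elim (rule path_eq, simp)
  qed
  have evs: "eventually (\<lambda>s. path s \<omega> = (\<Sum>j<nat \<lceil>t\<rceil> + 1. block_sum j s (\<omega> j))) (at t within A)" for t A
    using ev[of t] by (auto simp: eventually_at_filter elim: eventually_mono)
  show "((\<lambda>t. path t \<omega>) \<longlongrightarrow> path t \<omega>) (at_right t)" for t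
  proof (subst tendsto_cong[OF evs])
    have act: "eventually (\<lambda>s. active j s y = active j t y) (at_right t)" for j y
    proof (cases "real j + fst y \<le> t")
      case True
      have "eventually (\<lambda>s. t < s) (at_right t)" by (rule eventually_at_right_less)
      thus ?thesis by eventually_elim (use True in \<open>auto simp: active_def\<close>)
    next
      case False
      hence "eventually (\<lambda>s. s < real j + fst y) (at_right t)" by (intro eventually_at_rightI[of t "real j + fst y"]) auto
      thus ?thesis by eventually_elim (use False in \<open>auto simp: active_def\<close>)
    qed
    have "((\<lambda>s. of_bool (active j s y) :: real) \<longlongrightarrow> of_bool (active j t y)) (at_right t)" for j y
      by (rule tendsto_eventually, rule eventually_mono[OF act[of j y]]) simp
    hence "((\<lambda>s. \<Sum>j<nat \<lceil>t\<rceil> + 1. block_sum j s (\<omega> j)) \<longlongrightarrow> (\<Sum>j<nat \<lceil>t\<rceil> + 1. block_sum j t (\<omega> j))) (at_right t)"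
      unfolding block_sum_def by (intro tendsto_intros)
    also have "(\<Sum>j<nat \<lceil>t\<rceil> + 1. block_sum j t (\<omega> j)) = path t \<omega>"
      by (rule path_eq[symmetric]) linarith
    finally show "((\<lambda>s. \<Sum>j<nat \<lceil>t\<rceil> + 1. block_sum j s (\<omega> j)) \<longlongrightarrow> path t \<omega>) (at_right t)" .
  qed
  show "\<exists>l. ((\<lambda>t. path t \<omega>) \<longlongrightarrow> l) (at_left t)" for t
  proof -
    have act: "eventually (\<lambda>s. active j s y = (0 < fst y \<and> real j + fst y < t)) (at_left t)" for j y
    proof (cases "real j + fst y < t")
      case True
      hence "eventually (\<lambda>s. real j + fst y < s) (at_left t)" by (auto simp: eventually_at_left_field)
      thus ?thesis by eventually_elim (use True in \<open>auto simp: active_def\<close>)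
    next
      case False
      have "eventually (\<lambda>s. s < t) (at_left t)" by (auto simp: eventually_at_filter)
      thus ?thesis by eventually_elim (use False in \<open>auto simp: active_def\<close>)
    qed
    have "((\<lambda>s. of_bool (active j s y) :: real) \<longlongrightarrow> of_bool (0 < fst y \<and> real j + fst y < t)) (at_left t)" for j y
      by (rule tendsto_eventually, rule eventually_mono[OF act[of j y]]) simp
    hence "((\<lambda>s. \<Sum>j<nat \<lceil>t\<rceil> + 1. block_sum j s (\<omega> j)) \<longlongrightarrow>
      (\<Sum>j<nat \<lceil>t\<rceil> + 1. \<Sum>i<fst (\<omega> j). snd (snd (\<omega> j) i) * of_bool (0 < fst (snd (\<omega> j) i) \<and> real j + fst (snd (\<omega> j) i) < t))) (at_left t)"
      unfolding block_sum_def by (intro tendsto_intros)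
    thus ?thesis by (subst tendsto_cong[OF evs]) blast
  qed
qed

lemma chain_path: "upwards_skip_free_levy_chain path_law path h \<Lambda>"
proof -
  interpret P: prob_space path_law unfolding path_law_def by (rule path.P.prob_space_axioms)
  have char: "char (distr path_law borel (\<lambda>\<omega>. path s' \<omega> - path s \<omega>)) u = exp (of_real (s' - s) * (CLINT x|\<Lambda>. (iexp (u * x) - 1)))"
    if "0 \<le> s" "s \<le> s'" for s s' u
    unfolding char_def using char_increment_path[OF that, of u] by (subst integral_distr) auto
  have char0: "char (distr path_law borel (path t)) u = exp (of_real t * (CLINT x|\<Lambda>. (iexp (u * x) - 1)))"
    if "0 \<le> t" for t u
    using char[of 0 t u] that by simp
  show ?thesis
  proof (intro upwards_skip_free_levy_chain.intro levy_process.intro levy_process_axioms.intro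
      upwards_skip_free_levy_chain_axioms.intro)
    show "prob_space path_law" by (rule P.prob_space_axioms)
    show "path t \<in> borel_measurable path_law" for t by measurable
    show "AE \<omega> in path_law. path 0 \<omega> = 0" by simp
    show "cadlag (\<lambda>t. path t \<omega>)" for \<omega> by (rule cadlag_path)
    show "distr path_law borel (\<lambda>\<omega>. path (s + t) \<omega> - path s \<omega>) = distr path_law borel (path t)"
      if "0 \<le> s" "0 \<le> t" for s t
    proof (rule Levy_uniqueness)
      show "char (distr path_law borel (\<lambda>\<omega>. path (s + t) \<omega> - path s \<omega>)) = char (distr path_law borel (path t))"
        using char[of s "s + t"] char0[of t] that by (simp add: fun_eq_iff)
    qed (intro P.real_distribution_distr; measurable)+
    show "P.indep_vars (\<lambda>_. borel) (\<lambda>i \<omega>. path (t (Suc i)) \<omega> - path (t i) \<omega>) {..<n}"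
      if "0 \<le> t 0" "\<And>i. i < n \<Longrightarrow> t i < t (Suc i)" for n and t :: "nat \<Rightarrow> real"
    proof (rule P.indep_vars_char)
      have t_ge: "0 \<le> t l" if "l \<le> n" for l using that
      proof (induction l)
        case (Suc l) thus ?case using \<open>\<And>i. i < n \<Longrightarrow> t i < t (Suc i)\<close>[of l] by simp
      qed (use \<open>0 \<le> t 0\<close> in simp)
      fix u :: "nat \<Rightarrow> real"
      have "(CLINT \<omega>|path_law. iexp (\<Sum>i<n. u i * (path (t (Suc i)) \<omega> - path (t i) \<omega>)))
          = (\<Prod>i<n. exp (of_real (t (Suc i) - t i) * (CLINT x|\<Lambda>. (iexp (u i * x) - 1))))"
        using joint_char_path[of t n u] that by (simp only: less_imp_le exp_sum finite_lessThan)
      also have "\<dots> = (\<Prod>i<n. CLINT \<omega>|path_law. iexp (u i * (path (t (Suc i)) \<omega> - path (t i) \<omega>)))"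
        by (rule prod.cong[OF refl], rule char_increment_path[symmetric]) (use that t_ge in \<open>auto simp: less_imp_le\<close>)
      finally show "(CLINT \<omega>|path_law. iexp (\<Sum>i<n. u i * (path (t (Suc i)) \<omega> - path (t i) \<omega>)))
          = (\<Prod>i<n. CLINT \<omega>|path_law. iexp (u i * (path (t (Suc i)) \<omega> - path (t i) \<omega>)))" .
    qed measurable
    show "char (distr path_law borel (path t)) u = exp (of_real t * (CLINT x|\<Lambda>. (iexp (u * x) - 1)))"
      if "0 \<le> t" for t u by (rule char0[OF that])
  qed (use h_pos sets_levy_measure finite_measure_axioms levy_measure_zero levy_measure_lattice skip_free in auto)
qed

end

context upwards_skip_free_levy_chain
begin

text \<open>A cadlag path is determined by its values at rational times, so the chain can be moved to
  the space of real sequences, equipped with the final sigma-algebra.\<close>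

lemma ex_chain_on_sequences:
  "\<exists>(N :: (nat \<Rightarrow> real) measure) Y. upwards_skip_free_levy_chain N Y h \<Lambda>"
proof -
  define Qs where "Qs = {q \<in> \<rat>. (0::real) \<le> q}"
  have "countable Qs" unfolding Qs_def by (rule countable_subset[OF _ countable_rat]) auto
  moreover have "Qs \<noteq> {}" by (auto simp: Qs_def intro!: exI[of _ 0])
  ultimately have range: "range (from_nat_into Qs) = Qs" by (intro range_from_nat_into)
  define e where "e \<omega> = (\<lambda>n. X (from_nat_into Qs n) \<omega>)" for \<omega>
  define \<Omega> where "\<Omega> = e ` space M"
  define S where "S = sigma \<Omega> {A. A \<subseteq> \<Omega> \<and> e -` A \<inter> space M \<in> sets M}"
  define N where "N = distr M S e"
  \<comment> \<open>Sample points with the same path are identified by \<open>e\<close>, so a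
    preimage has to be chosen; \<open>path_det\<close> shows that the choice does not change the
    value at any time \<open>t \<ge> 0\<close>.\<close>
  define Y where "Y t y = X t (inv_into (space M) e y)" for t y
  have spS: "space S = \<Omega>" unfolding S_def by (rule space_measure_of) auto
  have e[measurable]: "e \<in> M \<rightarrow>\<^sub>M S"
    unfolding S_def by (rule measurable_measure_of) (auto simp: \<Omega>_def)
  have path_det: "X t \<omega> = X t \<omega>'"
    if "\<omega> \<in> space M" "\<omega>' \<in> space M" "e \<omega> = e \<omega>'" "0 \<le> t" for t \<omega> \<omega>'
  proof (rule ccontr)
    assume ne: "X t \<omega> \<noteq> X t \<omega>'"
    have "((\<lambda>s. X s \<omega> - X s \<omega>') \<longlongrightarrow> X t \<omega> - X t \<omega>') (at_right t)"
      using cadlag_paths[OF that(1)] cadlag_paths[OF that(2)] that(4)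
      by (intro tendsto_diff) (auto simp: cadlag_def)
    hence "eventually (\<lambda>s. X s \<omega> - X s \<omega>' \<noteq> 0) (at_right t)"
      by (rule tendsto_imp_eventually_ne) (use ne in simp)
    then obtain b where b: "t < b" "\<And>s. t < s \<Longrightarrow> s < b \<Longrightarrow> X s \<omega> \<noteq> X s \<omega>'"
      by (auto simp: eventually_at_right_field)
    from Rats_dense_in_real[OF b(1)] obtain q where q: "q \<in> \<rat>" "t < q" "q < b" by blast
    hence "q \<in> Qs" using that(4) by (simp add: Qs_def)
    then obtain n where "q = from_nat_into Qs n" using range by auto
    hence "X q \<omega> = X q \<omega>'" using fun_cong[OF that(3), of n] by (simp add: e_def)
    thus False using b(2) q by auto
  qed
  have Ye: "Y t (e \<omega>) = X t \<omega>" if "\<omega> \<in> space M" "0 \<le> t" for t \<omega>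
    unfolding Y_def
    using that by (intro path_det) (auto intro: inv_into_into f_inv_into_f[symmetric] simp: f_inv_into_f)
  have Ym: "Y t \<in> S \<rightarrow>\<^sub>M borel" if t: "0 \<le> t" for t
  proof (rule measurableI)
    fix A :: "real set" assume A: "A \<in> sets borel"
    have "e -` (Y t -` A \<inter> \<Omega>) \<inter> space M = X t -` A \<inter> space M"
    proof (rule set_eqI)
      fix x show "x \<in> e -` (Y t -` A \<inter> \<Omega>) \<inter> space M \<longleftrightarrow> x \<in> X t -` A \<inter> space M"
        by (cases "x \<in> space M") (simp_all add: Ye t \<Omega>_def)
    qed
    hence "e -` (Y t -` A \<inter> \<Omega>) \<inter> space M \<in> sets M"
      using measurable_sets[OF measurable_at[OF t] A] by simp
    thus "Y t -` A \<inter> space S \<in> sets S"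
      unfolding spS unfolding S_def by (subst sets_measure_of) auto
  qed simp
  have YN: "Y t \<in> borel_measurable N" if "0 \<le> t" for t using Ym[OF that] by (simp add: N_def)
  have spN: "space N = \<Omega>" by (simp add: N_def spS)
  interpret N: prob_space N unfolding N_def by (rule prob_space_distr[OF e])
  have dist: "distr N K f = distr M K g"
    if "f \<in> S \<rightarrow>\<^sub>M K" "\<And>\<omega>. \<omega> \<in> space M \<Longrightarrow> f (e \<omega>) = g \<omega>" for K f and g :: "'a \<Rightarrow> 'c"
    unfolding N_def by (subst distr_distr[OF that(1) e]) (auto intro!: distr_cong that(2))
  have "upwards_skip_free_levy_chain N Y h \<Lambda>"
  proof (intro upwards_skip_free_levy_chain.intro levy_process.intro levy_process_axioms.intro
      upwards_skip_free_levy_chain_axioms.intro)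
    show "prob_space N" by (rule N.prob_space_axioms)
    show "Y t \<in> borel_measurable N" if "0 \<le> t" for t by (rule YN[OF that])
    have "AE \<omega> in M. Y 0 (e \<omega>) = 0"
      using start AE_space by eventually_elim (simp add: Ye)
    thus "AE y in N. Y 0 y = 0"
      unfolding N_def by (subst AE_distr_iff[OF e]) (use Ym[of 0] in \<open>auto intro!: pred_eq_const1\<close>)
    show "cadlag (\<lambda>t. Y t y)" if y: "y \<in> space N" for y
    proof -
      have "inv_into (space M) e y \<in> space M" using y by (auto simp: spN \<Omega>_def intro: inv_into_into)
      thus ?thesis unfolding Y_def by (rule cadlag_paths)
    qed
    show "distr N borel (\<lambda>y. Y (s + t) y - Y s y) = distr N borel (Y t)" if st: "0 \<le> s" "0 \<le> t" for s t
    proof -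
      note [measurable] = Ym[OF st(1)] Ym[OF st(2)] Ym[OF add_nonneg_nonneg[OF st]]
      have "distr N borel (\<lambda>y. Y (s + t) y - Y s y) = distr M borel (\<lambda>\<omega>. X (s + t) \<omega> - X s \<omega>)"
        by (rule dist) (use st in \<open>auto simp: Ye\<close>)
      also have "\<dots> = distr M borel (X t)" by (rule stationary_increments[OF st])
      also have "\<dots> = distr N borel (Y t)"
        by (rule dist[symmetric]) (use st in \<open>auto simp: Ye\<close>)
      finally show ?thesis .
    qed
    show "N.indep_vars (\<lambda>_. borel) (\<lambda>i y. Y (t (Suc i)) y - Y (t i) y) {..<n}"
      if t0: "0 \<le> t 0" and inc: "\<And>i. i < n \<Longrightarrow> t i < t (Suc i)" for n and t :: "nat \<Rightarrow> real"
    proof (cases "n = 0")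
      case True
      thus ?thesis by (simp add: N.indep_vars_def2 N.indep_sets_def)
    next
      case False
      have t_ge: "0 \<le> t l" if "l \<le> n" for l using that
      proof (induction l)
        case (Suc l) thus ?case using inc[of l] by simp
      qed (use t0 in simp)
      have mX: "(\<lambda>\<omega>. X (t (Suc i)) \<omega> - X (t i) \<omega>) \<in> borel_measurable M" if "i < n" for i
        using that t_ge[of i] t_ge[of "Suc i"] by (intro borel_measurable_diff measurable_at) auto
      have mY: "(\<lambda>y. Y (t (Suc i)) y - Y (t i) y) \<in> borel_measurable S" if "i < n" for i
        using that t_ge[of i] t_ge[of "Suc i"] by (intro borel_measurable_diff Ym) auto
      have mYN: "(\<lambda>y. Y (t (Suc i)) y - Y (t i) y) \<in> borel_measurable N" if "i < n" for i
        using mY[OF that] by (simp add: N_def)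
      have ind: "indep_vars (\<lambda>_. borel) (\<lambda>i \<omega>. X (t (Suc i)) \<omega> - X (t i) \<omega>) {..<n}"
        by (rule independent_increments[OF t0 inc])
      have XYd: "distr N borel (\<lambda>y. Y (t (Suc i)) y - Y (t i) y) = distr M borel (\<lambda>\<omega>. X (t (Suc i)) \<omega> - X (t i) \<omega>)"
        if "i < n" for i
        by (rule dist[OF mY[OF that]]) (use that t_ge[of i] t_ge[of "Suc i"] in \<open>auto simp: Ye\<close>)
      have "distr N (\<Pi>\<^sub>M i\<in>{..<n}. borel) (\<lambda>y. \<lambda>i\<in>{..<n}. Y (t (Suc i)) y - Y (t i) y)
          = distr M (\<Pi>\<^sub>M i\<in>{..<n}. borel) (\<lambda>\<omega>. \<lambda>i\<in>{..<n}. X (t (Suc i)) \<omega> - X (t i) \<omega>)"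
      proof (rule dist)
        show "(\<lambda>y. \<lambda>i\<in>{..<n}. Y (t (Suc i)) y - Y (t i) y) \<in> S \<rightarrow>\<^sub>M (\<Pi>\<^sub>M i\<in>{..<n}. borel)"
          by (rule measurable_restrict) (auto intro: mY)
      qed (use t_ge in \<open>auto simp: Ye restrict_def fun_eq_iff\<close>)
      also have "\<dots> = (\<Pi>\<^sub>M i\<in>{..<n}. distr M borel (\<lambda>\<omega>. X (t (Suc i)) \<omega> - X (t i) \<omega>))"
        using ind indep_vars_iff_distr_eq_PiM'[of "{..<n}" "\<lambda>i \<omega>. X (t (Suc i)) \<omega> - X (t i) \<omega>" "\<lambda>_. borel"] False mX
        by auto
      also have "\<dots> = (\<Pi>\<^sub>M i\<in>{..<n}. distr N borel (\<lambda>y. Y (t (Suc i)) y - Y (t i) y))"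
        by (rule PiM_cong) (auto simp: XYd)
      finally show ?thesis
        using N.indep_vars_iff_distr_eq_PiM'[of "{..<n}" "\<lambda>i y. Y (t (Suc i)) y - Y (t i) y" "\<lambda>_. borel"] False mYN
        by auto
    qed
    show "char (distr N borel (Y t)) u = exp (of_real t * (CLINT x|\<Lambda>. (iexp (u * x) - 1)))"
      if t: "0 \<le> t" for t u
    proof -
      have "distr N borel (Y t) = distr M borel (X t)"
        by (rule dist[OF Ym[OF t]]) (use t in \<open>auto simp: Ye\<close>)
      thus ?thesis using compound_Poisson[OF t] by simp
    qed
  qed (use h_pos sets_levy_measure finite_levy_measure levy_measure_zero levy_measure_lattice skip_free in auto)
  thus ?thesis by blast
qed

end

section \<open>Existence of realizations and exponential tilting\<close>

context skip_free_levy_measure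
begin

lemma chain_realization:
  "case chain_realization h \<Lambda> of (N, Y) \<Rightarrow> upwards_skip_free_levy_chain N Y h \<Lambda>"
proof -
  have "\<exists>(N :: (nat \<Rightarrow> real) measure) Y. upwards_skip_free_levy_chain N Y h \<Lambda>"
    by (rule upwards_skip_free_levy_chain.ex_chain_on_sequences[OF chain_path])
  hence "\<exists>x. case x of (N :: (nat \<Rightarrow> real) measure, Y) \<Rightarrow> upwards_skip_free_levy_chain N Y h \<Lambda>" by auto
  thus ?thesis unfolding chain_realization_def by (rule someI_ex)
qed

text \<open>Jumps never exceed \<open>h\<close>, so the exponential is bounded almost
  everywhere.\<close>

lemma integrable_exp_levy:
  assumes "0 \<le> b" shows "integrable \<Lambda> (\<lambda>x. exp (b * x))"
proof (rule integrable_const_bound[where B="exp (b * h)"])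
  show "AE x in \<Lambda>. norm (exp (b * x)) \<le> exp (b * h)"
    using AE_atoms
  proof eventually_elim
    case (elim x)
    then obtain k where "x = atoms k" by auto
    moreover have "0 \<le> real k * h" using h_pos by simp
    ultimately have "x \<le> h" using h_pos by (auto simp: atoms_def intro: order_trans[of _ 0])
    thus ?case using assms by (simp add: mult_left_mono)
  qed
qed simp

text \<open>A positive density leaves the open null sets, hence both supports, unchanged; finiteness
  is the exponential moment just shown.\<close>

lemma tilt_levy_measure:
  assumes b: "0 \<le> b" shows "skip_free_levy_measure (tilt \<Lambda> b) h"
proof (intro skip_free_levy_measure.intro skip_free_levy_measure_axioms.intro)
  show "finite_measure (tilt \<Lambda> b)"
  proof (rule finite_measureI)
    have "emeasure (tilt \<Lambda> b) (space (tilt \<Lambda> b)) = (\<integral>\<^sup>+x. ennreal (exp (b * x)) \<partial>\<Lambda>)"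
      by (simp add: tilt_def emeasure_density sets_levy_measure cong: nn_integral_cong)
    also have "\<dots> = ennreal (\<integral>x. exp (b * x) \<partial>\<Lambda>)"
      by (rule nn_integral_eq_integral[OF integrable_exp_levy[OF b]]) auto
    finally show "emeasure (tilt \<Lambda> b) (space (tilt \<Lambda> b)) \<noteq> \<infinity>" by simp
  qed
  show "emeasure (tilt \<Lambda> b) {0} = 0"
  proof -
    have "{0} \<in> null_sets (tilt \<Lambda> b)"
      unfolding tilt_def using levy_measure_zero
      by (subst null_sets_density_iff) (auto simp: sets_levy_measure intro!: AE_I'[of "{0}"] null_setsI)
    thus ?thesis by auto
  qed
  have "density (tilt \<Lambda> b) (indicator {0<..}) = density (density \<Lambda> (indicator {0<..})) (\<lambda>x. ennreal (exp (b * x)))"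
    unfolding tilt_def
    by (subst (1 2) density_density_eq) (auto intro!: density_cong simp: mult.commute)
  also have "msupport \<dots> = {h}"
    by (subst msupport_density_pos) (auto simp: sets_levy_measure skip_free)
  finally show "msupport (density (tilt \<Lambda> b) (indicator {0<..})) = {h}" .
  show "msupport (tilt \<Lambda> b) \<subseteq> lattice_points h"
    unfolding tilt_def by (subst msupport_density_pos) (auto simp: sets_levy_measure levy_measure_lattice[THEN subsetD])
qed (use h_pos in \<open>auto simp: tilt_def sets_levy_measure\<close>)

lemma integral_tilt:
  fixes f :: "real \<Rightarrow> real"
  assumes [measurable]: "f \<in> borel_measurable borel"
  shows "(\<integral>x. f x \<partial>tilt \<Lambda> b) = (\<integral>x. exp (b * x) * f x \<partial>\<Lambda>)"
  unfolding tilt_def by (subst integral_density) auto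

lemma measure_tilt: "measure (tilt \<Lambda> b) {c} = exp (b * c) * measure \<Lambda> {c}"
proof -
  have "emeasure (tilt \<Lambda> b) {c} = (\<integral>\<^sup>+x. ennreal (exp (b * c)) * indicator {c} x \<partial>\<Lambda>)"
    unfolding tilt_def by (subst emeasure_density)
      (auto simp: sets_levy_measure intro!: nn_integral_cong simp: indicator_def)
  also have "\<dots> = ennreal (exp (b * c)) * emeasure \<Lambda> {c}"
    by (rule nn_integral_cmult_indicator) (simp add: sets_levy_measure)
  finally show ?thesis by (simp add: measure_def enn2real_mult)
qed

end

section \<open>Exit along a refining time grid\<close>

text \<open>The sequence \<open>x + s\<close> leaves \<open>[0, b)\<close> at step \<open>k\<close> and does so downwards. The series below has at most
  one nonzero term.\<close>

definition exit_at :: "ereal \<Rightarrow> real \<Rightarrow> (nat \<Rightarrow> real) \<Rightarrow> nat \<Rightarrow> bool" where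
  "exit_at b x s k \<longleftrightarrow> (\<forall>j<k. 0 \<le> x + s j \<and> ereal (x + s j) < b) \<and> x + s k < 0"

definition exit_val :: "real \<Rightarrow> ereal \<Rightarrow> real \<Rightarrow> (nat \<Rightarrow> real) \<Rightarrow> real" where
  "exit_val r b x s = (\<Sum>k. r ^ k * of_bool (exit_at b x s k))"

lemma exit_at_unique: "exit_at b x s k \<Longrightarrow> exit_at b x s k' \<Longrightarrow> k = k'"
proof -
  assume k: "exit_at b x s k" "exit_at b x s k'"
  have "\<not> k < k'" "\<not> k' < k" using k unfolding exit_at_def not_less by (force simp: not_le[symmetric])+
  thus ?thesis by simp
qed

lemma exit_val_eq:
  assumes k: "exit_at b x s k"
  shows "exit_val r b x s = r ^ k"
proof -
  have "exit_val r b x s = (\<Sum>k'\<in>{k}. r ^ k' * of_bool (exit_at b x s k'))"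
    unfolding exit_val_def
    by (rule suminf_finite) (use exit_at_unique[OF k] in auto)
  thus ?thesis using k by simp
qed

lemma exit_val_0: "(\<And>k. \<not> exit_at b x s k) \<Longrightarrow> exit_val r b x s = 0"
  by (simp add: exit_val_def)

lemma exit_val_bounds:
  assumes "0 \<le> r" "r \<le> 1"
  shows "0 \<le> exit_val r b x s" "exit_val r b x s \<le> 1"
proof -
  have "0 \<le> exit_val r b x s \<and> exit_val r b x s \<le> 1"
  proof (cases "\<exists>k. exit_at b x s k")
    case True
    then obtain k where "exit_at b x s k" ..
    from exit_val_eq[OF this, of r] show ?thesis using assms by (simp add: power_le_one)
  next
    case False
    thus ?thesis by (simp add: exit_val_0)
  qed
  thus "0 \<le> exit_val r b x s" "exit_val r b x s \<le> 1" by auto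
qed

lemma exit_val_neg: "x + s 0 < 0 \<Longrightarrow> exit_val r b x s = 1"
  using exit_val_eq[of b x s 0 r] by (simp add: exit_at_def)

lemma exit_val_above:
  assumes "0 \<le> x + s 0" "b \<le> ereal (x + s 0)"
  shows "exit_val r b x s = 0"
proof (rule exit_val_0)
  fix k show "\<not> exit_at b x s k"
    using assms by (cases k) (auto simp: exit_at_def not_less)
qed

lemma exit_val_step:
  assumes "0 \<le> x + s 0" "ereal (x + s 0) < b" and s': "\<And>k. x + s (Suc k) = x' + s' k"
  shows "exit_val r b x s = r * exit_val r b x' s'"
proof -
  have Suc: "exit_at b x s (Suc k) \<longleftrightarrow> exit_at b x' s' k" for k
  proof -
    have "(\<forall>j<Suc k. 0 \<le> x + s j \<and> ereal (x + s j) < b) \<longleftrightarrow> (\<forall>j<k. 0 \<le> x + s (Suc j) \<and> ereal (x + s (Suc j)) < b)"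
      using assms(1,2) less_Suc_eq_0_disj by metis
    thus ?thesis unfolding exit_at_def s' by simp
  qed
  have 0: "\<not> exit_at b x s 0" using assms by (simp add: exit_at_def)
  show ?thesis
  proof (cases "\<exists>k. exit_at b x' s' k")
    case True
    then obtain k where k: "exit_at b x' s' k" by blast
    hence "exit_at b x s (Suc k)" by (simp add: Suc)
    thus ?thesis by (simp add: exit_val_eq[OF k] exit_val_eq)
  next
    case False
    hence "\<not> exit_at b x s k" for k using Suc 0 by (cases k) auto
    thus ?thesis using False by (simp add: exit_val_0)
  qed
qed

lemma exit_val_measurable [measurable]:
  assumes [measurable]: "f \<in> borel_measurable N" "\<And>k. (\<lambda>\<omega>. s \<omega> k) \<in> borel_measurable N"
  shows "(\<lambda>\<omega>. exit_val r b (f \<omega>) (s \<omega>)) \<in> borel_measurable N"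
  unfolding exit_val_def exit_at_def by measurable

text \<open>The continuous-time counterpart of \<open>exit_val\<close>. The barrier condition refers
  to some time \<open>t\<close> of negativity and not to the infimum, at which \<open>x + f\<close>
  may still be nonnegative.\<close>

definition exit_lim :: "real \<Rightarrow> ereal \<Rightarrow> real \<Rightarrow> (real \<Rightarrow> real) \<Rightarrow> real" where
  "exit_lim q b x f = (if \<exists>t\<ge>0. x + f t < 0 \<and> (\<forall>s. 0 \<le> s \<and> s \<le> t \<longrightarrow> ereal (x + f s) < b)
     then exp (- q * Inf {t. 0 \<le> t \<and> x + f t < 0}) else 0)"

lemma eventually_dyadic:
  assumes "0 \<le> (t::real)" "0 < \<eta>"
  shows "eventually (\<lambda>m. \<exists>k. t \<le> real k / 2 ^ m \<and> real k / 2 ^ m < t + \<eta>) sequentially"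
proof -
  have "(\<lambda>m. (1/2::real) ^ m) \<longlonglongrightarrow> 0" by (rule LIMSEQ_realpow_zero) auto
  hence "eventually (\<lambda>m. (1/2::real) ^ m < \<eta>) sequentially" by (rule order_tendstoD) (use assms in simp)
  thus ?thesis
  proof eventually_elim
    case (elim m)
    define k where "k = nat \<lceil>t * 2 ^ m\<rceil>"
    have "t * 2 ^ m \<le> real k" "real k < t * 2 ^ m + 1" using assms by (auto simp: k_def) linarith+
    hence "t \<le> real k / 2 ^ m" "real k / 2 ^ m < t + (1/2) ^ m"
      by (auto simp: field_simps power_divide)
    thus ?case using elim by (intro exI[of _ k]) auto
  qed
qed

text \<open>If the exit comes first, the first negative grid time tends to the infimum from the
  right. If the barrier comes first, some grid time must see it, and this is what
  \<open>stay\<close> guarantees: after touching the barrier the path remains there for a positive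
  time.\<close>

lemma exit_val_tendsto:
  assumes rc: "\<And>t. 0 \<le> t \<Longrightarrow> (f \<longlongrightarrow> f t) (at_right t)" and b: "0 \<le> b"
    and stay: "\<And>t. 0 \<le> t \<Longrightarrow> b \<le> ereal (x + f t) \<Longrightarrow> eventually (\<lambda>s. b \<le> ereal (x + f s)) (at_right t)"
  shows "(\<lambda>m. exit_val (exp (- q / 2 ^ m)) b x (\<lambda>k. f (real k / 2 ^ m))) \<longlonglongrightarrow> exit_lim q b x f"
proof -
  define S where "S = {t. 0 \<le> t \<and> x + f t < 0}"
  have bdd: "bdd_below S" by (auto simp: S_def bdd_below_def)
  have right: "\<exists>\<eta>>0. \<forall>s. t \<le> s \<and> s < t + \<eta> \<longrightarrow> P s"
    if "P t" "eventually P (at_right t)" for P and t :: real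
  proof -
    from that(2) obtain c where c: "t < c" "\<And>s. t < s \<Longrightarrow> s < c \<Longrightarrow> P s" by (auto simp: eventually_at_right_field)
    thus ?thesis using that(1) by (intro exI[of _ "c - t"]) (auto simp: order.order_iff_strict)
  qed
  show ?thesis
  proof (cases "\<exists>t\<ge>0. x + f t < 0 \<and> (\<forall>s. 0 \<le> s \<and> s \<le> t \<longrightarrow> ereal (x + f s) < b)")
    case True
    then obtain t where t: "0 \<le> t" "x + f t < 0" "\<And>s. 0 \<le> s \<Longrightarrow> s \<le> t \<Longrightarrow> ereal (x + f s) < b" by blast
    define T where "T = Inf S"
    have tS: "t \<in> S" using t by (simp add: S_def)
    have Tt: "T \<le> t" unfolding T_def using tS bdd by (rule cInf_lower)
    have T0: "0 \<le> T" unfolding T_def using tS by (intro cInf_greatest) (auto simp: S_def)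
    have L: "exit_lim q b x f = exp (- q * T)" unfolding exit_lim_def T_def S_def using True by auto
    have close: "eventually (\<lambda>m. \<exists>\<tau>. T \<le> \<tau> \<and> \<tau> < T + \<epsilon> \<and>
        exit_val (exp (- q / 2 ^ m)) b x (\<lambda>k. f (real k / 2 ^ m)) = exp (- q * \<tau>)) sequentially"
      if \<epsilon>: "0 < \<epsilon>" for \<epsilon>
    proof -
      \<comment> \<open>The infimum \<open>T\<close> may lie outside \<open>S\<close>, so a negative
        time \<open>t'\<close> near it is used. With \<open>t' \<le> t\<close> the barrier has not
        been reached up to \<open>t'\<close>.\<close>
      obtain t' where t': "t' \<in> S" "t' \<le> t" "t' < T + \<epsilon>"
      proof (cases "T = t")
        case True thus ?thesis using tS \<epsilon> by (intro that[of t]) auto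
      next
        case False
        hence "Inf S < min (T + \<epsilon>) t" using Tt \<epsilon> by (simp add: T_def)
        then obtain z where "z \<in> S" "z < min (T + \<epsilon>) t" using cInf_lessD[of S] tS by blast
        thus ?thesis by (intro that[of z]) auto
      qed
      have t'0: "0 \<le> t'" using t' by (simp add: S_def)
      have "((\<lambda>s. x + f s) \<longlongrightarrow> x + f t') (at_right t')" by (intro tendsto_intros rc t'0)
      hence "eventually (\<lambda>s. x + f s < 0) (at_right t')" by (rule order_tendstoD) (use t' in \<open>simp add: S_def\<close>)
      from right[OF _ this] t' obtain \<eta> where \<eta>: "0 < \<eta>" "\<And>s. t' \<le> s \<Longrightarrow> s < t' + \<eta> \<Longrightarrow> x + f s < 0"
        by (auto simp: S_def)
      have "0 < min \<eta> (T + \<epsilon> - t')" using \<eta> t' by simp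
      from eventually_dyadic[OF t'0 this] show ?thesis
      proof eventually_elim
        case (elim m)
        then obtain k where k: "t' \<le> real k / 2 ^ m" "real k / 2 ^ m < t' + \<eta>" "real k / 2 ^ m < T + \<epsilon>" by auto
        define k0 where "k0 = (LEAST k. x + f (real k / 2 ^ m) < 0)"
        have fk: "x + f (real k / 2 ^ m) < 0" using k \<eta> by auto
        have k0: "x + f (real k0 / 2 ^ m) < 0" unfolding k0_def using fk by (rule LeastI)
        have k0k: "k0 \<le> k" unfolding k0_def using fk by (rule Least_le)
        have "exit_at b x (\<lambda>k. f (real k / 2 ^ m)) k0"
          unfolding exit_at_def
        proof (intro conjI allI impI)
          fix j assume j: "j < k0"
          hence nj: "\<not> x + f (real j / 2 ^ m) < 0" unfolding k0_def by (rule not_less_Least)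
          thus "0 \<le> x + f (real j / 2 ^ m)" by simp
          have "real j / 2 ^ m \<le> real k / 2 ^ m" using j k0k by (intro divide_right_mono) auto
          \<comment> \<open>The path is negative on \<open>[t', t' + \<eta>)\<close>. Hence a grid
            time up to that of \<open>k\<close> at which the path is nonnegative lies before
            \<open>t'\<close>, where the barrier has not been reached.\<close>
          moreover have "\<not> (t' \<le> real j / 2 ^ m \<and> real j / 2 ^ m < t' + \<eta>)" using \<eta>(2) nj by blast
          ultimately have "real j / 2 ^ m < t'" using k by linarith
          thus "ereal (x + f (real j / 2 ^ m)) < b" using t' by (intro t) auto
        qed (rule k0)
        hence "exit_val (exp (- q / 2 ^ m)) b x (\<lambda>k. f (real k / 2 ^ m)) = exp (- q / 2 ^ m) ^ k0"
          by (rule exit_val_eq)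
        also have "\<dots> = exp (- q * (real k0 / 2 ^ m))"
          by (simp add: exp_of_nat_mult[symmetric] mult.commute)
        finally have "exit_val (exp (- q / 2 ^ m)) b x (\<lambda>k. f (real k / 2 ^ m)) = exp (- q * (real k0 / 2 ^ m))" .
        moreover have "T \<le> real k0 / 2 ^ m" unfolding T_def
          by (rule cInf_lower[OF _ bdd]) (use k0 in \<open>auto simp: S_def\<close>)
        moreover have "real k0 / 2 ^ m < T + \<epsilon>"
          using k0k k(3) by (smt (verit) divide_right_mono of_nat_mono zero_le_power)
        ultimately show ?case by blast
      qed
    qed
    show ?thesis unfolding L
    proof (rule tendstoI)
      fix e :: real assume e: "0 < e"
      have "isCont (\<lambda>\<tau>. exp (- q * \<tau>)) T" by (intro continuous_intros)
      then obtain d where d: "0 < d" "\<And>\<tau>. dist \<tau> T < d \<Longrightarrow> dist (exp (- q * \<tau>)) (exp (- q * T)) < e"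
        unfolding continuous_at_eps_delta using e by blast
      from close[OF d(1)] show "eventually (\<lambda>m. dist (exit_val (exp (- q / 2 ^ m)) b x (\<lambda>k. f (real k / 2 ^ m))) (exp (- q * T)) < e) sequentially"
      proof eventually_elim
        case (elim m)
        then obtain \<tau> where \<tau>: "T \<le> \<tau>" "\<tau> < T + d"
          "exit_val (exp (- q / 2 ^ m)) b x (\<lambda>k. f (real k / 2 ^ m)) = exp (- q * \<tau>)" by blast
        show ?case unfolding \<tau>(3) by (rule d) (use \<tau> in \<open>simp add: dist_real_def\<close>)
      qed
    qed
  next
    case False
    hence L: "exit_lim q b x f = 0" unfolding exit_lim_def by (rule if_not_P)
    define B where "B = {t. 0 \<le> t \<and> b \<le> ereal (x + f t)}"
    have SB: "\<exists>s\<in>B. s \<le> t" if "t \<in> S" for t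
      using False that by (auto simp: S_def B_def not_less)
    show ?thesis
    proof (cases "B = {}")
      case True
      hence "S = {}" using SB by auto
      hence "\<not> exit_at b x (\<lambda>k. f (real k / 2 ^ m)) k" for m k
        by (auto simp: exit_at_def S_def dest: spec[of _ "real k / 2 ^ m"])
      thus ?thesis unfolding L by (simp add: exit_val_0)
    next
      case False
      define T where "T = Inf B"
      have bddB: "bdd_below B" by (auto simp: B_def bdd_below_def)
      have T0: "0 \<le> T" unfolding T_def using False by (intro cInf_greatest) (auto simp: B_def)
      \<comment> \<open>If the path were below the barrier at \<open>T\<close>, right continuity
        would keep it there on a right neighbourhood, against \<open>T = Inf B\<close>.\<close>
      have TB: "b \<le> ereal (x + f T)"
      proof (rule ccontr)
        assume "\<not> b \<le> ereal (x + f T)"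
        hence less: "ereal (x + f T) < b" by simp
        have "((\<lambda>s. ereal (x + f s)) \<longlongrightarrow> ereal (x + f T)) (at_right T)" by (intro tendsto_intros rc T0)
        hence "eventually (\<lambda>s. ereal (x + f s) < b) (at_right T)" by (rule order_tendstoD) (rule less)
        from right[OF less this] obtain \<eta> where \<eta>: "0 < \<eta>" "\<And>s. T \<le> s \<Longrightarrow> s < T + \<eta> \<Longrightarrow> ereal (x + f s) < b" by auto
        have "Inf B < T + \<eta>" using \<eta> by (simp add: T_def)
        then obtain z where z: "z \<in> B" "z < T + \<eta>" using cInf_lessD[OF False] by blast
        moreover have "T \<le> z" unfolding T_def using z(1) bddB by (rule cInf_lower)
        ultimately show False using \<eta>(2)[of z] by (auto simp: B_def)
      qed
      from right[OF TB stay[OF T0 TB]] obtain \<eta> where \<eta>: "0 < \<eta>" "\<And>s. T \<le> s \<Longrightarrow> s < T + \<eta> \<Longrightarrow> b \<le> ereal (x + f s)" by auto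
      from eventually_dyadic[OF T0 \<eta>(1)]
      have "eventually (\<lambda>m. exit_val (exp (- q / 2 ^ m)) b x (\<lambda>k. f (real k / 2 ^ m)) = 0) sequentially"
      proof eventually_elim
        case (elim m)
        then obtain k where k: "T \<le> real k / 2 ^ m" "real k / 2 ^ m < T + \<eta>" by blast
        show ?case
        proof (rule exit_val_0, rule notI)
          fix k' assume k': "exit_at b x (\<lambda>k. f (real k / 2 ^ m)) k'"
          have neg: "x + f (real k' / 2 ^ m) < 0" using k' by (simp add: exit_at_def)
          hence "real k' / 2 ^ m \<in> S" by (simp add: S_def)
          from SB[OF this] obtain s where s: "s \<in> B" "s \<le> real k' / 2 ^ m" by blast
          have "T \<le> s" unfolding T_def using s(1) bddB by (rule cInf_lower)
          hence Tk: "T \<le> real k' / 2 ^ m" using s by simp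
          \<comment> \<open>An exit after index \<open>k\<close> is impossible because the barrier
            is seen at \<open>k\<close>. An exit up to index \<open>k\<close> happens in
            \<open>[T, T + \<eta>)\<close>, where the path is at least
            \<open>b \<ge> 0\<close>.\<close>
          show False
          proof (cases "k < k'")
            case True
            thus False using k' \<eta>(2)[OF k] by (auto simp: exit_at_def not_less[symmetric])
          next
            case False
            hence "real k' / 2 ^ m \<le> real k / 2 ^ m" by (intro divide_right_mono) auto
            hence "b \<le> ereal (x + f (real k' / 2 ^ m))" using k by (intro \<eta>(2) Tk) auto
            hence "0 \<le> ereal (x + f (real k' / 2 ^ m))" using b by (rule order_trans[rotated])
            thus False using neg by simp
          qed
        qed
      qed
      thus ?thesis unfolding L by (rule tendsto_eventually)
    qed
  qed
qed

section \<open>Exit probabilities are harmonic\<close>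

context upwards_skip_free_levy_chain
begin

text \<open>Stated for a random walk with independent steps on a product space, where restarting
  after one step is a shift of coordinates. \<open>grid_exit_eq\<close> transfers it to the sampled
  chain.\<close>

definition grid_exit :: "real \<Rightarrow> ereal \<Rightarrow> real \<Rightarrow> real \<Rightarrow> real" where
  "grid_exit q b \<delta> x = (\<integral>\<omega>. exit_val (exp (- q * \<delta>)) b x (\<lambda>k. \<Sum>i<k. \<omega> i)
     \<partial>PiM UNIV (\<lambda>_. distr M borel (X \<delta>)))"

text \<open>As a limit of grid values this is measurable in \<open>x\<close> without reference to
  paths. Convergence is proved for lattice points, which carry \<open>\<Lambda>\<close>.\<close>

definition exit_fun :: "real \<Rightarrow> ereal \<Rightarrow> real \<Rightarrow> real" where
  "exit_fun q b x = lim (\<lambda>m. grid_exit q b (1 / 2 ^ m) x)"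

context
  fixes q :: real and b :: ereal and \<delta> :: real
  assumes q: "0 \<le> q" and \<delta>: "0 < \<delta>"
begin

lemma walk_law_sequence_space: "sequence_space (distr M borel (X \<delta>))"
proof -
  have "X \<delta> \<in> borel_measurable M" using \<delta> by (intro measurable_at) simp
  then interpret N: prob_space "distr M borel (X \<delta>)" by (rule prob_space_distr)
  show ?thesis by unfold_locales
qed

interpretation W: sequence_space "distr M borel (X \<delta>)" by (rule walk_law_sequence_space)
interpretation N: prob_space "distr M borel (X \<delta>)" using measurable_at[of \<delta>] \<delta> by (intro prob_space_distr) simp
interpretation NW: pair_prob_space "distr M borel (X \<delta>)" "PiM UNIV (\<lambda>_::nat. distr M borel (X \<delta>))" ..

lemma r_bounds: "0 \<le> exp (- q * \<delta>)" "exp (- q * \<delta>) \<le> 1"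
  using q \<delta> by auto

lemma exit_integrable:
  assumes "finite_measure K" "f \<in> borel_measurable K" "\<And>k. (\<lambda>\<omega>. s \<omega> k) \<in> borel_measurable K"
  shows "integrable K (\<lambda>\<omega>. exit_val (exp (- q * \<delta>)) b (f \<omega>) (s \<omega>))"
  using assms(2,3) exit_val_bounds[OF r_bounds]
  by (intro finite_measure.integrable_const_bound[OF assms(1), where B=1] exit_val_measurable) auto

lemma sums_measurable [measurable]:
  "(\<lambda>\<omega>. \<Sum>i<k. \<omega> i) \<in> borel_measurable (PiM UNIV (\<lambda>_::nat. distr M borel (X \<delta>)))"
  by measurable

lemma grid_exit_bounds: "0 \<le> grid_exit q b \<delta> x" "grid_exit q b \<delta> x \<le> 1"
proof -
  show "0 \<le> grid_exit q b \<delta> x" unfolding grid_exit_def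
    by (rule Bochner_Integration.integral_nonneg) (use exit_val_bounds[OF r_bounds] in auto)
  have "grid_exit q b \<delta> x \<le> (\<integral>\<omega>. 1 \<partial>PiM UNIV (\<lambda>_::nat. distr M borel (X \<delta>)))" unfolding grid_exit_def
    by (rule Bochner_Integration.integral_mono)
      (use exit_val_bounds[OF r_bounds] exit_integrable[OF W.P.finite_measure_axioms] in auto)
  thus "grid_exit q b \<delta> x \<le> 1" by (simp add: W.P.prob_space)
qed

lemma grid_exit_measurable [measurable]: "grid_exit q b \<delta> \<in> borel_measurable borel"
  unfolding grid_exit_def by measurable

lemma grid_exit_neg: "x < 0 \<Longrightarrow> grid_exit q b \<delta> x = 1"
  unfolding grid_exit_def by (simp add: exit_val_neg W.P.prob_space)

lemma grid_exit_above: "0 \<le> x \<Longrightarrow> b \<le> ereal x \<Longrightarrow> grid_exit q b \<delta> x = 0"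
  unfolding grid_exit_def by (simp add: exit_val_above)

text \<open>Prefixing an independent step to an i.i.d. sequence reproduces its law. After its first
  step the walk is therefore a fresh walk from the new position, at the price of one discount
  factor.\<close>

lemma grid_exit_step:
  assumes x: "0 \<le> x" "ereal x < b"
  shows "grid_exit q b \<delta> x = exp (- q * \<delta>) * (\<integral>\<omega>. grid_exit q b \<delta> (x + X \<delta> \<omega>) \<partial>M)"
proof -
  let ?N = "distr M borel (X \<delta>)" and ?r = "exp (- q * \<delta>)"
  let ?S = "PiM UNIV (\<lambda>_::nat. ?N)"
  define g where "g y \<omega> = exit_val ?r b y (\<lambda>k. \<Sum>i<k. \<omega> i)" for y and \<omega> :: "nat \<Rightarrow> real"
  have [measurable]: "X \<delta> \<in> borel_measurable M" using \<delta> by (intro measurable_at) simp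
  have gm[measurable]: "g y \<in> borel_measurable ?S" for y
    unfolding g_def by measurable
  have "grid_exit q b \<delta> x = (\<integral>\<omega>. g x \<omega> \<partial>distr (?N \<Otimes>\<^sub>M ?S) ?S (\<lambda>(s, \<omega>). case_nat s \<omega>))"
    unfolding W.PiM_iter grid_exit_def g_def ..
  also have "\<dots> = (\<integral>p. g x (case p of (s, \<omega>) \<Rightarrow> case_nat s \<omega>) \<partial>(?N \<Otimes>\<^sub>M ?S))"
    by (rule integral_distr) measurable
  also have "\<dots> = (\<integral>p. ?r * g (x + fst p) (snd p) \<partial>(?N \<Otimes>\<^sub>M ?S))"
  proof (rule Bochner_Integration.integral_cong[OF refl])
    fix p :: "real \<times> (nat \<Rightarrow> real)"
    obtain a w where p: "p = (a, w)" by (cases p)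
    have "(\<Sum>i<Suc k. case_nat a w i) = a + (\<Sum>i<k. w i)" for k
      by (subst sum.lessThan_Suc_shift) simp
    thus "g x (case p of (s, \<omega>) \<Rightarrow> case_nat s \<omega>) = ?r * g (x + fst p) (snd p)"
      unfolding g_def p prod.case fst_conv snd_conv
      by (intro exit_val_step) (use x in \<open>auto simp del: sum.lessThan_Suc\<close>)
  qed
  also have "\<dots> = ?r * (\<integral>p. g (x + fst p) (snd p) \<partial>(?N \<Otimes>\<^sub>M ?S))" by simp
  also have "(\<integral>p. g (x + fst p) (snd p) \<partial>(?N \<Otimes>\<^sub>M ?S)) = (\<integral>y. (\<integral>\<omega>. g (x + y) \<omega> \<partial>?S) \<partial>?N)"
  proof -
    have [measurable]: "(\<lambda>p. \<Sum>i<k. snd p i) \<in> borel_measurable (?N \<Otimes>\<^sub>M ?S)" for k by measurable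
    have "integrable (?N \<Otimes>\<^sub>M ?S) (\<lambda>p. g (x + fst p) (snd p))"
      unfolding g_def by (rule exit_integrable) (auto intro: NW.finite_measure_axioms)
    from NW.integral_fst'[OF this] show ?thesis by simp
  qed
  also have "\<dots> = (\<integral>y. grid_exit q b \<delta> (x + y) \<partial>?N)" unfolding grid_exit_def g_def ..
  also have "\<dots> = (\<integral>\<omega>. grid_exit q b \<delta> (x + X \<delta> \<omega>) \<partial>M)"
    by (rule integral_distr) measurable
  finally show ?thesis .
qed

lemma distr_increments:
  "distr M (PiM UNIV (\<lambda>_. borel)) (\<lambda>\<omega> i. X (real (Suc i) * \<delta>) \<omega> - X (real i * \<delta>) \<omega>)
     = PiM UNIV (\<lambda>_::nat. distr M borel (X \<delta>))"
proof -
  have Xm: "(\<lambda>\<omega>. X (real (Suc i) * \<delta>) \<omega> - X (real i * \<delta>) \<omega>) \<in> borel_measurable M" for i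
    using \<delta> by (intro borel_measurable_diff measurable_at) auto
  have "indep_vars (\<lambda>_. borel) (\<lambda>i \<omega>. X (real (Suc i) * \<delta>) \<omega> - X (real i * \<delta>) \<omega>) {..<n}" for n
    by (rule independent_increments[of "\<lambda>i. real i * \<delta>"]) (use \<delta> in auto)
  hence "indep_vars (\<lambda>_. borel) (\<lambda>i \<omega>. X (real (Suc i) * \<delta>) \<omega> - X (real i * \<delta>) \<omega>) UNIV"
    unfolding indep_vars_def2 
  proof (intro conjI ballI)
    assume *: "\<And>n. (\<forall>i\<in>{..<n}. random_variable borel (\<lambda>\<omega>. X (real (Suc i) * \<delta>) \<omega> - X (real i * \<delta>) \<omega>)) \<and>
      indep_sets (\<lambda>i. {(\<lambda>\<omega>. X (real (Suc i) * \<delta>) \<omega> - X (real i * \<delta>) \<omega>) -` A \<inter> space M |A. A \<in> sets borel}) {..<n}"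
    show "indep_sets (\<lambda>i. {(\<lambda>\<omega>. X (real (Suc i) * \<delta>) \<omega> - X (real i * \<delta>) \<omega>) -` A \<inter> space M |A. A \<in> sets borel}) UNIV"
    proof (subst indep_sets_finite_index_sets, intro allI impI)
      fix J :: "nat set" assume J: "finite J"
      hence "J \<subseteq> {..<Suc (Max J)}" by (auto simp: less_Suc_eq_le)
      thus "indep_sets (\<lambda>i. {(\<lambda>\<omega>. X (real (Suc i) * \<delta>) \<omega> - X (real i * \<delta>) \<omega>) -` A \<inter> space M |A. A \<in> sets borel}) J"
        using *[of "Suc (Max J)"] by (blast intro: indep_sets_mono_index)
    qed
  qed (rule Xm)
  hence "distr M (\<Pi>\<^sub>M i\<in>UNIV. borel) (\<lambda>\<omega>. \<lambda>i\<in>UNIV. X (real (Suc i) * \<delta>) \<omega> - X (real i * \<delta>) \<omega>)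
      = (\<Pi>\<^sub>M i\<in>UNIV. distr M borel (\<lambda>\<omega>. X (real (Suc i) * \<delta>) \<omega> - X (real i * \<delta>) \<omega>))"
    by (subst (asm) indep_vars_iff_distr_eq_PiM) (simp_all only: Xm UNIV_not_empty not_False_eq_True)
  moreover have "distr M borel (\<lambda>\<omega>. X (real (Suc i) * \<delta>) \<omega> - X (real i * \<delta>) \<omega>) = distr M borel (X \<delta>)" for i
    using stationary_increments[of "real i * \<delta>" \<delta>] \<delta> by (simp add: algebra_simps)
  ultimately show ?thesis by (simp add: restrict_UNIV)
qed

lemma grid_exit_eq:
  "grid_exit q b \<delta> x = (\<integral>\<omega>. exit_val (exp (- q * \<delta>)) b x (\<lambda>k. X (real k * \<delta>) \<omega>) \<partial>M)"
proof -
  let ?r = "exp (- q * \<delta>)"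
  have [measurable]: "X (real i * \<delta>) \<in> borel_measurable M" for i using \<delta> by (intro measurable_at) simp
  have "grid_exit q b \<delta> x = (\<integral>\<omega>. exit_val ?r b x (\<lambda>k. \<Sum>i<k. X (real (Suc i) * \<delta>) \<omega> - X (real i * \<delta>) \<omega>) \<partial>M)"
    unfolding grid_exit_def distr_increments[symmetric] 
  proof (rule integral_distr)
    have [measurable]: "X (real (Suc i) * \<delta>) \<in> borel_measurable M" for i using \<delta> by (intro measurable_at) simp
    show "(\<lambda>\<omega> i. X (real (Suc i) * \<delta>) \<omega> - X (real i * \<delta>) \<omega>) \<in> M \<rightarrow>\<^sub>M Pi\<^sub>M UNIV (\<lambda>_. borel)"
      by (rule measurable_PiM_single', measurable)
    show "(\<lambda>\<omega>. exit_val ?r b x (\<lambda>k. \<Sum>i<k. \<omega> i)) \<in> borel_measurable (PiM UNIV (\<lambda>_::nat. borel))"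
      by measurable
  qed
  also have "\<dots> = (\<integral>\<omega>. exit_val ?r b x (\<lambda>k. X (real k * \<delta>) \<omega>) \<partial>M)"
  proof (rule integral_cong_AE)
    have tel: "(\<Sum>i<k. X (real (Suc i) * \<delta>) \<omega> - X (real i * \<delta>) \<omega>) = X (real k * \<delta>) \<omega> - X 0 \<omega>" for k \<omega>
      by (induction k) auto
    show "AE \<omega> in M. exit_val ?r b x (\<lambda>k. \<Sum>i<k. X (real (Suc i) * \<delta>) \<omega> - X (real i * \<delta>) \<omega>)
       = exit_val ?r b x (\<lambda>k. X (real k * \<delta>) \<omega>)"
      unfolding tel using start by eventually_elim simp
    show "(\<lambda>\<omega>. exit_val ?r b x (\<lambda>k. \<Sum>i<k. X (real (Suc i) * \<delta>) \<omega> - X (real i * \<delta>) \<omega>)) \<in> borel_measurable M"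
      unfolding tel using measurable_at[of 0] by measurable
  qed measurable
  finally show ?thesis .
qed

end

lemma AE_exit_val_tendsto:
  assumes x: "x \<in> lattice_points h" and b: "0 \<le> b"
  shows "AE \<omega> in M. (\<lambda>m. exit_val (exp (- q / 2 ^ m)) b x (\<lambda>k. X (real k / 2 ^ m) \<omega>))
    \<longlonglongrightarrow> exit_lim q b x (\<lambda>t. X t \<omega>)"
  using AE_lattice_path AE_space
proof eventually_elim
  case (elim \<omega>)
  have rc: "((\<lambda>t. X t \<omega>) \<longlongrightarrow> X t \<omega>) (at_right t)" if "0 \<le> t" for t
    using cadlag_paths[OF elim(2)] that by (simp add: cadlag_def)
  \<comment> \<open>Right continuity gives \<open>X s > X t - h\<close> just after \<open>t\<close>;
    between lattice values this means \<open>X s \<ge> X t\<close>.\<close>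
  have stay: "eventually (\<lambda>s. X t \<omega> \<le> X s \<omega>) (at_right t)" if t: "0 \<le> t" for t
  proof -
    have "eventually (\<lambda>s. X t \<omega> - h < X s \<omega>) (at_right t)"
      using rc[OF t] by (rule order_tendstoD) (use h_pos in simp)
    moreover have "eventually (\<lambda>s. t < s) (at_right t)" by (rule eventually_at_right_less)
    ultimately show ?thesis
    proof eventually_elim
      case (elim s)
      have "X t \<omega> \<in> lattice_points h" "X s \<omega> \<in> lattice_points h"
        using \<open>\<forall>t\<ge>0. X t \<omega> \<in> lattice_points h\<close> t elim by auto
      then obtain k l where kl: "X t \<omega> = h * of_int k" "X s \<omega> = h * of_int l" by (auto simp: lattice_points_def)
      hence "h * of_int (k - 1) < h * of_int l" using elim by (simp add: algebra_simps)
      hence "k \<le> l" using h_pos by (simp only: mult_less_cancel_left_pos of_int_less_iff)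
      thus ?case using kl h_pos by simp
    qed
  qed
  show ?case
  proof (rule exit_val_tendsto[OF rc b])
    fix t :: real assume t: "0 \<le> t" "b \<le> ereal (x + X t \<omega>)"
    from stay[OF t(1)] show "eventually (\<lambda>s. b \<le> ereal (x + X s \<omega>)) (at_right t)"
      by eventually_elim (use t in \<open>auto elim!: order_trans\<close>)
  qed
qed

text \<open>At an infinite barrier the hypothesis \<open>stay\<close> is vacuous, so convergence
  holds on every path and the limit is measurable without completion.\<close>

lemma exit_val_tendsto_inf:
  assumes \<omega>: "\<omega> \<in> space M"
  shows "(\<lambda>m. exit_val (exp (- q / 2 ^ m)) \<infinity> x (\<lambda>k. X (real k / 2 ^ m) \<omega>))
    \<longlonglongrightarrow> exit_lim q \<infinity> x (\<lambda>t. X t \<omega>)"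
  by (rule exit_val_tendsto) (use cadlag_paths[OF \<omega>] in \<open>auto simp: cadlag_def\<close>)

lemma grid_exit_tendsto:
  assumes q: "0 \<le> q" and g[measurable]: "g \<in> borel_measurable M"
    and lim: "AE \<omega> in M. (\<lambda>m. exit_val (exp (- q / 2 ^ m)) b x (\<lambda>k. X (real k / 2 ^ m) \<omega>)) \<longlonglongrightarrow> g \<omega>"
  shows "(\<lambda>m. grid_exit q b (1 / 2 ^ m) x) \<longlonglongrightarrow> (\<integral>\<omega>. g \<omega> \<partial>M)"
proof -
  have [measurable]: "X (real i / 2 ^ m) \<in> borel_measurable M" for i m by (intro measurable_at) simp
  have "exp (- q / 2 ^ m) \<le> 1" for m using q by simp
  hence "norm (exit_val (exp (- q / 2 ^ m)) b x s) \<le> 1" for m s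
    using exit_val_bounds[of "exp (- q / 2 ^ m)" b x s] by auto
  hence "(\<lambda>m. \<integral>\<omega>. exit_val (exp (- q / 2 ^ m)) b x (\<lambda>k. X (real k / 2 ^ m) \<omega>) \<partial>M) \<longlonglongrightarrow> (\<integral>\<omega>. g \<omega> \<partial>M)"
    by (intro integral_dominated_convergence[where w="\<lambda>_. 1"] lim) auto
  thus ?thesis by (simp add: grid_exit_eq[OF q])
qed

lemma exit_fun_eq:
  assumes "0 \<le> q" "g \<in> borel_measurable M"
    "AE \<omega> in M. (\<lambda>m. exit_val (exp (- q / 2 ^ m)) b x (\<lambda>k. X (real k / 2 ^ m) \<omega>)) \<longlonglongrightarrow> g \<omega>"
  shows "exit_fun q b x = (\<integral>\<omega>. g \<omega> \<partial>M)"
  unfolding exit_fun_def by (rule limI, rule grid_exit_tendsto) fact+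

lemma grid_exit_tendsto_exit_fun:
  assumes q: "0 \<le> q" and b: "0 \<le> b" and x: "x \<in> lattice_points h"
  shows "(\<lambda>m. grid_exit q b (1 / 2 ^ m) x) \<longlonglongrightarrow> exit_fun q b x"
proof -
  define g where "g \<omega> = lim (\<lambda>m. exit_val (exp (- q / 2 ^ m)) b x (\<lambda>k. X (real k / 2 ^ m) \<omega>))" for \<omega>
  have [measurable]: "X (real i / 2 ^ m) \<in> borel_measurable M" for i m by (intro measurable_at) simp
  have m: "g \<in> borel_measurable M" unfolding g_def by measurable
  have "AE \<omega> in M. (\<lambda>m. exit_val (exp (- q / 2 ^ m)) b x (\<lambda>k. X (real k / 2 ^ m) \<omega>)) \<longlonglongrightarrow> g \<omega>"
    using AE_exit_val_tendsto[OF x b, of q]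
    by eventually_elim (use convergent_LIMSEQ_iff convergentI in \<open>auto simp: g_def\<close>)
  from grid_exit_tendsto[OF q m this] exit_fun_eq[OF q m this] show ?thesis by simp
qed

lemma exit_fun_neg: "0 \<le> q \<Longrightarrow> x < 0 \<Longrightarrow> exit_fun q b x = 1"
  unfolding exit_fun_def by (simp add: grid_exit_neg)

lemma exit_fun_above: "0 \<le> q \<Longrightarrow> 0 \<le> x \<Longrightarrow> b \<le> ereal x \<Longrightarrow> exit_fun q b x = 0"
  unfolding exit_fun_def by (simp add: grid_exit_above)

lemma exit_fun_measurable [measurable]: "0 \<le> q \<Longrightarrow> exit_fun q b \<in> borel_measurable borel"
  unfolding exit_fun_def using grid_exit_measurable[of q _ b] by measurable

lemma exit_fun_bounds:
  assumes "0 \<le> q" "0 \<le> b" "x \<in> lattice_points h"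
  shows "0 \<le> exit_fun q b x" "exit_fun q b x \<le> 1"
  using grid_exit_bounds[OF assms(1)]
  by (auto intro!: LIMSEQ_le_const[OF grid_exit_tendsto_exit_fun[OF assms]] LIMSEQ_le_const2[OF grid_exit_tendsto_exit_fun[OF assms]])

text \<open>Insert \<open>small_time\<close> into the one-step equation, multiply by
  \<open>exp (L.lam * d m)\<close> and divide by \<open>d m\<close>: the error is of order
  \<open>d m\<close>. Each grid function satisfies its own such equation, so pointwise convergence
  on the lattice suffices and no rate is required.\<close>

lemma exit_fun_harmonic:
  assumes q: "0 \<le> q" and b: "0 \<le> b" and x: "x \<in> lattice_points h" "0 \<le> x" "ereal x < b"
  shows "(L.lam + q) * exit_fun q b x = (\<integral>y. exit_fun q b (x + y) \<partial>\<Lambda>)"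
proof -
  define d where "d m = (1 / 2 ^ m :: real)" for m :: nat
  have d: "0 < d m" for m by (simp add: d_def)
  define F where "F m = grid_exit q b (d m)" for m
  define I where "I m = (\<integral>y. F m (x + y) \<partial>\<Lambda>)" for m
  have Fm[measurable]: "F m \<in> borel_measurable borel" for m unfolding F_def by (rule grid_exit_measurable[OF q d])
  have F1: "\<bar>F m y\<bar> \<le> 1" for m y unfolding F_def using grid_exit_bounds[OF q d, where b=b and x=y] by simp
  have Fl: "(\<lambda>m. F m y) \<longlonglongrightarrow> exit_fun q b y" if "y \<in> lattice_points h" for y
    unfolding F_def d_def by (rule grid_exit_tendsto_exit_fun[OF q b that])
  have dlim: "d \<longlonglongrightarrow> 0"
    unfolding d_def using LIMSEQ_realpow_zero[of "1/2"] by (simp add: power_divide)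
  have dlim': "filterlim d (at 0) sequentially"
    unfolding filterlim_at using dlim by (simp add: less_imp_neq[OF d, symmetric])
  have "I \<longlonglongrightarrow> (\<integral>y. exit_fun q b (x + y) \<partial>\<Lambda>)"
    unfolding I_def
  proof (rule integral_dominated_convergence[where w="\<lambda>_. 1"])
    show "AE y in \<Lambda>. (\<lambda>m. F m (x + y)) \<longlonglongrightarrow> exit_fun q b (x + y)"
      using L.AE_levy_lattice
    proof eventually_elim
      case (elim y)
      thus ?case by (intro Fl L.lattice_add x)
    qed
  qed (use F1 exit_fun_measurable[OF q, of b] in auto)
  moreover have "(\<lambda>m. F m x * ((exp ((L.lam + q) * d m) - 1) / d m) - I m) \<longlonglongrightarrow> 0"
  proof (rule Lim_null_comparison)
    have "\<bar>F m x * ((exp ((L.lam + q) * d m) - 1) / d m) - I m\<bar> \<le> exp (L.lam * d m) * (L.lam\<^sup>2 * d m)" for m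
    proof -
      define E where "E = (\<integral>\<omega>. F m (x + X (d m) \<omega>) \<partial>M)"
      have FE: "F m x = exp (- q * d m) * E"
        unfolding E_def F_def by (rule grid_exit_step[OF q d x(2,3)])
      have "\<bar>E - exp (- (L.lam * d m)) * (F m (x + 0) + d m * (\<integral>y. F m (x + y) \<partial>\<Lambda>))\<bar> \<le> (L.lam * d m)\<^sup>2"
        unfolding E_def by (rule small_time[OF d]) (use F1 in auto)
      hence "exp (L.lam * d m) * \<bar>E - exp (- (L.lam * d m)) * (F m x + d m * I m)\<bar> \<le> exp (L.lam * d m) * (L.lam * d m)\<^sup>2"
        unfolding I_def by (intro mult_left_mono) auto
      moreover have "exp (L.lam * d m) * \<bar>E - exp (- (L.lam * d m)) * (F m x + d m * I m)\<bar>
          = \<bar>exp (L.lam * d m) * (E - exp (- (L.lam * d m)) * (F m x + d m * I m))\<bar>"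
        by (simp add: abs_mult)
      moreover have "exp (L.lam * d m) * (E - exp (- (L.lam * d m)) * (F m x + d m * I m))
          = exp ((L.lam + q) * d m) * F m x - (F m x + d m * I m)"
      proof -
        have "exp (L.lam * d m) * E = exp ((L.lam + q) * d m) * F m x"
          unfolding FE by (simp add: mult.assoc[symmetric] mult_exp_exp algebra_simps)
        thus ?thesis by (simp add: right_diff_distrib mult.assoc[symmetric] mult_exp_exp)
      qed
      ultimately have "\<bar>exp ((L.lam + q) * d m) * F m x - (F m x + d m * I m)\<bar> \<le> exp (L.lam * d m) * (L.lam * d m)\<^sup>2"
        by simp
      hence "\<bar>exp ((L.lam + q) * d m) * F m x - (F m x + d m * I m)\<bar> / d m \<le> exp (L.lam * d m) * (L.lam * d m)\<^sup>2 / d m"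
        using d[of m] by (intro divide_right_mono) auto
      also have "\<dots> = exp (L.lam * d m) * (L.lam\<^sup>2 * d m)"
        using d[of m] by (simp add: power2_eq_square)
      also have "\<bar>exp ((L.lam + q) * d m) * F m x - (F m x + d m * I m)\<bar> / d m = \<bar>(exp ((L.lam + q) * d m) * F m x - (F m x + d m * I m)) / d m\<bar>"
        using d[of m] by (simp add: abs_divide)
      also have "(exp ((L.lam + q) * d m) * F m x - (F m x + d m * I m)) / d m
          = F m x * ((exp ((L.lam + q) * d m) - 1) / d m) - I m"
        using d[of m] by (simp add: field_simps)
      finally show ?thesis .
    qed
    thus "eventually (\<lambda>m. norm (F m x * ((exp ((L.lam + q) * d m) - 1) / d m) - I m) \<le> exp (L.lam * d m) * (L.lam\<^sup>2 * d m)) sequentially"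
      by simp
    have "(\<lambda>m. exp (L.lam * d m) * (L.lam\<^sup>2 * d m)) \<longlonglongrightarrow> exp (L.lam * 0) * (L.lam\<^sup>2 * 0)"
      by (intro tendsto_intros dlim)
    thus "(\<lambda>m. exp (L.lam * d m) * (L.lam\<^sup>2 * d m)) \<longlonglongrightarrow> 0" by simp
  qed
  ultimately have "(\<lambda>m. F m x * ((exp ((L.lam + q) * d m) - 1) / d m)) \<longlonglongrightarrow> (\<integral>y. exit_fun q b (x + y) \<partial>\<Lambda>)"
    using tendsto_add by fastforce
  moreover have "(\<lambda>m. F m x * ((exp ((L.lam + q) * d m) - 1) / d m)) \<longlonglongrightarrow> exit_fun q b x * (L.lam + q)"
  proof (intro tendsto_mult Fl x)
    have "((\<lambda>t. exp ((L.lam + q) * t)) has_real_derivative (L.lam + q)) (at 0)"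
      by (auto intro!: derivative_eq_intros)
    hence "((\<lambda>t. (exp ((L.lam + q) * t) - 1) / t) \<longlongrightarrow> L.lam + q) (at 0)"
      by (simp add: DERIV_def)
    thus "(\<lambda>m. (exp ((L.lam + q) * d m) - 1) / d m) \<longlonglongrightarrow> L.lam + q"
      by (rule filterlim_compose) (rule dlim')
  qed
  ultimately show ?thesis using LIMSEQ_unique by (simp add: mult.commute)
qed

end

section \<open>Convolution recurrences and their generating functions\<close>

fun scale_seq :: "real \<Rightarrow> real \<Rightarrow> (nat \<Rightarrow> real) \<Rightarrow> real \<Rightarrow> nat \<Rightarrow> real" where
  "scale_seq l p a c 0 = c"
| "scale_seq l p a c (Suc n) = (l * scale_seq l p a c n - (\<Sum>k\<le>n. a k * scale_seq l p a c (n - k))) / p"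

lemma scale_seq_rec:
  "p \<noteq> 0 \<Longrightarrow> l * scale_seq l p a c n = p * scale_seq l p a c (Suc n) + (\<Sum>k\<le>n. a k * scale_seq l p a c (n - k))"
  by simp

text \<open>The equation is asked for only below \<open>N\<close>, because exit probabilities with a
  barrier satisfy it only below that barrier.\<close>

lemma recurrence_unique:
  fixes f g :: "nat \<Rightarrow> real"
  assumes p: "p \<noteq> 0" and 0: "f 0 = g 0"
    and f: "\<And>n. n < N \<Longrightarrow> l * f n = p * f (Suc n) + (\<Sum>k\<le>n. a k * f (n - k)) + B n"
    and g: "\<And>n. n < N \<Longrightarrow> l * g n = p * g (Suc n) + (\<Sum>k\<le>n. a k * g (n - k)) + B n"
    and n: "n \<le> N"
  shows "f n = g n"
  using n
proof (induction n rule: less_induct)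
  case (less n)
  show ?case
  proof (cases n)
    case (Suc m)
    have IH: "f k = g k" if "k \<le> m" for k using less Suc that by auto
    have "(\<Sum>k\<le>m. a k * f (m - k)) = (\<Sum>k\<le>m. a k * g (m - k))"
      by (rule sum.cong) (auto simp: IH)
    moreover have "m < N" "l * f m = l * g m" using less Suc IH[of m] by auto
    ultimately have "p * f (Suc m) = p * g (Suc m)" using f[of m] g[of m] by linarith
    thus ?thesis using p Suc by auto
  qed (use 0 in simp)
qed

text \<open>Summation commutes with convolution; the shifted sum lacks the first term, whence
  \<open>- p * w 0\<close>.\<close>

lemma sum_recurrence:
  fixes w :: "nat \<Rightarrow> real"
  assumes rec: "\<And>n. l * w n = p * w (Suc n) + (\<Sum>k\<le>n. a k * w (n - k))"
  shows "l * (\<Sum>j<n. w j) = p * (\<Sum>j<Suc n. w j) - p * w 0 + (\<Sum>k\<le>n. a k * (\<Sum>j<n-k. w j))"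
proof (induction n)
  case (Suc n)
  have "(\<Sum>k\<le>n. a k * (\<Sum>j<Suc n - k. w j)) = (\<Sum>k\<le>n. a k * (\<Sum>j<n-k. w j) + a k * w (n - k))"
    by (rule sum.cong) (auto simp: Suc_diff_le algebra_simps)
  hence "(\<Sum>k\<le>Suc n. a k * (\<Sum>j<Suc n - k. w j)) = (\<Sum>k\<le>n. a k * (\<Sum>j<n-k. w j)) + (\<Sum>k\<le>n. a k * w (n - k))"
    by (simp add: sum.distrib)
  thus ?case using Suc rec[of n] by (simp add: algebra_simps)
qed simp

locale down_jumps =
  fixes p l :: real and a :: "nat \<Rightarrow> real"
  assumes p: "0 < p" and a_nonneg: "\<And>k. 0 \<le> a k" and a0: "a 0 = 0" and a_sums: "a sums (l - p)"
begin

text \<open>At \<open>y = exp (- \<beta> * h)\<close> the quantity \<open>p / y + gen y - l\<close>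
  is the Laplace exponent at \<open>\<beta>\<close>; see
  \<open>laplace_exponent_gen\<close>.\<close>

definition gen :: "real \<Rightarrow> real" where "gen y = (\<Sum>k. a k * y ^ k)"

lemma summable_gen: "0 \<le> y \<Longrightarrow> y \<le> 1 \<Longrightarrow> summable (\<lambda>k. a k * y ^ k)"
  by (rule summable_comparison_test'[OF sums_summable[OF a_sums], of 0])
    (auto simp: abs_mult a_nonneg power_le_one intro: mult_left_le)

lemma gen_sums: "0 \<le> y \<Longrightarrow> y \<le> 1 \<Longrightarrow> (\<lambda>k. a k * y ^ k) sums gen y"
  unfolding gen_def by (intro summable_sums summable_gen)

lemma gen_convolution:
  assumes y: "0 \<le> y" "y \<le> 1" and f: "summable (\<lambda>n. \<bar>f n * y ^ n\<bar>)"
  shows "(\<lambda>n. (\<Sum>k\<le>n. a k * f (n - k)) * y ^ n) sums (gen y * (\<Sum>n. f n * y ^ n))"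
proof -
  have "(\<lambda>n. \<Sum>k\<le>n. (a k * y ^ k) * (f (n - k) * y ^ (n - k))) sums ((\<Sum>k. a k * y ^ k) * (\<Sum>n. f n * y ^ n))"
    by (rule Cauchy_product_sums) (use f summable_gen[OF y] a_nonneg y in \<open>auto simp: abs_mult\<close>)
  moreover have "(\<Sum>k\<le>n. (a k * y ^ k) * (f (n - k) * y ^ (n - k))) = (\<Sum>k\<le>n. a k * f (n - k)) * y ^ n" for n
    unfolding sum_distrib_right
    by (rule sum.cong) (auto simp: power_add[symmetric] mult_ac)
  ultimately show ?thesis by (simp add: gen_def)
qed

text \<open>Convexity of the Laplace exponent: below a point where it is smaller, the chain tilted by \<open>y\<close> has
  positive drift.\<close>

lemma positive_drift:
  assumes y: "0 < y" "y < y0" "y0 \<le> 1" and less: "p / y0 + gen y0 < p / y + gen y"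
  shows "summable (\<lambda>k. real k * (a k * y ^ k))" "(\<Sum>k. real k * (a k * y ^ k)) < p / y"
proof -
  \<comment> \<open>The relative increment, \<open>y0 = y * (1 + r)\<close>. Bernoulli's inequality
    for \<open>(1 + r) ^ k\<close> bounds each power from below by its tangent at
    \<open>y\<close>.\<close>
  define r where "r = (y0 - y) / y"
  have r: "0 < r" using y by (simp add: r_def)
  have le: "r * (real k * (a k * y ^ k)) \<le> a k * y0 ^ k - a k * y ^ k" for k
  proof -
    have y0: "y0 = y * (1 + r)" using y by (simp add: r_def field_simps)
    have "(1 + real k * r) * y ^ k \<le> (1 + r) ^ k * y ^ k"
      by (intro mult_right_mono Bernoulli_inequality) (use r y in auto)
    hence "a k * ((1 + real k * r) * y ^ k) \<le> a k * y0 ^ k"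
      unfolding y0 power_mult_distrib by (intro mult_left_mono a_nonneg) (simp add: mult.commute)
    thus ?thesis by (simp add: algebra_simps)
  qed
  have s: "(\<lambda>k. a k * y0 ^ k - a k * y ^ k) sums (gen y0 - gen y)"
    by (intro sums_diff gen_sums) (use y in auto)
  have sr: "summable (\<lambda>k. r * (real k * (a k * y ^ k)))"
    by (rule summable_comparison_test'[OF sums_summable[OF s], of 0])
      (use le r y a_nonneg in \<open>auto simp: abs_mult\<close>)
  thus sm: "summable (\<lambda>k. real k * (a k * y ^ k))" using r by (simp add: summable_cmult_iff)
  have "r * (\<Sum>k. real k * (a k * y ^ k)) = (\<Sum>k. r * (real k * (a k * y ^ k)))"
    by (rule suminf_mult[symmetric, OF sm])
  also have "\<dots> \<le> gen y0 - gen y"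
    using suminf_le[OF le sr sums_summable[OF s]] s by (simp add: sums_iff)
  also have "\<dots> < p / y - p / y0" using less by simp
  also have "\<dots> = r * (p / y0)" using y by (simp add: r_def field_simps)
  also have "\<dots> \<le> r * (p / y)" using r y p by (intro mult_left_mono divide_left_mono) auto
  finally show "(\<Sum>k. real k * (a k * y ^ k)) < p / y"
    by (rule mult_less_cancel_left_pos[OF r, THEN iffD1])
qed

text \<open>Multiplying the recurrence by \<open>y ^ n\<close> and summing gives the value, but only
  once summability is known. The recurrence yields no direct growth bound; positive drift first
  bounds \<open>c n = w n * y ^ n\<close> and then its partial sums.\<close>

lemma scale_gen:
  assumes y: "0 < y" "y < y0" "y0 \<le> 1" and less: "p / y0 + gen y0 < p / y + gen y" and L: "L < p / y + gen y"
    and w0: "\<And>n. 0 \<le> w n"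
    and rec: "\<And>n. L * w n = p * w (Suc n) + (\<Sum>k\<le>n. a k * w (n - k))"
  shows "(\<lambda>n. w n * y ^ n) sums (p * w 0 / (y * (p / y + gen y - L)))"
proof -
  define c where "c n = w n * y ^ n" for n
  define D where "D = (\<Sum>k. real k * (a k * y ^ k))"
  define \<psi> where "\<psi> = p / y + gen y - L"
  \<comment> \<open>The sum of \<open>c\<close> over the at most \<open>k\<close> indices just
    before \<open>K\<close>: the part that a downward jump of \<open>k\<close> steps carries across
    the level \<open>K\<close>.\<close>
  define T where "T k K = (\<Sum>n | n < K \<and> K \<le> n + k. c n)" for k K :: nat
  note drift = positive_drift[OF y less, folded D_def]
  have \<psi>: "0 < \<psi>" using L by (simp add: \<psi>_def)
  have y1: "0 \<le> y" "y \<le> 1" using y by auto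
  have c0: "0 \<le> c n" for n using w0 y by (simp add: c_def)
  have crec: "L * c n = p / y * c (Suc n) + (\<Sum>k\<le>n. a k * y ^ k * c (n - k))" for n
  proof -
    have "(\<Sum>k\<le>n. a k * y ^ k * c (n - k)) = (\<Sum>k\<le>n. a k * w (n - k)) * y ^ n"
      unfolding sum_distrib_right c_def
      by (rule sum.cong) (auto simp: power_add[symmetric] mult_ac)
    moreover have "L * c n = (p * w (Suc n) + (\<Sum>k\<le>n. a k * w (n - k))) * y ^ n"
      unfolding rec[symmetric] c_def by simp
    ultimately show ?thesis using y by (simp add: c_def field_simps)
  qed
  have T_step: "T k (Suc K) = T k K + c K - (if k \<le> K then c (K - k) else 0)" if k: "k \<noteq> 0" for k K
  proof -
    have fin: "finite {n. n < K \<and> K \<le> n + k}" by simp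
    have "T k (Suc K) + (if k \<le> K then c (K - k) else 0) = T k K + c K"
    proof (cases "k \<le> K")
      case True
      have "{n. n < Suc K \<and> Suc K \<le> n + k} \<union> {K - k} = insert K {n. n < K \<and> K \<le> n + k}" using k True by auto
      moreover have "T k (Suc K) + c (K - k) = sum c ({n. n < Suc K \<and> Suc K \<le> n + k} \<union> {K - k})"
        unfolding T_def by (subst sum.union_disjoint) (use k True in auto)
      ultimately show ?thesis using True by (simp add: T_def)
    next
      case False
      have "{n. n < Suc K \<and> Suc K \<le> n + k} = insert K {n. n < K \<and> K \<le> n + k}" using k False by auto
      thus ?thesis using False by (simp add: T_def)
    qed
    thus ?thesis by simp
  qed
  have T0: "0 \<le> T k K" for k K unfolding T_def by (rule sum_nonneg) (rule c0)
  have Tb: "T k K \<le> (\<Sum>n<K. c n)" for k K unfolding T_def by (rule sum_mono2) (auto intro: c0)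
  have aT: "summable (\<lambda>k. a k * y ^ k * T k K)" for K
    by (rule summable_comparison_test'[OF summable_mult2[OF summable_gen[OF y1], of "\<Sum>n<K. c n"], of 0])
      (use a_nonneg y T0 Tb in \<open>auto simp: abs_mult intro!: mult_left_mono\<close>)
  \<comment> \<open>the recurrence for \<open>c\<close> summed over \<open>n < K\<close>: with the coefficients \<open>a k * y ^ k\<close> it telescopes\<close>
  have ident: "p / y * (c K - c 0) = (\<Sum>k. a k * y ^ k * T k K) - \<psi> * (\<Sum>n<K. c n)" for K
  proof (induction K)
    case 0 thus ?case by (simp add: T_def)
  next
    case (Suc K)
    have "(\<lambda>k. a k * y ^ k * (if k \<le> K then c (K - k) else 0)) sums (\<Sum>k\<le>K. a k * y ^ k * c (K - k))"
      using sums_If_finite_set[of "{..K}" "\<lambda>k. a k * y ^ k * c (K - k)"] by (simp add: if_distrib cong: if_cong)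
    hence "(\<lambda>k. a k * y ^ k * T k K + a k * y ^ k * c K - a k * y ^ k * (if k \<le> K then c (K - k) else 0))
        sums ((\<Sum>k. a k * y ^ k * T k K) + gen y * c K - (\<Sum>k\<le>K. a k * y ^ k * c (K - k)))"
      by (intro sums_diff sums_add summable_sums[OF aT] sums_mult2 gen_sums y1)
    moreover have "a k * y ^ k * T k K + a k * y ^ k * c K - a k * y ^ k * (if k \<le> K then c (K - k) else 0)
       = a k * y ^ k * T k (Suc K)" for k
      by (cases "k = 0") (auto simp: a0 T_step algebra_simps)
    ultimately have "(\<Sum>k. a k * y ^ k * T k (Suc K)) = (\<Sum>k. a k * y ^ k * T k K) + gen y * c K - (\<Sum>k\<le>K. a k * y ^ k * c (K - k))"
      by (simp add: sums_iff)
    also have "(\<Sum>k\<le>K. a k * y ^ k * c (K - k)) = L * c K - p / y * c (Suc K)" using crec[of K] by simp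
    finally show ?case using Suc by (simp add: \<psi>_def algebra_simps)
  qed
  have aT_le: "(\<Sum>k. a k * y ^ k * T k K) \<le> D * B"
    if B0: "0 \<le> B" and cB: "\<And>n. n < K \<Longrightarrow> c n \<le> B" for B K
  proof -
    have "T k K \<le> real k * B" for k
    proof -
      have "T k K \<le> (\<Sum>n | n < K \<and> K \<le> n + k. B)" unfolding T_def by (rule sum_mono) (use cB in auto)
      also have "\<dots> = real (card {n. n < K \<and> K \<le> n + k}) * B" by simp
      also have "\<dots> \<le> real k * B"
      proof (rule mult_right_mono[OF _ B0])
        have "card {n. n < K \<and> K \<le> n + k} \<le> card {K - k..<K}" by (rule card_mono) auto
        thus "real (card {n. n < K \<and> K \<le> n + k}) \<le> real k" by simp
      qed
      finally show ?thesis .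
    qed
    hence "a k * y ^ k * T k K \<le> real k * (a k * y ^ k) * B" for k
      using mult_left_mono[of "T k K" "real k * B" "a k * y ^ k"] a_nonneg y by (simp add: mult_ac)
    hence "(\<Sum>k. a k * y ^ k * T k K) \<le> (\<Sum>k. real k * (a k * y ^ k) * B)"
      by (intro suminf_le aT summable_mult2 drift)
    also have "\<dots> = D * B" unfolding D_def by (rule suminf_mult2[symmetric, OF drift(1)])
    finally show ?thesis .
  qed
  \<comment> \<open>The fixed point of the bound
    \<open>p / y * c K \<le> p / y * c 0 + D * B\<close>. It exists because the drift
    \<open>p / y - D\<close> is positive.\<close>
  define B where "B = (p / y) * c 0 / (p / y - D)"
  have cB: "c K \<le> B" for K
  proof (induction K rule: less_induct)
    case (less K)
    have B0: "0 \<le> B" unfolding B_def using c0[of 0] drift p y by (intro divide_nonneg_nonneg mult_nonneg_nonneg) auto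
    have "(\<Sum>k. a k * y ^ k * T k K) \<le> D * B" by (rule aT_le[OF B0]) (use less in auto)
    moreover have "0 \<le> \<psi> * (\<Sum>n<K. c n)" using c0 \<psi> by (intro mult_nonneg_nonneg sum_nonneg) auto
    ultimately have "p / y * (c K - c 0) \<le> D * B" using ident[of K] by linarith
    moreover have "p / y * c 0 = (p / y - D) * B" using drift by (simp add: B_def)
    ultimately have "p / y * c K \<le> p / y * B" by (simp add: algebra_simps)
    thus ?case by (rule mult_left_le_imp_le) (use p y in simp)
  qed
  \<comment> \<open>The bound on \<open>c\<close> discarded the term with \<open>\<psi>\<close> in
    \<open>ident\<close>. Keeping it now controls all partial sums.\<close>
  have "summable c"
  proof (rule summableI_nonneg_bounded)
    fix K
    have "0 \<le> B" using c0[of 0] cB[of 0] by linarith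
    hence "(\<Sum>k. a k * y ^ k * T k K) \<le> D * B" using cB by (rule aT_le)
    hence "\<psi> * (\<Sum>n<K. c n) \<le> D * B + p / y * c 0 - p / y * c K"
      using ident[of K] by (simp add: algebra_simps)
    also have "\<dots> \<le> D * B + p / y * c 0" using c0 p y by simp
    finally show "(\<Sum>n<K. c n) \<le> (D * B + p / y * c 0) / \<psi>" using \<psi> by (simp add: field_simps)
  qed (rule c0)
  hence sc: "summable (\<lambda>n. w n * y ^ n)" by (simp add: c_def[abs_def])
  define S where "S = (\<Sum>n. w n * y ^ n)"
  have S: "(\<lambda>n. w n * y ^ n) sums S" unfolding S_def by (rule summable_sums[OF sc])
  have "(\<lambda>n. w (Suc n) * y ^ Suc n) sums (S - w 0)" using S by (subst sums_Suc_iff) simp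
  hence "(\<lambda>n. p / y * (w (Suc n) * y ^ Suc n) + (\<Sum>k\<le>n. a k * w (n - k)) * y ^ n) sums (p / y * (S - w 0) + gen y * S)"
    unfolding S_def using sc w0 y
    by (intro sums_add sums_mult gen_convolution y1) (auto simp: abs_mult)
  moreover have "p / y * (w (Suc n) * y ^ Suc n) + (\<Sum>k\<le>n. a k * w (n - k)) * y ^ n = L * (w n * y ^ n)" for n
  proof -
    have "p / y * (w (Suc n) * y ^ Suc n) + (\<Sum>k\<le>n. a k * w (n - k)) * y ^ n = (p * w (Suc n) + (\<Sum>k\<le>n. a k * w (n - k))) * y ^ n"
      using y by (simp add: ring_distribs)
    thus ?thesis unfolding rec[symmetric] by simp
  qed
  ultimately have "L * S = p / y * (S - w 0) + gen y * S"
    using sums_mult[OF S, of L] by (simp add: sums_unique2)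
  hence "S * \<psi> = p / y * w 0" by (simp add: \<psi>_def algebra_simps)
  hence "S = p * w 0 / (y * \<psi>)" using \<psi> y by (simp add: field_simps)
  thus ?thesis using S by (simp add: \<psi>_def)
qed

text \<open>The sum of \<open>a k\<close> over \<open>k > n\<close>: the inhomogeneity produced by boundary value \<open>1\<close> at negative
  indices.\<close>

definition tail :: "nat \<Rightarrow> real" where "tail n = l - p - (\<Sum>k\<le>n. a k)"

lemma bounded_solution_0:
  fixes f :: "nat \<Rightarrow> real"
  assumes y: "0 < y" "y < 1" and root: "p / y + gen y = l + q" and f1: "\<And>n. \<bar>f n\<bar> \<le> 1"
    and rec: "\<And>n. (l + q) * f n = p * f (Suc n) + (\<Sum>k\<le>n. a k * f (n - k)) + tail n"
  shows "f 0 = 1 - q * y / (p * (1 - y))"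
proof -
  have y1: "0 \<le> y" "y \<le> 1" using y by auto
  have geo: "summable (\<lambda>n. y ^ n)" using y by (intro summable_geometric) simp
  have sf: "summable (\<lambda>n. \<bar>f n * y ^ n\<bar>)"
    by (rule summable_comparison_test'[OF geo, of 0]) (use f1 y in \<open>auto simp: abs_mult intro: mult_left_le_one_le\<close>)
  define S where "S = (\<Sum>n. f n * y ^ n)"
  have S: "(\<lambda>n. f n * y ^ n) sums S" unfolding S_def by (rule summable_sums[OF summable_rabs_cancel[OF sf]])
  have S': "(\<lambda>n. f (Suc n) * y ^ Suc n) sums (S - f 0)" using S by (subst sums_Suc_iff) simp
  have g: "(\<lambda>n. y ^ n) sums (1 / (1 - y))" by (rule geometric_sums) (use y in simp)
  have "(\<lambda>n. (\<Sum>k\<le>n. a k * 1) * y ^ n) sums (gen y * (\<Sum>n. 1 * y ^ n))"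
    by (rule gen_convolution[OF y1]) (use geo y in simp)
  hence "(\<lambda>n. (\<Sum>k\<le>n. a k) * y ^ n) sums (gen y * (1 / (1 - y)))" using g by (simp add: sums_iff)
  hence t: "(\<lambda>n. (l - p) * y ^ n - (\<Sum>k\<le>n. a k) * y ^ n) sums ((l - p) * (1 / (1 - y)) - gen y * (1 / (1 - y)))"
    by (intro sums_diff sums_mult g)
  have "(\<lambda>n. p / y * (f (Suc n) * y ^ Suc n) + (\<Sum>k\<le>n. a k * f (n - k)) * y ^ n + ((l - p) * y ^ n - (\<Sum>k\<le>n. a k) * y ^ n))
     sums (p / y * (S - f 0) + gen y * S + ((l - p) * (1 / (1 - y)) - gen y * (1 / (1 - y))))"
    unfolding S_def by (intro sums_add sums_mult t S'[unfolded S_def] gen_convolution y1 sf)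
  moreover have "p / y * (f (Suc n) * y ^ Suc n) + (\<Sum>k\<le>n. a k * f (n - k)) * y ^ n + ((l - p) * y ^ n - (\<Sum>k\<le>n. a k) * y ^ n)
     = (l + q) * (f n * y ^ n)" for n
  proof -
    have "p / y * (f (Suc n) * y ^ Suc n) = p * f (Suc n) * y ^ n" using y by simp
    hence "p / y * (f (Suc n) * y ^ Suc n) + (\<Sum>k\<le>n. a k * f (n - k)) * y ^ n + ((l - p) * y ^ n - (\<Sum>k\<le>n. a k) * y ^ n)
      = (p * f (Suc n) + (\<Sum>k\<le>n. a k * f (n - k)) + tail n) * y ^ n"
      by (simp only: tail_def) (simp only: ring_distribs left_diff_distrib)
    thus ?thesis unfolding rec[symmetric] by simp
  qed
  ultimately have "(l + q) * S = p / y * (S - f 0) + gen y * S + ((l - p) * (1 / (1 - y)) - gen y * (1 / (1 - y)))"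
    using sums_mult[OF S, of "l + q"] by (simp add: sums_unique2)
  \<comment> \<open>At the root the unknown sum \<open>S\<close> has the same coefficient on both
    sides and cancels, leaving an equation for \<open>f 0\<close> alone.\<close>
  moreover have "gen y = l + q - p / y" using root by simp
  ultimately have "p / y * f 0 = ((l - p) - (l + q - p / y)) / (1 - y)"
    by (simp add: algebra_simps diff_divide_distrib add_divide_distrib)
  hence "p / y * f 0 * (1 - y) = p / y - p - q" using y by simp
  hence "y * (p / y * f 0 * (1 - y)) = y * (p / y - p - q)" by simp
  hence "p * f 0 * (1 - y) = p - p * y - q * y" using y by (simp add: right_diff_distrib mult.commute)
  thus ?thesis using p y by (simp add: field_simps)
qed

text \<open>With boundary value \<open>1\<close> the constant \<open>1\<close> solves the recurrence
  with rate \<open>l\<close>; the surplus \<open>q\<close> is absorbed by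
  \<open>\<kappa> * p * w 0\<close>. Multiples of \<open>w\<close> solve the homogeneous equation,
  so \<open>C\<close> stays free to fit the value at \<open>0\<close>.\<close>

lemma Z_recurrence:
  fixes w :: "nat \<Rightarrow> real"
  assumes rec: "\<And>n. (l + q) * w n = p * w (Suc n) + (\<Sum>k\<le>n. a k * w (n - k))" and w0: "\<kappa> * p * w 0 = q"
  defines "Z \<equiv> \<lambda>n. 1 + \<kappa> * (\<Sum>j<n. w j)"
  shows "(l + q) * (Z n - C * w n) = p * (Z (Suc n) - C * w (Suc n)) + (\<Sum>k\<le>n. a k * (Z (n - k) - C * w (n - k))) + tail n"
proof -
  have "(\<Sum>k\<le>n. a k * (Z (n - k) - C * w (n - k)))
      = (\<Sum>k\<le>n. a k) + \<kappa> * (\<Sum>k\<le>n. a k * (\<Sum>j<n-k. w j)) - C * (\<Sum>k\<le>n. a k * w (n - k))"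
    by (simp add: Z_def sum_distrib_left algebra_simps sum_subtractf sum.distrib)
  moreover have "\<kappa> * ((l + q) * (\<Sum>j<n. w j)) = \<kappa> * (p * (\<Sum>j<Suc n. w j) - p * w 0 + (\<Sum>k\<le>n. a k * (\<Sum>j<n-k. w j)))"
    using sum_recurrence[OF rec, of n] by simp
  moreover have "C * ((l + q) * w n) = C * (p * w (Suc n) + (\<Sum>k\<le>n. a k * w (n - k)))" using rec[of n] by simp
  ultimately show ?thesis using w0 by (simp add: Z_def tail_def algebra_simps)
qed

end

section \<open>Laplace transforms and the Laplace exponent\<close>

lemma floor_step_iff:
  fixes h x :: real
  assumes "0 < h" "0 \<le> x"
  shows "x \<in> {real n * h..<real (Suc n) * h} \<longleftrightarrow> n = nat \<lfloor>x / h\<rfloor>"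
proof -
  have "x \<in> {real n * h..<real (Suc n) * h} \<longleftrightarrow> real n \<le> x / h \<and> x / h < real n + 1"
    using assms by (simp add: field_simps)
  also have "\<dots> \<longleftrightarrow> \<lfloor>x / h\<rfloor> = int n" by (simp add: floor_eq_iff)
  also have "\<dots> \<longleftrightarrow> n = nat \<lfloor>x / h\<rfloor>" using assms by auto
  finally show ?thesis .
qed

lemma integral_exp_step:
  assumes \<beta>: "0 < \<beta>" and ab: "a \<le> b"
  shows "integrable lborel (\<lambda>x. indicator {a..<b} x * exp (- \<beta> * x) :: real)"
    and "(\<integral>x. indicator {a..<b} x * exp (- \<beta> * x) \<partial>lborel) = (exp (- \<beta> * a) - exp (- \<beta> * b)) / \<beta>"
proof -
  have ae: "AE x in lborel. indicator {a..b} x *\<^sub>R exp (- \<beta> * x) = (indicator {a..<b} x * exp (- \<beta> * x) :: real)"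
    using AE_lborel_singleton[of b] by eventually_elim (auto simp: indicator_def)
  have cont: "continuous_on {a..b} (\<lambda>x. exp (- \<beta> * x))" by (intro continuous_intros)
  have i: "integrable lborel (\<lambda>x. indicator {a..b} x *\<^sub>R exp (- \<beta> * x) :: real)"
    using borel_integrable_atLeastAtMost'[OF cont] by (simp add: set_integrable_def)
  show "integrable lborel (\<lambda>x. indicator {a..<b} x * exp (- \<beta> * x) :: real)"
    by (rule integrable_cong_AE_imp[OF i _ ae]) measurable
  have "(\<integral>x. indicator {a..b} x *\<^sub>R exp (- \<beta> * x) \<partial>lborel) = - exp (- \<beta> * b) / \<beta> - (- exp (- \<beta> * a) / \<beta>)"
    by (rule integral_FTC_atLeastAtMost[OF ab _ cont])
      (use \<beta> in \<open>auto intro!: derivative_eq_intros simp: has_real_derivative_iff_has_vector_derivative[symmetric]\<close>)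
  moreover have "(\<integral>x. indicator {a..b} x *\<^sub>R exp (- \<beta> * x) \<partial>lborel) = (\<integral>x. indicator {a..<b} x * exp (- \<beta> * x) \<partial>lborel)"
    by (rule integral_cong_AE[OF _ _ ae]) measurable
  ultimately show "(\<integral>x. indicator {a..<b} x * exp (- \<beta> * x) \<partial>lborel) = (exp (- \<beta> * a) - exp (- \<beta> * b)) / \<beta>"
    by (simp add: diff_divide_distrib)
qed

text \<open>On the cell \<open>[n h, (n + 1) h)\<close> the exponential integrates to
  \<open>exp (- \<beta> * h) ^ n\<close> times a constant, so the transform is a generating
  function.\<close>

lemma step_function_laplace:
  fixes h \<beta> :: real
  assumes h: "0 < h" and \<beta>: "0 < \<beta>" and g: "summable (\<lambda>n. \<bar>g n\<bar> * exp (- \<beta> * h) ^ n)"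
  shows "(LBINT x:{0..}. exp (- \<beta> * x) * g (nat \<lfloor>x / h\<rfloor>)) = (1 - exp (- \<beta> * h)) / \<beta> * (\<Sum>n. g n * exp (- \<beta> * h) ^ n)"
proof -
  define I where "I n = {real n * h..<real (Suc n) * h}" for n :: nat
  define f where "f n x = g n * (indicator (I n) x * exp (- \<beta> * x))" for n x
  have I: "integrable lborel (\<lambda>x. indicator (I n) x * exp (- \<beta> * x) :: real)"
    "(\<integral>x. indicator (I n) x * exp (- \<beta> * x) \<partial>lborel) = exp (- \<beta> * h) ^ n * ((1 - exp (- \<beta> * h)) / \<beta>)" for n
  proof -
    have le: "real n * h \<le> real (Suc n) * h" using h by simp
    show "integrable lborel (\<lambda>x. indicator (I n) x * exp (- \<beta> * x) :: real)"
      unfolding I_def by (rule integral_exp_step[OF \<beta> le])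
    have "exp (- \<beta> * (real n * h)) = exp (- \<beta> * h) ^ n" by (simp add: exp_of_nat_mult[symmetric] mult_ac)
    moreover have "exp (- \<beta> * (real (Suc n) * h)) = exp (- \<beta> * h) ^ n * exp (- \<beta> * h)"
      by (simp add: exp_of_nat_mult[symmetric] mult_exp_exp algebra_simps)
    ultimately show "(\<integral>x. indicator (I n) x * exp (- \<beta> * x) \<partial>lborel) = exp (- \<beta> * h) ^ n * ((1 - exp (- \<beta> * h)) / \<beta>)"
      unfolding I_def integral_exp_step(2)[OF \<beta> le] by (simp add: right_diff_distrib diff_divide_distrib)
  qed
  have ind: "indicator (I n) x = (of_bool (n = nat \<lfloor>x / h\<rfloor> \<and> 0 \<le> x) :: real)" for n x
  proof (cases "0 \<le> x")
    case True thus ?thesis using floor_step_iff[OF h True, of n] by (simp add: I_def indicator_def)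
  next
    case False
    have "0 \<le> real n * h" using h by simp
    thus ?thesis using False by (auto simp: I_def indicator_def)
  qed
  have sums: "(\<lambda>n. f n x) sums (indicator {0..} x * (exp (- \<beta> * x) * g (nat \<lfloor>x / h\<rfloor>)))" for x
  proof -
    have "(\<lambda>n. f n x) = (\<lambda>n. if n = nat \<lfloor>x / h\<rfloor> then indicator {0..} x * (exp (- \<beta> * x) * g n) else 0)"
      unfolding f_def ind by (auto simp: fun_eq_iff indicator_def)
    thus ?thesis using sums_single[of "nat \<lfloor>x / h\<rfloor>" "\<lambda>n. indicator {0..} x * (exp (- \<beta> * x) * g n)"] by simp
  qed
  have norm: "norm (f n x) = \<bar>g n\<bar> * (indicator (I n) x * exp (- \<beta> * x))" for n x
    by (simp add: f_def abs_mult)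
  have "(\<lambda>n. \<integral>x. f n x \<partial>lborel) sums (\<integral>x. (\<Sum>n. f n x) \<partial>lborel)"
  proof (rule sums_integral)
    show "integrable lborel (f n)" for n unfolding f_def using I(1) by simp
    show "AE x in lborel. summable (\<lambda>n. norm (f n x))"
    proof (rule AE_I2)
      fix x
      have "(\<lambda>n. norm (f n x)) = (\<lambda>n. if n = nat \<lfloor>x / h\<rfloor> then indicator {0..} x * (exp (- \<beta> * x) * \<bar>g n\<bar>) else 0)"
        unfolding norm ind by (auto simp: fun_eq_iff indicator_def)
      thus "summable (\<lambda>n. norm (f n x))"
        using sums_summable[OF sums_single[of "nat \<lfloor>x / h\<rfloor>" "\<lambda>n. indicator {0..} x * (exp (- \<beta> * x) * \<bar>g n\<bar>)"]] by simp
    qed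
    show "summable (\<lambda>n. \<integral>x. norm (f n x) \<partial>lborel)"
      unfolding norm using summable_mult2[OF g, of "(1 - exp (- \<beta> * h)) / \<beta>"] I(2) by (simp add: mult_ac)
  qed
  moreover have "(\<integral>x. f n x \<partial>lborel) = (1 - exp (- \<beta> * h)) / \<beta> * (g n * exp (- \<beta> * h) ^ n)" for n
    unfolding f_def using I(2) by simp
  moreover have "(\<Sum>n. f n x) = indicator {0..} x * (exp (- \<beta> * x) * g (nat \<lfloor>x / h\<rfloor>))" for x
    using sums by (simp add: sums_iff)
  ultimately have "(\<lambda>n. (1 - exp (- \<beta> * h)) / \<beta> * (g n * exp (- \<beta> * h) ^ n))
      sums (LBINT x:{0..}. exp (- \<beta> * x) * g (nat \<lfloor>x / h\<rfloor>))"
    by (simp add: set_lebesgue_integral_def)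
  moreover have "summable (\<lambda>n. g n * exp (- \<beta> * h) ^ n)"
    by (rule summable_norm_cancel) (use g in \<open>simp add: abs_mult\<close>)
  ultimately show ?thesis using sums_unique2 sums_mult[OF summable_sums] by blast
qed

lemma step_function_integral:
  fixes h :: real
  assumes h: "0 < h"
  shows "(LBINT z:{0..real n * h}. g (nat \<lfloor>z / h\<rfloor>)) = h * (\<Sum>k<n. g k)"
proof -
  define I where "I n = {real n * h..<real (Suc n) * h}" for n :: nat
  have I: "integrable lborel (\<lambda>x. indicator (I k) x :: real)" "(\<integral>x. indicator (I k) x \<partial>lborel) = h" for k
    using h by (auto simp: I_def algebra_simps)
  have "(\<integral>z. indicator {0..real n * h} z *\<^sub>R g (nat \<lfloor>z / h\<rfloor>) \<partial>lborel) = (\<integral>z. (\<Sum>k<n. indicator (I k) z * g k) \<partial>lborel)"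
  proof (rule integral_cong_AE)
    show "AE z in lborel. indicator {0..real n * h} z *\<^sub>R g (nat \<lfloor>z / h\<rfloor>) = (\<Sum>k<n. indicator (I k) z * g k)"
      using AE_lborel_singleton[of "real n * h"]
    proof eventually_elim
      case (elim z)
      show ?case
      proof (cases "0 \<le> z")
        case True
        have "(\<Sum>k<n. indicator (I k) z * g k) = (\<Sum>k<n. if k = nat \<lfloor>z / h\<rfloor> then g k else 0)"
          by (rule sum.cong) (use floor_step_iff[OF h True] in \<open>auto simp: I_def indicator_def\<close>)
        also have "\<dots> = (if nat \<lfloor>z / h\<rfloor> < n then g (nat \<lfloor>z / h\<rfloor>) else 0)" by simp
        also have "nat \<lfloor>z / h\<rfloor> < n \<longleftrightarrow> z < real n * h"
        proof -
          have "nat \<lfloor>z / h\<rfloor> < n \<longleftrightarrow> \<lfloor>z / h\<rfloor> < int n" using True h by (subst nat_less_iff) auto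
          also have "\<dots> \<longleftrightarrow> z / h < real n" by (simp add: floor_less_iff)
          finally show ?thesis using h by (simp add: field_simps)
        qed
        finally show ?thesis using True elim by (auto simp: indicator_def)
      next
        case False
        have "z \<notin> I k" for k
        proof -
          have "0 \<le> real k * h" using h by simp
          thus ?thesis using False by (auto simp: I_def)
        qed
        thus ?thesis using False by simp
      qed
    qed
    have "(\<lambda>z. g (nat \<lfloor>z / h\<rfloor>)) \<in> borel_measurable borel"
      by (rule measurable_compose[of "\<lambda>z. nat \<lfloor>z / h\<rfloor>" _ "count_space UNIV"]) measurable
    thus "(\<lambda>z. indicator {0..real n * h} z *\<^sub>R g (nat \<lfloor>z / h\<rfloor>)) \<in> borel_measurable lborel" by measurable
    show "(\<lambda>z. \<Sum>k<n. indicator (I k) z * g k) \<in> borel_measurable lborel" unfolding I_def by measurable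
  qed
  also have "\<dots> = (\<Sum>k<n. h * g k)"
    by (subst Bochner_Integration.integral_sum) (use I in auto)
  finally show ?thesis by (simp add: set_lebesgue_integral_def sum_distrib_left)
qed

section \<open>The Laplace exponent, its largest root and its inverse\<close>

context skip_free_levy_measure
begin

sublocale down: down_jumps p_up lam a_down
  using p_up_pos a_down_nonneg sums_a_down by unfold_locales auto

lemma laplace_exponent_gen:
  assumes \<beta>: "0 \<le> \<beta>"
  shows "p_up / exp (- \<beta> * h) + down.gen (exp (- \<beta> * h)) = laplace_exponent \<Lambda> \<beta> + lam"
proof -
  have "(\<lambda>k. a_down k * exp (- \<beta> * h) ^ k) sums ((\<integral>x. exp (\<beta> * x) \<partial>\<Lambda>) - p_up * exp (\<beta> * h))"
    using levy_integral[OF integrable_exp_levy[OF \<beta>]] by (simp add: exp_of_nat_mult[symmetric] mult_ac)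
  hence "down.gen (exp (- \<beta> * h)) = (\<integral>x. exp (\<beta> * x) \<partial>\<Lambda>) - p_up * exp (\<beta> * h)"
    unfolding down.gen_def by (simp add: sums_iff)
  moreover have "laplace_exponent \<Lambda> \<beta> = (\<integral>x. exp (\<beta> * x) \<partial>\<Lambda>) - lam"
    unfolding laplace_exponent_def using integrable_exp_levy[OF \<beta>]
    by (subst Bochner_Integration.integral_diff) (auto simp: lam_def)
  ultimately show ?thesis by (simp add: exp_minus field_simps)
qed

lemma laplace_exponent_0 [simp]: "laplace_exponent \<Lambda> 0 = 0"
  by (simp add: laplace_exponent_def)

lemma convex_laplace_exponent: "convex_on {0..} (laplace_exponent \<Lambda>)"
proof (rule convex_onI)
  fix t x y :: real assume t: "0 < t" "t < 1" and xy: "x \<in> {0..}" "y \<in> {0..}"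
  have i: "integrable \<Lambda> (\<lambda>z. exp (b * z) - 1)" if "0 \<le> b" for b
    using integrable_exp_levy[OF that] by simp
  have nn: "0 \<le> (1 - t) * x + t * y" using t xy by auto
  have "laplace_exponent \<Lambda> ((1 - t) * x + t * y) \<le> (\<integral>z. (1 - t) * (exp (x * z) - 1) + t * (exp (y * z) - 1) \<partial>\<Lambda>)"
    unfolding laplace_exponent_def
  proof (rule integral_mono)
    fix z
    have "exp ((1 - t) *\<^sub>R (x * z) + t *\<^sub>R (y * z)) \<le> (1 - t) * exp (x * z) + t * exp (y * z)"
      by (rule convex_onD[OF exp_convex]) (use t in auto)
    thus "exp (((1 - t) * x + t * y) * z) - 1 \<le> (1 - t) * (exp (x * z) - 1) + t * (exp (y * z) - 1)"
      by (simp add: algebra_simps)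
  qed (use i nn xy in auto)
  also have "\<dots> = (1 - t) * laplace_exponent \<Lambda> x + t * laplace_exponent \<Lambda> y"
    unfolding laplace_exponent_def using i xy by (subst Bochner_Integration.integral_add) auto
  finally show "laplace_exponent \<Lambda> ((1 - t) *\<^sub>R x + t *\<^sub>R y) \<le> (1 - t) * laplace_exponent \<Lambda> x + t * laplace_exponent \<Lambda> y" by simp
qed simp

text \<open>In the variable \<open>y = exp (- \<beta> * h)\<close> the exponent is a power series
  plus \<open>p_up / y\<close>. Summability of \<open>a_down\<close> gives uniform convergence up to
  \<open>y = 1\<close>, which is \<open>\<beta> = 0\<close>.\<close>

lemma continuous_laplace_exponent: "continuous_on {0..} (laplace_exponent \<Lambda>)"
proof -
  have "uniform_limit {0..1} (\<lambda>n y. \<Sum>i<n. a_down i * y ^ i) (\<lambda>y. \<Sum>i. a_down i * y ^ i) sequentially"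
  proof (rule Weierstrass_m_test)
    fix n and y :: real assume "y \<in> {0..1}"
    thus "norm (a_down n * y ^ n) \<le> a_down n"
      using a_down_nonneg[of n] by (auto simp: abs_mult power_le_one intro: mult_left_le)
  qed (use sums_a_down in \<open>simp add: sums_iff\<close>)
  hence "continuous_on {0..1} down.gen" unfolding down.gen_def
    by (rule uniform_limit_theorem[rotated]) (auto intro!: continuous_intros always_eventually)
  hence "continuous_on {0..} (\<lambda>\<beta>. down.gen (exp (- \<beta> * h)))"
    by (rule continuous_on_compose2) (use h_pos in \<open>auto intro!: continuous_intros\<close>)
  hence "continuous_on {0..} (\<lambda>\<beta>. p_up / exp (- \<beta> * h) + down.gen (exp (- \<beta> * h)) - lam)"
    by (intro continuous_intros) auto
  thus ?thesis
  proof (rule continuous_on_eq)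
    fix \<beta> :: real assume "\<beta> \<in> {0..}"
    thus "p_up / exp (- \<beta> * h) + down.gen (exp (- \<beta> * h)) - lam = laplace_exponent \<Lambda> \<beta>"
      using laplace_exponent_gen[of \<beta>] by simp
  qed
qed

text \<open>The upward jump alone gives at least \<open>p_up * exp (\<beta> * h) - lam\<close>; the
  threshold is where the linear term of this exponential reaches \<open>lam + q\<close>.\<close>

lemma laplace_exponent_large:
  assumes "0 \<le> q" "(lam + q) / (p_up * h) \<le> \<beta>"
  shows "0 \<le> \<beta>" "q < laplace_exponent \<Lambda> \<beta>"
proof -
  have ph: "0 < p_up * h" using p_up_pos h_pos by simp
  have "0 \<le> (lam + q) / (p_up * h)" using assms(1) lam_pos ph by (intro divide_nonneg_pos) auto
  thus \<beta>: "0 \<le> \<beta>" using assms(2) by simp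
  have "0 \<le> down.gen (exp (- \<beta> * h))" unfolding down.gen_def
    by (intro suminf_nonneg down.summable_gen) (use \<beta> h_pos a_down_nonneg in auto)
  hence "p_up * exp (\<beta> * h) \<le> laplace_exponent \<Lambda> \<beta> + lam"
    using laplace_exponent_gen[OF \<beta>] by (simp add: exp_minus field_simps)
  moreover have "p_up * (1 + \<beta> * h) \<le> p_up * exp (\<beta> * h)"
    using p_up_pos exp_ge_add_one_self[of "\<beta> * h"] by (intro mult_left_mono) auto
  moreover have "lam + q \<le> p_up * (\<beta> * h)" using assms ph by (simp add: field_simps)
  ultimately show "q < laplace_exponent \<Lambda> \<beta>" using p_up_pos by (simp add: algebra_simps)
qed

lemma laplace_exponent_IVT:
  assumes "0 \<le> a" "laplace_exponent \<Lambda> a \<le> q" "0 \<le> q"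
  shows "\<exists>\<beta>\<ge>a. laplace_exponent \<Lambda> \<beta> = q"
proof -
  define B where "B = max a ((lam + q) / (p_up * h))"
  have "q < laplace_exponent \<Lambda> B" by (rule laplace_exponent_large(2)) (use assms in \<open>auto simp: B_def\<close>)
  moreover have "a \<le> B" by (simp add: B_def)
  moreover have "continuous_on {a..B} (laplace_exponent \<Lambda>)"
    by (rule continuous_on_subset[OF continuous_laplace_exponent]) (use assms in auto)
  ultimately have "\<exists>\<beta>\<ge>a. \<beta> \<le> B \<and> laplace_exponent \<Lambda> \<beta> = q"
    using assms by (intro IVT') auto
  thus ?thesis by blast
qed

text \<open>The roots form a closed subset of a compact interval, so the maximum is attained and
  \<open>GREATEST\<close> denotes it.\<close>

lemma largest_root:
  shows "0 \<le> largest_root \<Lambda>" "laplace_exponent \<Lambda> (largest_root \<Lambda>) = 0"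
    "\<And>\<beta>. 0 \<le> \<beta> \<Longrightarrow> laplace_exponent \<Lambda> \<beta> = 0 \<Longrightarrow> \<beta> \<le> largest_root \<Lambda>"
proof -
  define B where "B = (lam + 0) / (p_up * h)"
  define R where "R = {\<beta> \<in> {0..B}. laplace_exponent \<Lambda> \<beta> = 0}"
  have B0: "0 \<le> B" using lam_pos p_up_pos h_pos by (simp add: B_def)
  have "closed R" unfolding R_def
    by (rule continuous_closed_preimage_constant[OF continuous_on_subset[OF continuous_laplace_exponent]]) auto
  moreover have "bounded R" by (rule bounded_subset[of "{0..B}"]) (auto simp: R_def)
  ultimately have "compact R" by (simp add: compact_eq_bounded_closed)
  moreover have "R \<noteq> {}" using B0 by (auto simp: R_def intro!: exI[of _ 0])
  ultimately obtain \<rho> where \<rho>: "\<rho> \<in> R" "\<And>\<beta>. \<beta> \<in> R \<Longrightarrow> \<beta> \<le> \<rho>" using compact_attains_sup[of R] by blast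
  have root: "\<beta> \<in> R" if "0 \<le> \<beta>" "laplace_exponent \<Lambda> \<beta> = 0" for \<beta>
  proof -
    have "\<not> B \<le> \<beta>" using laplace_exponent_large(2)[of 0 \<beta>] that by (auto simp: B_def)
    thus ?thesis using that by (simp add: R_def)
  qed
  have "largest_root \<Lambda> = \<rho>" unfolding largest_root_def
    by (rule Greatest_equality) (use \<rho> root in \<open>auto simp: R_def\<close>)
  thus "0 \<le> largest_root \<Lambda>" "laplace_exponent \<Lambda> (largest_root \<Lambda>) = 0"
    "\<And>\<beta>. 0 \<le> \<beta> \<Longrightarrow> laplace_exponent \<Lambda> \<beta> = 0 \<Longrightarrow> \<beta> \<le> largest_root \<Lambda>"
    using \<rho> root by (auto simp: R_def)
qed

lemma laplace_exponent_pos: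
  assumes "largest_root \<Lambda> < \<beta>" shows "0 < laplace_exponent \<Lambda> \<beta>"
proof (rule ccontr)
  assume "\<not> 0 < laplace_exponent \<Lambda> \<beta>"
  hence le: "laplace_exponent \<Lambda> \<beta> \<le> 0" by simp
  have "0 \<le> \<beta>" using assms largest_root(1) by simp
  from laplace_exponent_IVT[OF this le] obtain \<beta>' where "\<beta> \<le> \<beta>'" "laplace_exponent \<Lambda> \<beta>' = 0" by auto
  thus False using largest_root(1) largest_root(3)[of \<beta>'] assms by auto
qed

text \<open>Write \<open>s\<close> as a proper convex combination of the largest root and
  \<open>t\<close>. The exponent vanishes at the root and is positive at \<open>t\<close>, so plain
  convexity already gives a strict inequality.\<close>

lemma strict_mono_laplace_exponent:
  assumes "largest_root \<Lambda> \<le> s" "s < t" shows "laplace_exponent \<Lambda> s < laplace_exponent \<Lambda> t"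
proof (cases "s = largest_root \<Lambda>")
  case True
  thus ?thesis using laplace_exponent_pos[of t] assms largest_root(2) by simp
next
  case False
  define \<rho> where "\<rho> = largest_root \<Lambda>"
  define u where "u = (s - \<rho>) / (t - \<rho>)"
  have r: "\<rho> < s" using False assms by (simp add: \<rho>_def)
  have u: "0 < u" "u < 1" using r assms by (auto simp: u_def)
  have "u * (t - \<rho>) = s - \<rho>" using r assms by (simp add: u_def)
  hence s: "s = (1 - u) *\<^sub>R \<rho> + u *\<^sub>R t" by (simp add: algebra_simps)
  have "laplace_exponent \<Lambda> s \<le> (1 - u) * laplace_exponent \<Lambda> \<rho> + u * laplace_exponent \<Lambda> t"
    unfolding s by (rule convex_onD[OF convex_laplace_exponent])
      (use u r assms largest_root(1) in \<open>auto simp: \<rho>_def\<close>)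
  also have "\<dots> = u * laplace_exponent \<Lambda> t" using largest_root(2) by (simp add: \<rho>_def)
  also have "\<dots> < laplace_exponent \<Lambda> t" using u laplace_exponent_pos[of t] assms by simp
  finally show ?thesis .
qed

lemma Phi:
  assumes q: "0 \<le> q"
  shows "largest_root \<Lambda> \<le> Phi \<Lambda> q" "laplace_exponent \<Lambda> (Phi \<Lambda> q) = q"
proof -
  have inj: "inj_on (laplace_exponent \<Lambda>) {largest_root \<Lambda>..}"
  proof (rule inj_onI)
    fix s t assume "s \<in> {largest_root \<Lambda>..}" "t \<in> {largest_root \<Lambda>..}" "laplace_exponent \<Lambda> s = laplace_exponent \<Lambda> t"
    thus "s = t" using strict_mono_laplace_exponent[of s t] strict_mono_laplace_exponent[of t s]
      by (cases s t rule: linorder_cases) auto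
  qed
  obtain \<beta> where "largest_root \<Lambda> \<le> \<beta>" "laplace_exponent \<Lambda> \<beta> = q"
    using laplace_exponent_IVT[of "largest_root \<Lambda>" q] largest_root q by auto
  hence im: "q \<in> laplace_exponent \<Lambda> ` {largest_root \<Lambda>..}" by auto
  show "laplace_exponent \<Lambda> (Phi \<Lambda> q) = q" unfolding Phi_def by (rule f_the_inv_into_f[OF inj im])
  show "largest_root \<Lambda> \<le> Phi \<Lambda> q" unfolding Phi_def using the_inv_into_into[OF inj im, of "{largest_root \<Lambda>..}"] by simp
qed

lemma Phi_nonneg: "0 \<le> q \<Longrightarrow> 0 \<le> Phi \<Lambda> q"
  using Phi(1) largest_root(1) by (rule order_trans[rotated])

lemma Phi_pos: "0 < q \<Longrightarrow> 0 < Phi \<Lambda> q"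
  using Phi(2)[of q] Phi_nonneg[of q] by (cases "Phi \<Lambda> q = 0") auto

lemma laplace_exponent_gt: "0 \<le> q \<Longrightarrow> Phi \<Lambda> q < \<beta> \<Longrightarrow> q < laplace_exponent \<Lambda> \<beta>"
  using strict_mono_laplace_exponent[of "Phi \<Lambda> q" \<beta>] Phi[of q] by simp

lemma scale_gen_laplace:
  assumes q: "0 \<le> q" and \<beta>: "Phi \<Lambda> q < \<beta>" and w: "\<And>n. 0 \<le> w n"
    and rec: "\<And>n. (lam + q) * w n = p_up * w (Suc n) + (\<Sum>k\<le>n. a_down k * w (n - k))"
    and w0: "p_up * w 0 = 1 / h"
  shows "(\<lambda>n. w n * exp (- \<beta> * h) ^ n) sums (exp (\<beta> * h) / (h * (laplace_exponent \<Lambda> \<beta> - q)))"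
proof -
  have P0: "0 \<le> Phi \<Lambda> q" by (rule Phi_nonneg[OF q])
  have b0: "0 \<le> \<beta>" using P0 \<beta> by simp
  have gt: "q < laplace_exponent \<Lambda> \<beta>" by (rule laplace_exponent_gt[OF q \<beta>])
  have "(\<lambda>n. w n * exp (- \<beta> * h) ^ n) sums
      (p_up * w 0 / (exp (- \<beta> * h) * (p_up / exp (- \<beta> * h) + down.gen (exp (- \<beta> * h)) - (lam + q))))"
  \<comment> \<open>The comparison point for the drift is
    \<open>exp (- Phi \<Lambda> q * h)\<close>: there the exponent equals \<open>q\<close>, and at
    \<open>\<beta>\<close> it is larger.\<close>
  proof (rule down.scale_gen[where ?y0.0="exp (- Phi \<Lambda> q * h)"])
    show "exp (- \<beta> * h) < exp (- Phi \<Lambda> q * h)" "exp (- Phi \<Lambda> q * h) \<le> 1"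
      using \<beta> h_pos P0 by auto
    show "p_up / exp (- Phi \<Lambda> q * h) + down.gen (exp (- Phi \<Lambda> q * h)) < p_up / exp (- \<beta> * h) + down.gen (exp (- \<beta> * h))"
      unfolding laplace_exponent_gen[OF P0] laplace_exponent_gen[OF b0] using Phi(2)[OF q] gt by simp
    show "lam + q < p_up / exp (- \<beta> * h) + down.gen (exp (- \<beta> * h))"
      unfolding laplace_exponent_gen[OF b0] using gt by simp
  qed (use w rec in auto)
  thus ?thesis unfolding laplace_exponent_gen[OF b0] w0 by (simp add: exp_minus field_simps)
qed

end

section \<open>Scale functions\<close>

text \<open>One-sided limits bound \<open>f\<close> near every point; Bolzano bisection joins the
  local bounds.\<close>

lemma cadlag_bounded_above:
  assumes f: "cadlag f" and t: "0 \<le> t"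
  shows "\<exists>B. \<forall>s. 0 \<le> s \<and> s \<le> t \<longrightarrow> f s \<le> B"
proof -
  define P where "P a b \<longleftrightarrow> (\<exists>B. \<forall>s. 0 \<le> s \<and> a \<le> s \<and> s \<le> b \<longrightarrow> f s \<le> B)" for a b
  have "P 0 t"
    using t
  proof (induction rule: Bolzano)
    case (trans a b c)
    then obtain B C where BC: "\<And>s. 0 \<le> s \<Longrightarrow> a \<le> s \<Longrightarrow> s \<le> b \<Longrightarrow> f s \<le> B" "\<And>s. 0 \<le> s \<Longrightarrow> b \<le> s \<Longrightarrow> s \<le> c \<Longrightarrow> f s \<le> C"
      unfolding P_def by blast
    have "f s \<le> max B C" if "0 \<le> s" "a \<le> s" "s \<le> c" for s
      using BC(1)[of s] BC(2)[of s] that by (cases "s \<le> b") (auto simp: le_max_iff_disj)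
    thus ?case unfolding P_def by blast
  next
    case (local x)
    hence x0: "0 \<le> x" by simp
    have "(f \<longlongrightarrow> f x) (at_right x)" using f x0 by (simp add: cadlag_def)
    hence "eventually (\<lambda>s. f s < f x + 1) (at_right x)" by (rule order_tendstoD) simp
    then obtain c where c: "x < c" "\<And>s. x < s \<Longrightarrow> s < c \<Longrightarrow> f s < f x + 1" by (auto simp: eventually_at_right_field)
    obtain e B where e: "e < x" "\<And>s. 0 \<le> s \<Longrightarrow> e < s \<Longrightarrow> s < x \<Longrightarrow> f s \<le> B"
    proof (cases "x = 0")
      case True thus ?thesis by (intro that[of "x - 1" 0]) auto
    next
      case False
      hence "0 < x" using x0 by simp
      then obtain l where "(f \<longlongrightarrow> l) (at_left x)" using f unfolding cadlag_def by blast
      hence "eventually (\<lambda>s. f s < l + 1) (at_left x)" by (rule order_tendstoD) simp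
      then obtain e where "e < x" "\<And>s. e < s \<Longrightarrow> s < x \<Longrightarrow> f s < l + 1" by (auto simp: eventually_at_left_field)
      thus ?thesis by (intro that[of e "l + 1"]) (auto intro: less_imp_le)
    qed
    show ?case
    proof (intro exI[of _ "min (c - x) (x - e)"] conjI allI impI)
      show "0 < min (c - x) (x - e)" using c e by simp
      fix a b assume ab: "a \<le> x \<and> x \<le> b \<and> b - a < min (c - x) (x - e)"
      have "f s \<le> max B (f x + 1)" if "0 \<le> s" "a \<le> s" "s \<le> b" for s
        using c(2)[of s] e(2)[of s] that ab by (cases s x rule: linorder_cases) (auto simp: le_max_iff_disj)
      thus "P a b" unfolding P_def by blast
    qed
  qed
  thus ?thesis unfolding P_def by auto
qed

text \<open>Up to a fixed negative time the path is bounded, so high barriers are not reached and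
  the value is eventually constant in \<open>N\<close>.\<close>

lemma exit_lim_barrier_to_infinity:
  assumes f: "cadlag f" and h: "0 < h"
  shows "(\<lambda>N. exit_lim q (ereal (real N * h)) x f) \<longlonglongrightarrow> exit_lim q \<infinity> x f"
proof (cases "\<exists>t\<ge>0. x + f t < 0")
  case True
  then obtain t where t: "0 \<le> t" "x + f t < 0" by blast
  from cadlag_bounded_above[OF f t(1)] obtain B where B: "\<And>s. 0 \<le> s \<Longrightarrow> s \<le> t \<Longrightarrow> f s \<le> B" by blast
  obtain N0 where N0: "(x + B) / h < real N0" using reals_Archimedean2 by blast
  have "eventually (\<lambda>N. exit_lim q (ereal (real N * h)) x f = exit_lim q \<infinity> x f) sequentially"
    using eventually_ge_at_top[of N0]
  proof eventually_elim
    case (elim N)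
    have "x + B < real N0 * h" using N0 h by (simp add: field_simps)
    also have "\<dots> \<le> real N * h" using elim h by simp
    finally have "x + f s < real N * h" if "0 \<le> s" "s \<le> t" for s using B[OF that] by simp
    hence "\<exists>t\<ge>0. x + f t < 0 \<and> (\<forall>s. 0 \<le> s \<and> s \<le> t \<longrightarrow> ereal (x + f s) < ereal (real N * h))"
      using t by auto
    moreover have "\<exists>t\<ge>0. x + f t < 0 \<and> (\<forall>s. 0 \<le> s \<and> s \<le> t \<longrightarrow> ereal (x + f s) < \<infinity>)" using t by auto
    ultimately show ?case unfolding exit_lim_def by (simp only: if_True)
  qed
  thus ?thesis by (rule tendsto_eventually)
next
  case False
  hence "exit_lim q b x f = 0" for b by (auto simp: exit_lim_def)
  thus ?thesis by simp
qed

lemma exit_lim_passage_below: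
  "exit_lim q \<infinity> x (\<lambda>t. X t \<omega>) = (if passage_below X x \<omega> < \<infinity> then exp (- q * real_of_ereal (passage_below X x \<omega>)) else 0)"
proof -
  define S where "S = {t. 0 \<le> t \<and> x + X t \<omega> < 0}"
  have pb: "passage_below X x \<omega> = Inf (ereal ` S)"
    unfolding passage_below_def S_def by (intro arg_cong[where f=Inf]) (auto simp: algebra_simps image_def)
  have ne: "(\<exists>t\<ge>0. x + X t \<omega> < 0 \<and> (\<forall>s. 0 \<le> s \<and> s \<le> t \<longrightarrow> ereal (x + X s \<omega>) < \<infinity>)) \<longleftrightarrow> S \<noteq> {}"
    by (auto simp: S_def)
  show ?thesis
  proof (cases "S = {}")
    case True
    thus ?thesis unfolding exit_lim_def ne pb by (simp add: top_ereal_def)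
  next
    case False
    have "bdd_below S" by (auto simp: S_def bdd_below_def)
    hence "Inf (ereal ` S) = ereal (Inf S)" using False by (simp add: ereal_Inf')
    thus ?thesis using False unfolding exit_lim_def ne pb S_def[symmetric] by simp
  qed
qed

section \<open>The scale sequence and its behaviour under tilting\<close>

context skip_free_levy_measure
begin

text \<open>The initial value is forced by the normalization of the scale function: the generating
  function becomes \<open>exp (\<beta> * h) / (h * (laplace_exponent \<Lambda> \<beta> -
  q))\<close>, and integration over cells adds the factor
  \<open>(1 - exp (- \<beta> * h)) / \<beta>\<close>.\<close>

definition scale_q :: "real \<Rightarrow> nat \<Rightarrow> real" where
  "scale_q q = scale_seq (lam + q) p_up a_down (1 / (h * p_up))"

lemma scale_q_0: "scale_q q 0 = 1 / (h * p_up)" by (simp add: scale_q_def)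

lemma scale_q_rec:
  "(lam + q) * scale_q q n = p_up * scale_q q (Suc n) + (\<Sum>k\<le>n. a_down k * scale_q q (n - k))"
  unfolding scale_q_def by (rule scale_seq_rec) (use p_up_pos in simp)

lemma scale_q_unique:
  assumes "\<And>n. (lam + q) * f n = p_up * f (Suc n) + (\<Sum>k\<le>n. a_down k * f (n - k))" "f 0 = 1 / (h * p_up)"
  shows "f n = scale_q q n"
  by (rule recurrence_unique[where N=n and B="\<lambda>_. 0" and l="lam + q" and p=p_up and a=a_down])
    (use assms scale_q_rec[of q] scale_q_0 p_up_pos in auto)

text \<open>Tilting multiplies the rate of a jump \<open>x\<close> by \<open>exp (b * x)\<close> and
  adds \<open>laplace_exponent \<Lambda> b\<close> to the total rate, so exponential weights carry
  one recurrence into the other. The exponent uses \<open>Suc n\<close> because the initial value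
  contains the tilted \<open>p_up\<close>; this is the \<open>1 +\<close> inside the floor of
  \<open>Wq\<close>.\<close>

lemma scale_q_tilt:
  assumes b: "0 \<le> b"
  shows "exp (b * real (Suc n) * h) * skip_free_levy_measure.scale_q (tilt \<Lambda> b) h 0 n = scale_q (laplace_exponent \<Lambda> b) n"
proof -
  interpret T: skip_free_levy_measure "tilt \<Lambda> b" h by (rule tilt_levy_measure[OF b])
  have p: "T.p_up = exp (b * h) * p_up" by (simp add: T.p_up_def p_up_def measure_tilt)
  have a: "T.a_down k = exp (- b * real k * h) * a_down k" for k
    by (simp add: T.a_down_def a_down_def measure_tilt mult_ac)
  have "(\<integral>x. 1 \<partial>tilt \<Lambda> b) = (\<integral>x. exp (b * x) * 1 \<partial>\<Lambda>)" by (rule integral_tilt) simp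
  moreover have "laplace_exponent \<Lambda> b = (\<integral>x. exp (b * x) \<partial>\<Lambda>) - lam"
    unfolding laplace_exponent_def using integrable_exp_levy[OF b]
    by (subst Bochner_Integration.integral_diff) (auto simp: lam_def)
  ultimately have l: "T.lam = lam + laplace_exponent \<Lambda> b" by (simp add: T.lam_def)
  define e where "e n = exp (b * real (Suc n) * h)" for n
  have "e n * T.scale_q 0 n = scale_q (laplace_exponent \<Lambda> b) n"
  proof (rule scale_q_unique)
    fix n
    have "(lam + laplace_exponent \<Lambda> b) * (e n * T.scale_q 0 n) = e n * ((T.lam + 0) * T.scale_q 0 n)"
      by (simp add: l)
    also have "\<dots> = e n * T.p_up * T.scale_q 0 (Suc n) + (\<Sum>k\<le>n. e n * (T.a_down k * T.scale_q 0 (n - k)))"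
      unfolding T.scale_q_rec by (simp add: distrib_left sum_distrib_left)
    also have "e n * T.p_up = p_up * e (Suc n)"
      unfolding p e_def by (simp add: exp_add[symmetric] algebra_simps)
    also have "(\<Sum>k\<le>n. e n * (T.a_down k * T.scale_q 0 (n - k))) = (\<Sum>k\<le>n. a_down k * (e (n - k) * T.scale_q 0 (n - k)))"
    proof (rule sum.cong[OF refl])
      fix k assume "k \<in> {..n}"
      hence "e n * exp (- b * real k * h) = e (n - k)"
        unfolding e_def by (simp add: exp_add[symmetric] of_nat_diff algebra_simps)
      thus "e n * (T.a_down k * T.scale_q 0 (n - k)) = a_down k * (e (n - k) * T.scale_q 0 (n - k))"
        unfolding a by (simp add: mult_ac)
    qed
    finally show "(lam + laplace_exponent \<Lambda> b) * (e n * T.scale_q 0 n) =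
        p_up * (e (Suc n) * T.scale_q 0 (Suc n)) + (\<Sum>k\<le>n. a_down k * (e (n - k) * T.scale_q 0 (n - k)))"
      by (simp add: mult_ac)
  next
    show "e 0 * T.scale_q 0 0 = 1 / (h * p_up)" by (simp add: T.scale_q_0 p e_def)
  qed
  thus ?thesis by (simp add: e_def)
qed

end

section \<open>Two-sided exit, depth probabilities and the normalizing constant\<close>

context upwards_skip_free_levy_chain
begin

text \<open>Below \<open>0\<close> the exit has already occurred and the value is \<open>1\<close>,
  so jumps down by more than \<open>n\<close> steps contribute their total rate,
  \<open>tail n\<close>.\<close>

lemma exit_fun_rec:
  assumes q: "0 \<le> q" and b: "0 \<le> b" and n: "ereal (real n * h) < b"
  shows "(L.lam + q) * exit_fun q b (real n * h) = L.p_up * exit_fun q b (real (Suc n) * h)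
     + (\<Sum>k\<le>n. L.a_down k * exit_fun q b (real (n - k) * h)) + L.down.tail n"
proof -
  let ?x = "real n * h"
  have x: "?x \<in> lattice_points h" "0 \<le> ?x" using L.lattice_of_int(1)[of "int n"] h_pos by auto
  have int: "integrable \<Lambda> (\<lambda>y. exit_fun q b (?x + y))"
  proof (rule L.integrable_const_bound[where B=1])
    show "AE y in \<Lambda>. norm (exit_fun q b (?x + y)) \<le> 1"
      using L.AE_levy_lattice
    proof eventually_elim
      case (elim y)
      hence "?x + y \<in> lattice_points h" by (intro L.lattice_add x)
      thus ?case using exit_fun_bounds[OF q b] by (simp add: abs_le_iff)
    qed
  qed (use exit_fun_measurable[OF q, of b] in measurable)
  define s where "s k = L.a_down k * exit_fun q b (?x - real k * h)" for k
  have s: "s sums ((\<integral>y. exit_fun q b (?x + y) \<partial>\<Lambda>) - L.p_up * exit_fun q b (?x + h))"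
    using L.levy_integral[OF int] by (simp add: s_def[abs_def])
  \<comment> \<open>Beyond \<open>n\<close> the series \<open>s\<close> agrees with
    \<open>a_down\<close>, so it is written as \<open>a_down\<close> plus a finite
    correction.\<close>
  have "(\<lambda>k. L.a_down k + (if k \<in> {..n} then s k - L.a_down k else 0)) sums (L.lam - L.p_up + (\<Sum>k\<in>{..n}. s k - L.a_down k))"
    by (intro sums_add L.sums_a_down sums_If_finite_set) simp
  moreover have "L.a_down k + (if k \<in> {..n} then s k - L.a_down k else 0) = s k" for k
  proof (cases "k \<le> n")
    case False
    hence "?x - real k * h < 0" using h_pos by (simp add: left_diff_distrib[symmetric] mult_less_0_iff)
    thus ?thesis using False by (simp add: s_def exit_fun_neg[OF q])
  qed simp
  ultimately have "s sums (L.lam - L.p_up + (\<Sum>k\<in>{..n}. s k - L.a_down k))" by simp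
  from sums_unique2[OF s this]
  have "(\<integral>y. exit_fun q b (?x + y) \<partial>\<Lambda>) = L.p_up * exit_fun q b (?x + h) + (\<Sum>k\<le>n. s k) + L.down.tail n"
    by (simp add: L.down.tail_def sum_subtractf)
  also have "(\<Sum>k\<le>n. s k) = (\<Sum>k\<le>n. L.a_down k * exit_fun q b (real (n - k) * h))"
    by (rule sum.cong) (auto simp: s_def of_nat_diff left_diff_distrib)
  also have "?x + h = real (Suc n) * h" by (simp add: algebra_simps)
  finally show ?thesis using exit_fun_harmonic[OF q b x n] by simp
qed

text \<open>Passing to the complementary probability removes the inhomogeneity. Up to
  \<open>N\<close> it is a multiple of the scale sequence, and its value \<open>1\<close> at the
  barrier fixes the factor.\<close>

lemma not_exit_two_sided:
  assumes n: "n \<le> N"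
  shows "1 - exit_fun 0 (ereal (real N * h)) (real n * h) = L.scale_q 0 n / L.scale_q 0 N"
    and "0 < L.scale_q 0 N"
proof -
  define b where "b = ereal (real N * h)"
  define G where "G n = 1 - exit_fun 0 b (real n * h)" for n
  define w where "w = L.scale_q 0"
  have b: "0 \<le> b" using h_pos by (simp add: b_def)
  have w0: "0 < w 0" using h_pos L.p_up_pos by (simp add: w_def L.scale_q_0)
  have G: "G n = G 0 / w 0 * w n" if "n \<le> N" for n
  proof (rule recurrence_unique[where N=N and B="\<lambda>_. 0" and l="L.lam + 0" and p="L.p_up" and a="L.a_down"])
    fix n assume "n < N"
    hence "ereal (real n * h) < b" using h_pos by (simp add: b_def)
    from exit_fun_rec[OF order_refl b this]
    show "(L.lam + 0) * G n = L.p_up * G (Suc n) + (\<Sum>k\<le>n. L.a_down k * G (n - k)) + 0"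
      by (simp add: G_def L.down.tail_def right_diff_distrib sum_subtractf)
    have "(L.lam + 0) * (G 0 / w 0 * w n) = G 0 / w 0 * ((L.lam + 0) * w n)" by simp
    also have "\<dots> = L.p_up * (G 0 / w 0 * w (Suc n)) + (\<Sum>k\<le>n. L.a_down k * (G 0 / w 0 * w (n - k))) + 0"
      unfolding w_def L.scale_q_rec by (simp add: distrib_left sum_distrib_left mult_ac)
    finally show "(L.lam + 0) * (G 0 / w 0 * w n) = L.p_up * (G 0 / w 0 * w (Suc n)) + (\<Sum>k\<le>n. L.a_down k * (G 0 / w 0 * w (n - k))) + 0" .
  qed (use that w0 L.p_up_pos in auto)
  have "exit_fun 0 b (real N * h) = 0" by (rule exit_fun_above) (use h_pos in \<open>auto simp: b_def\<close>)
  hence "G N = 1" by (simp add: G_def)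
  hence GN: "G 0 / w 0 * w N = 1" using G[of N] by (simp only: order_refl)
  have "0 \<le> G 0" using exit_fun_bounds(2)[OF order_refl b L.lattice_0] by (simp add: G_def)
  hence c0: "0 \<le> G 0 / w 0" using w0 by simp
  \<comment> \<open>The sign is read off from the product \<open>G 0 / w 0 * w N = 1\<close>, whose
    first factor is nonnegative.\<close>
  have pos: "0 < w N"
  proof (rule ccontr)
    assume "\<not> 0 < w N"
    hence "G 0 / w 0 * w N \<le> 0" using c0 by (intro mult_nonneg_nonpos) auto
    thus False unfolding GN by simp
  qed
  have "G 0 / w 0 = 1 / w N" using GN pos by (metis less_irrefl nonzero_eq_divide_eq)
  hence "G n = w n / w N" using G[OF n] by simp
  thus "1 - exit_fun 0 (ereal (real N * h)) (real n * h) = L.scale_q 0 n / L.scale_q 0 N"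
    by (simp add: G_def b_def w_def)
  show "0 < L.scale_q 0 N" using pos by (simp add: w_def)
qed

lemma scale_q_pos: "0 < L.scale_q 0 n" by (rule not_exit_two_sided(2)[of n n]) simp

text \<open>The ratio of the two terms is a probability.\<close>

lemma scale_q_mono: "n \<le> N \<Longrightarrow> L.scale_q 0 n \<le> L.scale_q 0 N"
proof -
  assume n: "n \<le> N"
  have "real n * h \<in> lattice_points h" using L.lattice_of_int(1)[of "int n"] by simp
  moreover have "0 \<le> ereal (real N * h)" using h_pos by simp
  ultimately have "0 \<le> exit_fun 0 (ereal (real N * h)) (real n * h)" by (intro exit_fun_bounds(1)) auto
  hence "L.scale_q 0 n / L.scale_q 0 N \<le> 1" using not_exit_two_sided(1)[OF n] by simp
  thus ?thesis using scale_q_pos[of N] by (simp add: divide_le_eq)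
qed

text \<open>At a finite barrier the grid values are known to converge only almost surely, as paths
  off the lattice may leave the barrier at once. The pathwise \<open>lim\<close> supplies a
  measurable substitute.\<close>

lemma exit_lim_measurable_version:
  assumes x: "x \<in> lattice_points h" and b: "0 \<le> b"
  obtains g where "g \<in> borel_measurable M" "AE \<omega> in M. g \<omega> = exit_lim q b x (\<lambda>t. X t \<omega>)"
    "0 \<le> q \<Longrightarrow> exit_fun q b x = (\<integral>\<omega>. g \<omega> \<partial>M)"
proof -
  define g where "g \<omega> = lim (\<lambda>m. exit_val (exp (- q / 2 ^ m)) b x (\<lambda>k. X (real k / 2 ^ m) \<omega>))" for \<omega>
  have [measurable]: "X (real i / 2 ^ m) \<in> borel_measurable M" for i m by (intro measurable_at) simp
  have m: "g \<in> borel_measurable M" unfolding g_def by measurable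
  have eq: "AE \<omega> in M. g \<omega> = exit_lim q b x (\<lambda>t. X t \<omega>)"
    using AE_exit_val_tendsto[OF x b, of q] by eventually_elim (auto simp: g_def intro: limI)
  have lim: "AE \<omega> in M. (\<lambda>m. exit_val (exp (- q / 2 ^ m)) b x (\<lambda>k. X (real k / 2 ^ m) \<omega>)) \<longlonglongrightarrow> g \<omega>"
    using AE_exit_val_tendsto[OF x b, of q] eq by eventually_elim simp
  show thesis by (rule that[OF m eq]) (rule exit_fun_eq[OF _ m lim])
qed

text \<open>Shifted up by \<open>n * h\<close>, a depth beyond \<open>n * h\<close> before reaching
  \<open>h\<close> is a downward exit from \<open>[0, (n + 1) * h)\<close>, the condition in
  \<open>exit_lim\<close>.\<close>

lemma first_depth_le_iff:
  "first_depth X h \<omega> \<le> ereal (real n * h) \<longleftrightarrow>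
     \<not> (\<exists>t\<ge>0. real n * h + X t \<omega> < 0 \<and> (\<forall>s. 0 \<le> s \<and> s \<le> t \<longrightarrow> ereal (real n * h + X s \<omega>) < ereal (real (Suc n) * h)))"
proof -
  have nh: "0 \<le> real n * h" using h_pos by simp
  have above: "ereal s \<le> passage_above X h \<omega> \<longleftrightarrow> (\<forall>t\<ge>0. h \<le> X t \<omega> \<longrightarrow> s \<le> t)" for s
    unfolding passage_above_def le_Inf_iff by auto
  have "first_depth X h \<omega> \<le> ereal (real n * h) \<longleftrightarrow> (\<forall>s. 0 \<le> s \<and> ereal s \<le> passage_above X h \<omega> \<longrightarrow> 0 \<le> real n * h + X s \<omega>)"
    unfolding first_depth_def
    by (subst ereal_uminus_le_reorder) (auto simp: le_INF_iff minus_le_iff algebra_simps)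
  also have "\<dots> \<longleftrightarrow> \<not> (\<exists>s\<ge>0. real n * h + X s \<omega> < 0 \<and> (\<forall>t\<ge>0. h \<le> X t \<omega> \<longrightarrow> s \<le> t))"
    unfolding above by (auto simp: not_less)
  also have "(\<exists>s\<ge>0. real n * h + X s \<omega> < 0 \<and> (\<forall>t\<ge>0. h \<le> X t \<omega> \<longrightarrow> s \<le> t))
     \<longleftrightarrow> (\<exists>t\<ge>0. real n * h + X t \<omega> < 0 \<and> (\<forall>s. 0 \<le> s \<and> s \<le> t \<longrightarrow> X s \<omega> < h))"
  proof (intro iffI; elim exE conjE)
    fix s assume s: "0 \<le> s" "real n * h + X s \<omega> < 0" "\<forall>t\<ge>0. h \<le> X t \<omega> \<longrightarrow> s \<le> t"
    \<comment> \<open>The passage time is included in the definition of the depth, so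
      \<open>s\<close> could be a passage time itself; this fails because the path is negative at
      \<open>s\<close>.\<close>
    have "X s' \<omega> < h" if "0 \<le> s'" "s' \<le> s" for s'
    proof (rule ccontr)
      assume "\<not> X s' \<omega> < h"
      hence "s = s'" "h \<le> X s' \<omega>" using s(3) that by auto
      thus False using s(2) nh h_pos by simp
    qed
    thus "\<exists>t\<ge>0. real n * h + X t \<omega> < 0 \<and> (\<forall>s. 0 \<le> s \<and> s \<le> t \<longrightarrow> X s \<omega> < h)" using s by blast
  next
    fix t assume t: "0 \<le> t" "real n * h + X t \<omega> < 0" "\<forall>s. 0 \<le> s \<and> s \<le> t \<longrightarrow> X s \<omega> < h"
    have "\<forall>s\<ge>0. h \<le> X s \<omega> \<longrightarrow> t \<le> s" using t(3) by (meson linorder_not_le nle_le)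
    thus "\<exists>s\<ge>0. real n * h + X s \<omega> < 0 \<and> (\<forall>t\<ge>0. h \<le> X t \<omega> \<longrightarrow> s \<le> t)" using t by blast
  qed
  also have "(\<lambda>s. X s \<omega> < h) = (\<lambda>s. ereal (real n * h + X s \<omega>) < ereal (real (Suc n) * h))"
    by (simp add: algebra_simps)
  finally show ?thesis .
qed

text \<open>The event agrees up to a null set with the measurable set \<open>g = 0\<close>, which
  gives it the same measure in the completion. The rest is two-sided exit from \<open>n\<close> with
  barrier \<open>n + 1\<close>.\<close>

lemma depth_prob_eq: "depth_prob M X h (real n * h) = L.scale_q 0 n / L.scale_q 0 (Suc n)"
proof -
  note [simp del] = of_nat_Suc
  let ?b = "ereal (real (Suc n) * h)" and ?x = "real n * h"
  have x: "?x \<in> lattice_points h" using L.lattice_of_int(1)[of "int n"] by simp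
  have b: "0 \<le> ?b" using h_pos by simp
  obtain g where g[measurable]: "g \<in> borel_measurable M" and ae: "AE \<omega> in M. g \<omega> = exit_lim 0 ?b ?x (\<lambda>t. X t \<omega>)"
    and F: "exit_fun 0 ?b ?x = (\<integral>\<omega>. g \<omega> \<partial>M)" using exit_lim_measurable_version[OF x b, of 0] by auto
  define A where "A = {\<omega> \<in> space M. first_depth X h \<omega> \<le> ereal ?x}"
  define B where "B = {\<omega> \<in> space M. g \<omega> = 0}"
  have B: "B \<in> sets M" unfolding B_def by measurable
  have lim: "exit_lim 0 ?b ?x (\<lambda>t. X t \<omega>) = of_bool (\<not> first_depth X h \<omega> \<le> ereal ?x)" for \<omega>
    unfolding first_depth_le_iff exit_lim_def
    by (simp only: minus_zero mult_zero_left exp_zero not_not of_bool_def)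
  have AB: "AE \<omega> in M. \<omega> \<in> B \<longleftrightarrow> \<omega> \<in> A" using ae by eventually_elim (auto simp: A_def B_def lim)
  have AEc: "AE \<omega> in completion M. \<omega> \<in> B \<longleftrightarrow> \<omega> \<in> A" using AB by (rule AE_completion)
  have A: "A \<in> sets (completion M)"
    by (rule completion.in_sets_AE[OF AEc]) (use B in \<open>auto simp: A_def\<close>)
  have "depth_prob M X h ?x = measure (completion M) A" by (simp add: depth_prob_def A_def)
  also have "\<dots> = measure (completion M) B"
    unfolding measure_def using emeasure_eq_AE[OF AEc _ A] B by simp
  also have "\<dots> = (\<integral>\<omega>. indicator B \<omega> \<partial>M)" using B by simp
  also have "\<dots> = (\<integral>\<omega>. 1 - g \<omega> \<partial>M)"
    by (rule integral_cong_AE) (use ae AE_space B in \<open>auto elim!: eventually_elim2 simp: B_def lim indicator_def split: if_splits\<close>)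
  also have "\<dots> = 1 - exit_fun 0 ?b ?x"
  proof -
    have "integrable M g"
      by (rule integrable_const_bound[where B=1]) (use ae in \<open>auto elim!: eventually_mono simp: lim\<close>)
    thus ?thesis unfolding F by (subst Bochner_Integration.integral_diff) (auto simp: prob_space)
  qed
  also have "\<dots> = L.scale_q 0 n / L.scale_q 0 (Suc n)" by (rule not_exit_two_sided) simp
  finally show ?thesis .
qed

lemma scale_with_const_eq:
  "scale_with_const M X h c x = c / L.scale_q 0 0 * L.scale_q 0 (nat \<lfloor>x / h\<rfloor>)"
proof -
  define w where "w = L.scale_q 0"
  have w: "w n \<noteq> 0" for n using scale_q_pos[of n] by (simp add: w_def)
  have "(\<Prod>r=1..m. depth_prob M X h ((real r - 1) * h)) = w 0 / w m" for m
  proof (induction m)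
    case (Suc m)
    have "(\<Prod>r=1..Suc m. depth_prob M X h ((real r - 1) * h)) = w 0 / w m * depth_prob M X h (real m * h)"
      using Suc by (simp add: prod.nat_ivl_Suc')
    thus ?case using w by (simp add: depth_prob_eq w_def)
  qed (use w in simp)
  thus ?thesis unfolding scale_with_const_def w_def[symmetric] using w by simp
qed

lemma scale_laplace:
  assumes \<beta>: "Phi \<Lambda> 0 < \<beta>"
  shows "(LBINT x:{0..}. exp (- \<beta> * x) * scale_with_const M X h c x)
      = c / L.scale_q 0 0 * ((exp (\<beta> * h) - 1) / (\<beta> * h * laplace_exponent \<Lambda> \<beta>))"
proof -
  define w where "w = L.scale_q 0"
  have \<beta>0: "0 < \<beta>" using \<beta> L.Phi_nonneg[of 0] by simp
  have s: "(\<lambda>n. w n * exp (- \<beta> * h) ^ n) sums (exp (\<beta> * h) / (h * (laplace_exponent \<Lambda> \<beta> - 0)))"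
    unfolding w_def
    by (rule L.scale_gen_laplace) (use \<beta> scale_q_pos L.scale_q_rec[of 0] L.p_up_pos in \<open>auto simp: less_imp_le L.scale_q_0\<close>)
  have "(LBINT x:{0..}. exp (- \<beta> * x) * (c / w 0 * w (nat \<lfloor>x / h\<rfloor>)))
     = (1 - exp (- \<beta> * h)) / \<beta> * (\<Sum>n. (c / w 0 * w n) * exp (- \<beta> * h) ^ n)"
  proof (rule step_function_laplace[OF h_pos \<beta>0])
    have e: "\<bar>c / w 0 * w n\<bar> * exp (- \<beta> * h) ^ n = \<bar>c / w 0\<bar> * (w n * exp (- \<beta> * h) ^ n)" for n
      using scale_q_pos[of n] by (simp add: abs_mult w_def)
    show "summable (\<lambda>n. \<bar>c / w 0 * w n\<bar> * exp (- \<beta> * h) ^ n)"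
      unfolding e by (rule summable_mult[OF sums_summable[OF s]])
  qed
  also have "(\<Sum>n. (c / w 0 * w n) * exp (- \<beta> * h) ^ n) = c / w 0 * (exp (\<beta> * h) / (h * (laplace_exponent \<Lambda> \<beta> - 0)))"
    unfolding mult.assoc[of "c / w 0"] by (rule sums_unique[symmetric, OF sums_mult[OF s]])
  also have "(1 - exp (- \<beta> * h)) / \<beta> * (c / w 0 * (exp (\<beta> * h) / (h * (laplace_exponent \<Lambda> \<beta> - 0))))
     = c / w 0 * (((1 - exp (- \<beta> * h)) * exp (\<beta> * h)) / (\<beta> * h * laplace_exponent \<Lambda> \<beta>))"
    by (simp add: mult_ac)
  also have "(1 - exp (- \<beta> * h)) * exp (\<beta> * h) = exp (\<beta> * h) - 1"
    by (simp add: left_diff_distrib exp_add[symmetric])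
  finally show ?thesis unfolding scale_with_const_eq w_def .
qed

lemma scale_const_eq: "scale_const M X h \<Lambda> = L.scale_q 0 0"
  unfolding scale_const_def
proof (rule the_equality)
  have w: "0 < L.scale_q 0 0" by (rule scale_q_pos)
  thus "0 < L.scale_q 0 0 \<and> (\<forall>\<beta>>Phi \<Lambda> 0. (LBINT x:{0..}. exp (- \<beta> * x) * scale_with_const M X h (L.scale_q 0 0) x)
       = (exp (\<beta> * h) - 1) / (\<beta> * h * laplace_exponent \<Lambda> \<beta>))"
    by (auto simp only: scale_laplace) simp
  fix c assume c: "0 < c \<and> (\<forall>\<beta>>Phi \<Lambda> 0. (LBINT x:{0..}. exp (- \<beta> * x) * scale_with_const M X h c x)
       = (exp (\<beta> * h) - 1) / (\<beta> * h * laplace_exponent \<Lambda> \<beta>))"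
  \<comment> \<open>The transform is proportional to \<open>c\<close> and nonzero, so a single
    admissible argument determines the constant.\<close>
  define \<beta> where "\<beta> = Phi \<Lambda> 0 + 1"
  have \<beta>: "Phi \<Lambda> 0 < \<beta>" by (simp add: \<beta>_def)
  have "0 < \<beta>" using \<beta> L.Phi_nonneg[of 0] by simp
  moreover have "0 < laplace_exponent \<Lambda> \<beta>" using L.laplace_exponent_gt[OF order_refl \<beta>] .
  ultimately have R: "(exp (\<beta> * h) - 1) / (\<beta> * h * laplace_exponent \<Lambda> \<beta>) \<noteq> 0" using h_pos by simp
  have "c / L.scale_q 0 0 * ((exp (\<beta> * h) - 1) / (\<beta> * h * laplace_exponent \<Lambda> \<beta>)) = (exp (\<beta> * h) - 1) / (\<beta> * h * laplace_exponent \<Lambda> \<beta>)"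
    using c \<beta> by (simp only: scale_laplace[symmetric])
  hence "c / L.scale_q 0 0 = 1" using R by (metis mult_right_cancel mult_1)
  thus "c = L.scale_q 0 0" using w by simp
qed

lemma scale_fun_eq: "scale_fun M X h \<Lambda> x = L.scale_q 0 (nat \<lfloor>x / h\<rfloor>)"
  unfolding scale_fun_def scale_with_const_eq scale_const_eq using scale_q_pos[of 0] by simp

end

section \<open>The functions W^(q) and Z^(q) and the transform of Z^(q)\<close>

context skip_free_levy_measure
begin

text \<open>For every realization \<open>scale_fun_eq\<close> expresses the scale function through a
  sequence depending on the Levy measure alone, so the chosen realization does not matter.\<close>

lemma tilted_scale_fun_eq:
  assumes b: "0 \<le> b"
  shows "tilted_scale_fun h \<Lambda> b x = skip_free_levy_measure.scale_q (tilt \<Lambda> b) h 0 (nat \<lfloor>x / h\<rfloor>)"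
    and "0 < skip_free_levy_measure.scale_q (tilt \<Lambda> b) h 0 n"
proof -
  interpret T: skip_free_levy_measure "tilt \<Lambda> b" h by (rule tilt_levy_measure[OF b])
  obtain N Y where NY: "chain_realization h (tilt \<Lambda> b) = (N, Y)" by (cases "chain_realization h (tilt \<Lambda> b)")
  have "upwards_skip_free_levy_chain N Y h (tilt \<Lambda> b)" using T.chain_realization by (simp add: NY)
  then interpret Y: upwards_skip_free_levy_chain N Y h "tilt \<Lambda> b" .
  show "tilted_scale_fun h \<Lambda> b x = T.scale_q 0 (nat \<lfloor>x / h\<rfloor>)"
    unfolding tilted_scale_fun_def NY by (simp add: Y.scale_fun_eq)
  show "0 < T.scale_q 0 n" by (rule Y.scale_q_pos)
qed

lemma Wq_eq:
  assumes q: "0 \<le> q" and x: "0 \<le> x"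
  shows "Wq h \<Lambda> q x = scale_q q (nat \<lfloor>x / h\<rfloor>)"
proof -
  have P: "0 \<le> Phi \<Lambda> q" by (rule Phi_nonneg[OF q])
  have "\<lfloor>1 + x / h\<rfloor> = int (Suc (nat \<lfloor>x / h\<rfloor>))" using x h_pos by simp
  thus ?thesis unfolding Wq_def tilted_scale_fun_eq(1)[OF P]
    using scale_q_tilt[OF P, of "nat \<lfloor>x / h\<rfloor>"] by (simp only: Phi(2)[OF q] of_int_of_nat_eq)
qed

text \<open>Inherited from the chain tilted by \<open>Phi \<Lambda> q\<close>, for whose scale
  sequence positivity was obtained from exit probabilities.\<close>

lemma scale_q_pos:
  assumes q: "0 \<le> q" shows "0 < scale_q q n"
  using tilted_scale_fun_eq(2)[OF Phi_nonneg[OF q], of n] scale_q_tilt[OF Phi_nonneg[OF q], of n]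
  by (simp add: Phi(2)[OF q] flip: zero_less_mult_iff) (metis exp_gt_zero mult_pos_pos)

definition Z_seq :: "real \<Rightarrow> nat \<Rightarrow> real" where "Z_seq q n = 1 + q * h * (\<Sum>k<n. scale_q q k)"

lemma Zq_eq:
  assumes q: "0 \<le> q" and x: "0 \<le> x"
  shows "Zq h \<Lambda> q x = Z_seq q (nat \<lfloor>x / h\<rfloor>)"
proof -
  have n: "of_int \<lfloor>x / h\<rfloor> * h = real (nat \<lfloor>x / h\<rfloor>) * h" using x h_pos by simp
  have "(LBINT z:{0..real (nat \<lfloor>x / h\<rfloor>) * h}. Wq h \<Lambda> q z) = (LBINT z:{0..real (nat \<lfloor>x / h\<rfloor>) * h}. scale_q q (nat \<lfloor>z / h\<rfloor>))"
    by (rule set_lebesgue_integral_cong) (auto simp: Wq_eq[OF q])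
  thus ?thesis unfolding Zq_def n step_function_integral[OF h_pos] by (simp add: Z_seq_def mult_ac)
qed

lemma Zq_laplace:
  assumes q: "0 \<le> q" and \<beta>: "Phi \<Lambda> q < \<beta>"
  shows "(LBINT x:{0..}. Zq h \<Lambda> q x * exp (- \<beta> * x)) = 1 / \<beta> * (1 + q / (laplace_exponent \<Lambda> \<beta> - q))"
proof -
  define y where "y = exp (- \<beta> * h)"
  define w where "w = scale_q q"
  have \<beta>0: "0 < \<beta>" using \<beta> Phi_nonneg[OF q] by simp
  have y: "0 < y" "y < 1" using \<beta>0 h_pos by (auto simp: y_def)
  have d: "q < laplace_exponent \<Lambda> \<beta>" by (rule laplace_exponent_gt[OF q \<beta>])
  have wp: "0 < w n" for n unfolding w_def by (rule scale_q_pos[OF q])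
  have s: "(\<lambda>n. w n * y ^ n) sums (exp (\<beta> * h) / (h * (laplace_exponent \<Lambda> \<beta> - q)))"
    unfolding w_def y_def
    by (rule scale_gen_laplace[OF q \<beta>]) (use scale_q_pos[OF q] scale_q_rec p_up_pos in \<open>auto simp: less_imp_le scale_q_0\<close>)
  have g: "(\<lambda>n. y ^ n) sums (1 / (1 - y))" by (rule geometric_sums) (use y in simp)
  \<comment> \<open>The geometric sequence without its term of index \<open>0\<close>: its Cauchy
    product with \<open>w\<close> yields the sums over \<open>k < n\<close> occurring in
    \<open>Z_seq\<close>.\<close>
  define v where "v j = (if j = 0 then 0 else y ^ j)" for j :: nat
  have "(\<lambda>n. y * y ^ n) sums (y * (1 / (1 - y)))" by (rule sums_mult[OF g])
  hence "(\<lambda>n. v (Suc n)) sums (y / (1 - y))" by (simp add: v_def)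
  hence v: "v sums (y / (1 - y))" by (subst (asm) sums_Suc_iff) (simp add: v_def)
  have v0: "0 \<le> v j" for j using y by (simp add: v_def)
  have "(\<lambda>n. \<Sum>k\<le>n. (w k * y ^ k) * v (n - k)) sums ((\<Sum>n. w n * y ^ n) * (\<Sum>n. v n))"
    by (rule Cauchy_product_sums) (use s v v0 wp y in \<open>auto simp: sums_iff abs_mult less_imp_le\<close>)
  moreover have "(\<Sum>k\<le>n. (w k * y ^ k) * v (n - k)) = (\<Sum>k<n. w k) * y ^ n" for n
  proof -
    have "(\<Sum>k\<le>n. (w k * y ^ k) * v (n - k)) = (\<Sum>k<n. (w k * y ^ k) * v (n - k))"
      by (simp add: lessThan_Suc_atMost[symmetric] v_def)
    also have "\<dots> = (\<Sum>k<n. w k * y ^ n)"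
      by (rule sum.cong) (auto simp: v_def power_add[symmetric])
    finally show ?thesis by (simp add: sum_distrib_right)
  qed
  ultimately have "(\<lambda>n. (\<Sum>k<n. w k) * y ^ n) sums (exp (\<beta> * h) / (h * (laplace_exponent \<Lambda> \<beta> - q)) * (y / (1 - y)))"
    using s v by (simp add: sums_iff)
  hence "(\<lambda>n. y ^ n + q * h * ((\<Sum>k<n. w k) * y ^ n)) sums
     (1 / (1 - y) + q * h * (exp (\<beta> * h) / (h * (laplace_exponent \<Lambda> \<beta> - q)) * (y / (1 - y))))"
    by (intro sums_add sums_mult g)
  moreover have "q * h * (exp (\<beta> * h) / (h * (laplace_exponent \<Lambda> \<beta> - q)) * (y / (1 - y))) = q / (laplace_exponent \<Lambda> \<beta> - q) * (1 / (1 - y))"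
  proof -
    have "exp (\<beta> * h) * y = 1" by (simp add: y_def exp_add[symmetric])
    hence "q * h * (exp (\<beta> * h) / (h * (laplace_exponent \<Lambda> \<beta> - q)) * (y / (1 - y))) = q * h * (1 / (h * (laplace_exponent \<Lambda> \<beta> - q)) * (1 / (1 - y)))"
      by (simp add: mult_ac)
    thus ?thesis using h_pos by simp
  qed
  ultimately have Z: "(\<lambda>n. Z_seq q n * y ^ n) sums (1 / (1 - y) * (1 + q / (laplace_exponent \<Lambda> \<beta> - q)))"
    by (simp add: Z_seq_def w_def algebra_simps)
  have Z0: "0 \<le> Z_seq q n" for n
    unfolding Z_seq_def using q h_pos scale_q_pos[OF q] by (intro add_nonneg_nonneg mult_nonneg_nonneg sum_nonneg) (auto simp: less_imp_le)
  have "(LBINT x:{0..}. Zq h \<Lambda> q x * exp (- \<beta> * x)) = (LBINT x:{0..}. exp (- \<beta> * x) * Z_seq q (nat \<lfloor>x / h\<rfloor>))"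
    by (rule set_lebesgue_integral_cong) (auto simp: Zq_eq[OF q])
  also have "\<dots> = (1 - y) / \<beta> * (\<Sum>n. Z_seq q n * y ^ n)"
    unfolding y_def
    by (rule step_function_laplace[OF h_pos \<beta>0]) (use Z Z0 in \<open>simp add: sums_iff y_def\<close>)
  also have "(\<Sum>n. Z_seq q n * y ^ n) = 1 / (1 - y) * (1 + q / (laplace_exponent \<Lambda> \<beta> - q))"
    using Z by (simp add: sums_iff)
  finally show ?thesis using y by simp
qed

end

section \<open>Passage below a level: discounted transform and ruin probability\<close>

context upwards_skip_free_levy_chain
begin

text \<open>Both sides solve the recurrence with inhomogeneity \<open>tail\<close>, so it suffices
  to compare them at \<open>0\<close>. The factor of the scale sequence,
  \<open>q * h * y / (1 - y)\<close> for \<open>y = exp (- Phi \<Lambda> q * h)\<close>, is the one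
  that fits the value found by \<open>bounded_solution_0\<close>.\<close>

lemma exit_fun_q:
  assumes q: "0 < q"
  shows "exit_fun q \<infinity> (real n * h) = L.Z_seq q n - q * h / (exp (Phi \<Lambda> q * h) - 1) * L.scale_q q n"
proof -
  define F where "F n = exit_fun q \<infinity> (real n * h)" for n
  define C where "C = q * h / (exp (Phi \<Lambda> q * h) - 1)"
  define y where "y = exp (- Phi \<Lambda> q * h)"
  have q0: "0 \<le> q" using q by simp
  have P: "0 < Phi \<Lambda> q" by (rule L.Phi_pos[OF q])
  have y: "0 < y" "y < 1" using P h_pos by (auto simp: y_def)
  have rec: "(L.lam + q) * F n = L.p_up * F (Suc n) + (\<Sum>k\<le>n. L.a_down k * F (n - k)) + L.down.tail n" for n
    unfolding F_def by (rule exit_fun_rec[OF q0]) auto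
  have F0: "F 0 = 1 - q * y / (L.p_up * (1 - y))"
  proof (rule L.down.bounded_solution_0[OF y _ _ rec])
    show "L.p_up / y + L.down.gen y = L.lam + q"
      unfolding y_def using L.laplace_exponent_gen[of "Phi \<Lambda> q"] P L.Phi(2)[OF q0] by simp
    fix n
    have "real n * h \<in> lattice_points h" using L.lattice_of_int(1)[of "int n"] by simp
    thus "\<bar>F n\<bar> \<le> 1" using exit_fun_bounds[OF q0, of \<infinity> "real n * h"] by (simp add: F_def)
  qed
  have e: "exp (Phi \<Lambda> q * h) - 1 = (1 - y) / y" using y by (simp add: y_def exp_minus field_simps)
  have "F n = L.Z_seq q n - C * L.scale_q q n"
  proof (rule recurrence_unique[where N=n and B="L.down.tail" and l="L.lam + q" and p="L.p_up" and a="L.a_down"])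
    show "F 0 = L.Z_seq q 0 - C * L.scale_q q 0"
      unfolding F0 C_def e using y h_pos L.p_up_pos by (simp add: L.Z_seq_def L.scale_q_0)
    show "(L.lam + q) * (L.Z_seq q n - C * L.scale_q q n) = L.p_up * (L.Z_seq q (Suc n) - C * L.scale_q q (Suc n))
        + (\<Sum>k\<le>n. L.a_down k * (L.Z_seq q (n - k) - C * L.scale_q q (n - k))) + L.down.tail n" for n
      unfolding L.Z_seq_def
      by (rule L.down.Z_recurrence[OF L.scale_q_rec]) (use L.p_up_pos h_pos in \<open>simp add: L.scale_q_0\<close>)
  qed (use rec L.p_up_pos in auto)
  thus ?thesis by (simp add: F_def C_def)
qed

lemma exit_lim_inf_measurable: "(\<lambda>\<omega>. exit_lim q \<infinity> x (\<lambda>t. X t \<omega>)) \<in> borel_measurable M"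
proof (rule borel_measurable_LIMSEQ_real)
  have [measurable]: "X (real i / 2 ^ m) \<in> borel_measurable M" for i m by (intro measurable_at) simp
  show "(\<lambda>\<omega>. exit_val (exp (- q / 2 ^ m)) \<infinity> x (\<lambda>k. X (real k / 2 ^ m) \<omega>)) \<in> borel_measurable M" for m
    by measurable
qed (rule exit_val_tendsto_inf)

text \<open>For \<open>n = nat \<lfloor>x / h\<rfloor>\<close> no lattice point lies in
  \<open>[- x, - n * h)\<close>, so lattice paths pass below both levels at the same times.\<close>

lemma integral_exit_lim:
  assumes q: "0 \<le> q" and x: "0 \<le> x"
  shows "(\<integral>\<omega>. exit_lim q \<infinity> x (\<lambda>t. X t \<omega>) \<partial>M) = exit_fun q \<infinity> (real (nat \<lfloor>x / h\<rfloor>) * h)"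
proof -
  define n where "n = nat \<lfloor>x / h\<rfloor>"
  have n: "real n \<le> x / h" "x / h < real n + 1" using x h_pos by (auto simp: n_def)
  have "AE \<omega> in M. exit_lim q \<infinity> x (\<lambda>t. X t \<omega>) = exit_lim q \<infinity> (real n * h) (\<lambda>t. X t \<omega>)"
    using AE_lattice_path
  proof eventually_elim
    case (elim \<omega>)
    have "x + X t \<omega> < 0 \<longleftrightarrow> real n * h + X t \<omega> < 0" if "0 \<le> t" for t
    proof -
      have "X t \<omega> \<in> lattice_points h" using elim that by simp
      then obtain k where k: "X t \<omega> = h * of_int k" by (auto simp: lattice_points_def)
      have "x + X t \<omega> < 0 \<longleftrightarrow> x / h < of_int (- k)" unfolding k using h_pos by (simp add: field_simps) linarith
      also have "\<dots> \<longleftrightarrow> int n < - k"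
      proof
        assume "x / h < of_int (- k)"
        hence "real n < of_int (- k)" using n by linarith
        thus "int n < - k" by linarith
      next
        assume "int n < - k"
        hence "int n + 1 \<le> - k" by simp
        hence "real n + 1 \<le> of_int (- k)" by linarith
        thus "x / h < of_int (- k)" using n by linarith
      qed
      also have "\<dots> \<longleftrightarrow> h * (real n + of_int k) < 0" using h_pos by (simp add: mult_less_0_iff) linarith
      finally show ?thesis unfolding k by (simp add: algebra_simps)
    qed
    hence eq: "(0 \<le> t \<and> x + X t \<omega> < 0) = (0 \<le> t \<and> real n * h + X t \<omega> < 0)" for t by auto
    show ?case unfolding exit_lim_def eq conj_assoc[symmetric] by simp
  qed
  hence "(\<integral>\<omega>. exit_lim q \<infinity> x (\<lambda>t. X t \<omega>) \<partial>M) = (\<integral>\<omega>. exit_lim q \<infinity> (real n * h) (\<lambda>t. X t \<omega>) \<partial>M)"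
    by (intro integral_cong_AE exit_lim_inf_measurable)
  also have "\<dots> = exit_fun q \<infinity> (real n * h)"
    by (rule exit_fun_eq[symmetric, OF q exit_lim_inf_measurable]) (rule AE_I2, rule exit_val_tendsto_inf)
  finally show ?thesis by (simp add: n_def)
qed

text \<open>The two-sided probabilities are explicit; letting the barrier rise is dominated
  convergence, with one null set discarded for all \<open>N\<close> together.\<close>

lemma ruin_limit:
  "(\<lambda>N. L.scale_q 0 n / L.scale_q 0 N) \<longlonglongrightarrow> 1 - exit_fun 0 \<infinity> (real n * h)"
proof -
  let ?x = "real n * h"
  have x: "?x \<in> lattice_points h" using L.lattice_of_int(1)[of "int n"] by simp
  have b: "0 \<le> ereal (real N * h)" for N using h_pos by simp
  have "\<forall>N. \<exists>g. g \<in> borel_measurable M \<and> (AE \<omega> in M. g \<omega> = exit_lim 0 (ereal (real N * h)) ?x (\<lambda>t. X t \<omega>))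
    \<and> exit_fun 0 (ereal (real N * h)) ?x = (\<integral>\<omega>. g \<omega> \<partial>M)"
  proof
    fix N
    show "\<exists>g. g \<in> borel_measurable M \<and> (AE \<omega> in M. g \<omega> = exit_lim 0 (ereal (real N * h)) ?x (\<lambda>t. X t \<omega>))
    \<and> exit_fun 0 (ereal (real N * h)) ?x = (\<integral>\<omega>. g \<omega> \<partial>M)"
      by (rule exit_lim_measurable_version[OF x b, of 0 N]) auto
  qed
  then obtain g where g: "\<And>N. g N \<in> borel_measurable M"
    "\<And>N. AE \<omega> in M. g N \<omega> = exit_lim 0 (ereal (real N * h)) ?x (\<lambda>t. X t \<omega>)"
    "\<And>N. exit_fun 0 (ereal (real N * h)) ?x = (\<integral>\<omega>. g N \<omega> \<partial>M)" by metis
  have ae: "AE \<omega> in M. \<forall>N. g N \<omega> = exit_lim 0 (ereal (real N * h)) ?x (\<lambda>t. X t \<omega>)"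
    using g(2) by (simp add: AE_all_countable)
  have "(\<lambda>N. \<integral>\<omega>. g N \<omega> \<partial>M) \<longlonglongrightarrow> (\<integral>\<omega>. exit_lim 0 \<infinity> ?x (\<lambda>t. X t \<omega>) \<partial>M)"
  proof (rule integral_dominated_convergence[where w="\<lambda>_. 1"])
    show "AE \<omega> in M. (\<lambda>N. g N \<omega>) \<longlonglongrightarrow> exit_lim 0 \<infinity> ?x (\<lambda>t. X t \<omega>)"
      using ae AE_space
      by eventually_elim (use exit_lim_barrier_to_infinity[OF cadlag_paths h_pos] in auto)
    show "AE \<omega> in M. norm (g N \<omega>) \<le> 1" for N
      using g(2)[of N] by eventually_elim (auto simp: exit_lim_def)
  qed (use g(1) exit_lim_inf_measurable in auto)
  moreover have "(\<integral>\<omega>. exit_lim 0 \<infinity> ?x (\<lambda>t. X t \<omega>) \<partial>M) = exit_fun 0 \<infinity> ?x"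
    by (rule exit_fun_eq[symmetric, OF order_refl exit_lim_inf_measurable]) (rule AE_I2, rule exit_val_tendsto_inf)
  ultimately have "(\<lambda>N. 1 - exit_fun 0 (ereal (real N * h)) ?x) \<longlonglongrightarrow> 1 - exit_fun 0 \<infinity> ?x"
    unfolding g(3) by (auto intro!: tendsto_intros)
  moreover have "eventually (\<lambda>N. 1 - exit_fun 0 (ereal (real N * h)) ?x = L.scale_q 0 n / L.scale_q 0 N) sequentially"
    using eventually_ge_at_top[of n] by eventually_elim (rule not_exit_two_sided)
  ultimately show ?thesis by (rule Lim_transform_eventually)
qed

text \<open>Monotonicity gives convergence to the supremum, finite or not, and the limit over real
  arguments factors through \<open>nat \<lfloor>x / h\<rfloor>\<close>.\<close>

lemma scale_fun_limit_eq: "(\<lambda>N. ereal (L.scale_q 0 N)) \<longlonglongrightarrow> scale_fun_limit M X h \<Lambda>"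
proof -
  have mono: "mono (\<lambda>N. ereal (L.scale_q 0 N))" by (auto simp: mono_def scale_q_mono)
  have L: "(\<lambda>N. ereal (L.scale_q 0 N)) \<longlonglongrightarrow> (SUP N. ereal (L.scale_q 0 N))"
    using mono by (rule LIMSEQ_SUP)
  have "filterlim (\<lambda>x. x / h) at_top at_top"
    using h_pos by (simp add: filterlim_at_top_mult_tendsto_pos[OF tendsto_const _ filterlim_ident, of "1/h", simplified])
  hence "filterlim (\<lambda>x. nat \<lfloor>x / h\<rfloor>) sequentially at_top"
    by (intro filterlim_compose[OF filterlim_nat_sequentially] filterlim_compose[OF filterlim_floor_sequentially])
  hence "((\<lambda>x. ereal (scale_fun M X h \<Lambda> x)) \<longlongrightarrow> (SUP N. ereal (L.scale_q 0 N))) at_top"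
    unfolding scale_fun_eq by (rule filterlim_compose[OF L])
  hence "scale_fun_limit M X h \<Lambda> = (SUP N. ereal (L.scale_q 0 N))"
    unfolding scale_fun_limit_def by (intro tendsto_Lim) auto
  thus ?thesis using L by simp
qed

text \<open>For a finite limit, divide and compare with \<open>ruin_limit\<close>. For an infinite
  one the ratios tend to \<open>0\<close>, in accordance with division by infinity in
  \<open>ereal\<close>.\<close>

lemma scale_ratio:
  "ereal (L.scale_q 0 n) / scale_fun_limit M X h \<Lambda> = ereal (1 - exit_fun 0 \<infinity> (real n * h))"
proof -
  let ?L = "scale_fun_limit M X h \<Lambda>"
  have ge: "ereal (L.scale_q 0 0) \<le> ?L"
    by (rule LIMSEQ_le_const[OF scale_fun_limit_eq]) (auto simp: scale_q_mono)
  show ?thesis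
  proof (cases ?L)
    case (real l)
    hence "(\<lambda>N. L.scale_q 0 N) \<longlonglongrightarrow> l" using scale_fun_limit_eq by simp
    moreover have l: "0 < l" using ge real scale_q_pos[of 0] by simp
    ultimately have "(\<lambda>N. L.scale_q 0 n / L.scale_q 0 N) \<longlonglongrightarrow> L.scale_q 0 n / l" by (intro tendsto_intros) auto
    hence "L.scale_q 0 n / l = 1 - exit_fun 0 \<infinity> (real n * h)" using ruin_limit LIMSEQ_unique by blast
    thus ?thesis using real l by simp
  next
    case PInf
    hence "filterlim (\<lambda>N. L.scale_q 0 N) at_top sequentially"
      using scale_fun_limit_eq by (simp add: tendsto_PInfty_eq_at_top)
    hence "(\<lambda>N. L.scale_q 0 n / L.scale_q 0 N) \<longlonglongrightarrow> 0"
      by (intro tendsto_divide_0[OF tendsto_const] filterlim_at_top_imp_at_infinity)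
    hence "1 - exit_fun 0 \<infinity> (real n * h) = 0" using ruin_limit LIMSEQ_unique by blast
    thus ?thesis using PInf by simp
  next
    case MInf
    thus ?thesis using ge by simp
  qed
qed

lemma passage_below_transform:
  assumes x: "0 \<le> x" and q: "0 < q"
  shows "(LINT \<omega>|M. (if passage_below X x \<omega> < \<infinity> then exp (- q * real_of_ereal (passage_below X x \<omega>)) else 0))
       = Zq h \<Lambda> q x - q * h / (exp (Phi \<Lambda> q * h) - 1) * Wq h \<Lambda> q x"
  unfolding exit_lim_passage_below[symmetric]
  using q x by (simp add: integral_exit_lim exit_fun_q L.Zq_eq L.Wq_eq)

lemma passage_below_finite:
  assumes x: "0 \<le> x"
  shows "ereal (measure M {\<omega> \<in> space M. passage_below X x \<omega> < \<infinity>})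
       = 1 - ereal (scale_fun M X h \<Lambda> x) / scale_fun_limit M X h \<Lambda>"
proof -
  let ?A = "{\<omega> \<in> space M. passage_below X x \<omega> < \<infinity>}"
  have ind: "indicator ?A \<omega> = exit_lim 0 \<infinity> x (\<lambda>t. X t \<omega>)" if "\<omega> \<in> space M" for \<omega>
    using that by (simp add: exit_lim_passage_below)
  have "(indicator ?A :: 'a \<Rightarrow> real) \<in> borel_measurable M"
    using exit_lim_inf_measurable[of 0 x] by (subst measurable_cong[OF ind])
  hence "?A \<inter> space M \<in> sets M" by (rule borel_measurable_indicator_iff[THEN iffD1])
  hence "measure M ?A = (\<integral>\<omega>. indicator ?A \<omega> \<partial>M)" by (simp add: Int_absorb2)
  also have "\<dots> = (\<integral>\<omega>. exit_lim 0 \<infinity> x (\<lambda>t. X t \<omega>) \<partial>M)"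
    by (rule Bochner_Integration.integral_cong[OF refl ind])
  also have "\<dots> = exit_fun 0 \<infinity> (real (nat \<lfloor>x / h\<rfloor>) * h)" by (rule integral_exit_lim[OF order_refl x])
  finally show ?thesis unfolding scale_fun_eq scale_ratio by (simp add: one_ereal_def)
qed

end

theorem theorem4p12:
  fixes M :: "'a measure" and X :: "real \<Rightarrow> 'a \<Rightarrow> real"
    and h :: real and \<Lambda> :: "real measure"
  assumes "upwards_skip_free_levy_chain M X h \<Lambda>"
  shows "(\<forall>x\<ge>0.
           (\<forall>q>0. (LINT \<omega>|M. (if passage_below X x \<omega> < \<infinity>
                                then exp (- q * real_of_ereal (passage_below X x \<omega>)) else 0))
                   = Zq h \<Lambda> q x - q * h / (exp (Phi \<Lambda> q * h) - 1) * Wq h \<Lambda> q x)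
         \<and> ereal (measure M {\<omega> \<in> space M. passage_below X x \<omega> < \<infinity>})
             = 1 - ereal (scale_fun M X h \<Lambda> x) / scale_fun_limit M X h \<Lambda>)
       \<and> (\<forall>q\<ge>0. \<forall>\<beta>>Phi \<Lambda> q.
           (LBINT x:{0..}. Zq h \<Lambda> q x * exp (- \<beta> * x))
             = 1 / \<beta> * (1 + q / (laplace_exponent \<Lambda> \<beta> - q)))"
proof -
  interpret upwards_skip_free_levy_chain M X h \<Lambda> by (rule assms)
  show ?thesis using passage_below_transform passage_below_finite L.Zq_laplace by blast
qed

end
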